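(* Let $h_1,h_2,h_3\in\mathbb R$, $v_{12},v_{23}\in\mathbb C\setminus\{0\}$, $$H_0=\begin{pmatrix}h_1&0&0\\0&h_2&0\\0&0&h_3\end{pmatrix},\qquad V=\begin{pmatrix}0&v_{12}&0\\ \overline{v_{12}}&0&v_{23}\\0&\overline{v_{23}}&0\end{pmatrix},$$ $\omega_1=h_2-h_1$, $\omega_2=h_3-h_2$, and let $\lambda_1>\lambda_3>\lambda_2$ be real numbers, $O=\mathrm{diag}(\lambda_1,\lambda_2,\lambda_3)$, $\rho_0=\mathrm{diag}(0,0,1)$. For $T>0$ let $J_O\colon L_2([0,T],\mathbb R)\to\mathbb R$, $J_O(f)=\mathrm{Tr}[U_T^f\rho_0(U_T^f)^\dagger O]$. Then for all sufficiently large $T$ (how large may depend on the system): (1) if $\omega_1\neq\omega_2$ (anharmonic system), the zero control $f_0\equiv0$ is a trap of the third order for $J_O$; (2) if $\omega_1=\omega_2\neq0$ and $|v_{12}|\neq|v_{23}|$ (controllable harmonic system), the zero control $f_0\equiv 0$ is a trap of the seventh order for $J_O$.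
   Context: For $f\in L_2([0,T],\mathbb R)$, $U_t^f$ denotes the unique absolutely continuous solution on $[0,T]$ of $i\,\frac{dU_t^f}{dt}=(H_0+f(t)V)U_t^f$, $U_0^f=\mathbb I$ (a $3\times3$ unitary matrix). Definition (trap of $n$-th order). A control $f\in L_2([0,T],\mathbb R)$ is a trap of the $n$-th order for $J_O$ if: (i) $f$ is not a point of global maximum of $J_O$; (ii) the Taylor expansion of $J_O$ at $f$ has the form $$J_O(f+\delta f)=J_O(f)+\sum_{j=2}^n\frac1{j!}J_O^{(j)}(f)(\delta f,\ldots,\delta f)+o(\|\delta f\|^n)\quad\text{as }\|\delta f\|\to0,$$ where $J_O^{(j)}(f)$ is the $j$-th Fréchet differential of $J_O$ at $f$ (so the first-order term vanishes), and the functional $R(\delta f):=\sum_{j=2}^n\frac1{j!}J_O^{(j)}(f)(\delta f,\ldots,\delta f)$ satisfies: (a) $R$ is not identically zero; (b) for every $\delta f\in L_2([0,T],\mathbb R)$ there is $\varepsilon>0$ such that $R(t\,\delta f)\le0$ for all $t\in(-\varepsilon,\varepsilon)$. *)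

theory Defs
  imports "HOL-Analysis.Analysis"
begin

section \<open>The space \<open>L\<^sub>2([0,T],\<real>)\<close>\<close>

text \<open>
  Elements of \<open>L\<^sub>2([0,T],\<real>)\<close> are represented by functions on \<^typ>\<open>real\<close>, with the
  usual \<open>L\<^sub>2\<close> seminorm; equality almost everywhere on \<open>[0,T]\<close> is distance zero.
  Values outside \<open>[0,T]\<close> are irrelevant.
\<close>

definition L2 :: "real \<Rightarrow> (real \<Rightarrow> real) set" where
  "L2 T = {f. f \<in> borel_measurable (lebesgue_on {0..T}) \<and>
              integrable (lebesgue_on {0..T}) (\<lambda>t. (f t)\<^sup>2)}"

definition L2norm :: "real \<Rightarrow> (real \<Rightarrow> real) \<Rightarrow> real" where
  "L2norm T f = sqrt (LINT t|lebesgue_on {0..T}. (f t)\<^sup>2)"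

section \<open>Higher Frechet differentials of functionals on \<open>L\<^sub>2([0,T],\<real>)\<close>\<close>

text \<open>A form of degree \<open>k\<close> takes its \<open>k\<close> arguments as a list of length \<open>k\<close>.\<close>

definition bounded_multilinear_form :: "real \<Rightarrow> nat \<Rightarrow> ((real \<Rightarrow> real) list \<Rightarrow> real) \<Rightarrow> bool" where
  "bounded_multilinear_form T k A \<longleftrightarrow>
     (\<forall>hs i g. length hs = k \<and> set hs \<subseteq> L2 T \<and> i < k \<and> g \<in> L2 T \<longrightarrow>
        A (hs[i := (\<lambda>t. (hs ! i) t + g t)]) = A hs + A (hs[i := g])) \<and>
     (\<forall>hs i c. length hs = k \<and> set hs \<subseteq> L2 T \<and> i < k \<longrightarrow>
        A (hs[i := (\<lambda>t. c * (hs ! i) t)]) = c * A hs) \<and>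
     (\<exists>C. \<forall>hs. length hs = k \<and> set hs \<subseteq> L2 T \<longrightarrow> \<bar>A hs\<bar> \<le> C * (\<Prod>h\<leftarrow>hs. L2norm T h))"

text \<open>
  \<open>A\<close> is the Frechet differential of order \<open>k\<close> of \<open>J\<close> at \<open>f\<close>: the differential of order
  \<open>Suc k\<close> at \<open>f\<close> is the Frechet derivative at \<open>f\<close>, in the operator norm on \<open>k\<close>-linear forms,
  of the differential of order \<open>k\<close>, which has to exist in a neighbourhood of \<open>f\<close>.
  This determines \<open>A\<close> on lists of length \<open>k\<close> of elements of \<^term>\<open>L2 T\<close>.
\<close>

primrec has_frechet_differential ::
  "real \<Rightarrow> ((real \<Rightarrow> real) \<Rightarrow> real) \<Rightarrow> nat \<Rightarrow> (real \<Rightarrow> real) \<Rightarrow> ((real \<Rightarrow> real) list \<Rightarrow> real) \<Rightarrow> bool"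
where
  "has_frechet_differential T J 0 f A \<longleftrightarrow> A [] = J f"
| "has_frechet_differential T J (Suc k) f A \<longleftrightarrow>
     bounded_multilinear_form T (Suc k) A \<and>
     (\<exists>D. \<exists>r>0.
        (\<forall>g\<in>L2 T. L2norm T (\<lambda>t. g t - f t) < r \<longrightarrow> has_frechet_differential T J k g (D g)) \<and>
        (\<forall>\<epsilon>>0. \<exists>\<delta>>0. \<forall>d\<in>L2 T. L2norm T d < \<delta> \<longrightarrow>
           (\<forall>hs. length hs = k \<and> set hs \<subseteq> L2 T \<longrightarrow>
              \<bar>D (\<lambda>t. f t + d t) hs - D f hs - A (d # hs)\<bar>
                \<le> \<epsilon> * L2norm T d * (\<Prod>h\<leftarrow>hs. L2norm T h))))"

section \<open>Traps\<close>

text \<open>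
  The summation over \<open>j\<close> starts at \<open>2\<close>, so the expansion forces the first-order
  differential at \<open>f\<close> to vanish.
\<close>

definition trap_of_order ::
  "nat \<Rightarrow> real \<Rightarrow> ((real \<Rightarrow> real) \<Rightarrow> real) \<Rightarrow> (real \<Rightarrow> real) \<Rightarrow> bool" where
  "trap_of_order n T J f \<longleftrightarrow>
     f \<in> L2 T \<and>
     \<not> (\<forall>g\<in>L2 T. J g \<le> J f) \<and>
     (\<exists>D R.
        (\<forall>j\<in>{1..n}. has_frechet_differential T J j f (D j)) \<and>
        (\<forall>d. R d = (\<Sum>j=2..n. D j (replicate j d) / fact j)) \<and>
        (\<forall>\<epsilon>>0. \<exists>\<delta>>0. \<forall>d\<in>L2 T. L2norm T d < \<delta> \<longrightarrow>
           \<bar>J (\<lambda>t. f t + d t) - (J f + R d)\<bar> \<le> \<epsilon> * L2norm T d ^ n) \<and>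
        (\<exists>d\<in>L2 T. R d \<noteq> 0) \<and>
        (\<forall>d\<in>L2 T. \<exists>\<epsilon>>0. \<forall>s\<in>{-\<epsilon><..<\<epsilon>}. R (\<lambda>t. s * d t) \<le> 0))"

section \<open>Controlled Schroedinger evolution and the objective functional\<close>

definition absolutely_continuous_fun_on ::
  "real set \<Rightarrow> (real \<Rightarrow> 'a::real_normed_vector) \<Rightarrow> bool" where
  "absolutely_continuous_fun_on S u \<longleftrightarrow>
     (\<forall>\<epsilon>>0. \<exists>\<delta>>0. \<forall>d t. d division_of t \<and> t \<subseteq> S \<and> (\<Sum>k\<in>d. Sup k - Inf k) < \<delta> \<longrightarrow>
        (\<Sum>k\<in>d. norm (u (Sup k) - u (Inf k))) < \<epsilon>)"

definition dagger :: "complex^'n^'m \<Rightarrow> complex^'m^'n" where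
  "dagger A = (\<chi> i j. cnj (A $ j $ i))"

text \<open>
  For a complex number \<open>c\<close>, \<^term>\<open>mat c\<close> is the scalar matrix \<open>c\<close> times identity.
  Absolutely continuous solutions satisfy the equation almost everywhere.
\<close>

definition schroedinger_solution ::
  "complex^3^3 \<Rightarrow> complex^3^3 \<Rightarrow> real \<Rightarrow> (real \<Rightarrow> real) \<Rightarrow> (real \<Rightarrow> complex^3^3) \<Rightarrow> bool" where
  "schroedinger_solution H0 V T f U \<longleftrightarrow>
     absolutely_continuous_fun_on {0..T} U \<and> U 0 = mat 1 \<and>
     (AE t in lebesgue_on {0..T}. \<exists>U'.
        (U has_vector_derivative U') (at t within {0..T}) \<and>
        mat \<i> ** U' = (H0 + f t *\<^sub>R V) ** U t)"

text \<open>Extensionality only fixes the irrelevant values outside \<open>[0,T]\<close>.\<close>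

definition propagator ::
  "complex^3^3 \<Rightarrow> complex^3^3 \<Rightarrow> real \<Rightarrow> (real \<Rightarrow> real) \<Rightarrow> real \<Rightarrow> complex^3^3" where
  "propagator H0 V T f =
     (THE U. U \<in> extensional {0..T} \<and> schroedinger_solution H0 V T f U)"

text \<open>The trace below is real for Hermitian \<open>\<rho>0\<close> and \<open>Obs\<close>.\<close>

definition objective ::
  "complex^3^3 \<Rightarrow> complex^3^3 \<Rightarrow> complex^3^3 \<Rightarrow> complex^3^3 \<Rightarrow> real \<Rightarrow> (real \<Rightarrow> real) \<Rightarrow> real" where
  "objective H0 V \<rho>0 Obs T f =
     (let U = propagator H0 V T f T in Re (trace (U ** \<rho>0 ** dagger U ** Obs)))"

definition diag3 :: "real \<Rightarrow> real \<Rightarrow> real \<Rightarrow> complex^3^3" where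
  "diag3 a b c = vector [vector [of_real a, 0, 0],
                         vector [0, of_real b, 0],
                         vector [0, 0, of_real c]]"

definition coupling :: "complex \<Rightarrow> complex \<Rightarrow> complex^3^3" where
  "coupling v12 v23 = vector [vector [0, v12, 0],
                              vector [cnj v12, 0, v23],
                              vector [0, cnj v23, 0]]"

end

(*
  In the interaction picture the state obeys C' = f(t) B(t) C, and unitarity turns the objective
  into lam3 + (lam1 - lam3) |C_13|^2 - (lam3 - lam2) |C_23|^2 at time T.  Each application of the
  control moves the population between level 2 and the levels 1, 3, so C_23 is odd and C_13 is
  even in f.  Hence all odd differentials at 0 vanish and the second one is
  -2 (lam3 - lam2) |D_1|^2, where D_k is the k-th Dyson term of C_23: this is negative
  semidefinite, for every choice of frequencies.  If the two frequencies agree, the second order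
  term of C_13 is a multiple of D_1^2; where D_1 vanishes the order 4 term is therefore 0 and the
  order 6 term is -(lam3 - lam2) |D_3|^2.

  That 0 is not a global maximum follows, for every T > 0, from one short strong pulse f = A on
  [0, pi / (N A)], N^2 = |v12|^2 + |v23|^2: as A tends to infinity the evolution tends to
  exp(-i pi V / N), which leaves level 2 empty and level 1 populated.
*)

theory Submission
  imports Defs
begin

section \<open>Absolutely continuous functions and Lebesgue differentiation\<close>

text \<open>Two features of the definitions shape the development. The propagator is a definite
  description over absolutely continuous solutions, driven by a merely square integrable control, so
  the equation holds only almost everywhere. Existence is proved for the integral form and carried
  back by Lebesgue differentiation; uniqueness rests on the fact that an absolutely continuous
  function whose derivative vanishes almost everywhere is constant. Secondly, a differential of
  order \<open>Suc k\<close> at 0 is the derivative of the differential of order \<open>k\<close>,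
  which must therefore exist at all nearby controls. Dyson terms at 0 do not provide this: mixed
  variations of the solution are built at an arbitrary control \<open>f\<close>, with bounds uniform
  on balls, and become \<open>fact n\<close> times the Dyson terms only at \<open>f = 0\<close>.
  Finally, the sign condition on \<open>R\<close> is radial, with a threshold that may depend on the
  direction. Where the first Dyson term is nonzero, the negative quadratic term beats orders 4 and 6
  for small \<open>s\<close>, whatever their signs; only the other directions call for the structure
  of the harmonic system.\<close>

lemma absolutely_continuous_zero_derivative_imp_const:
  fixes u :: "real \<Rightarrow> 'a::real_normed_vector"
  assumes ac: "absolutely_continuous_fun_on {0..T} u"
    and N: "negligible N"
    and der: "\<And>t. t \<in> {0..T} - N \<Longrightarrow> (u has_vector_derivative 0) (at t within {0..T})"
    and b: "b \<in> {0..T}"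
  shows "u b = u 0"
proof -
  have "norm (u b - u 0) \<le> e" if "e > 0" for e
  proof -
    \<comment> \<open>Slope allowed on the intervals tagged outside \<open>N\<close>: a total length
      of at most \<open>T\<close> then costs at most \<open>e / 2\<close>. The \<open>1 + T\<close>
      keeps the quotient meaningful for \<open>T = 0\<close>.\<close>
    define c where "c = e / (2 * (1 + T))"
    have T: "0 \<le> T" using b by auto
    have c: "c > 0" using that T by (simp add: c_def)
    have "e / 2 > 0" using that by simp
    then obtain \<delta> where \<delta>: "\<delta> > 0" and "\<forall>d t. d division_of t \<and> t \<subseteq> {0..T} \<and>
        (\<Sum>k\<in>d. Sup k - Inf k) < \<delta> \<longrightarrow> (\<Sum>k\<in>d. norm (u (Sup k) - u (Inf k))) < e / 2"
      using ac unfolding absolutely_continuous_fun_on_def by blast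
    then have ac': "\<And>d t. d division_of t \<Longrightarrow> t \<subseteq> {0..T} \<Longrightarrow>
        (\<Sum>k\<in>d. Sup k - Inf k) < \<delta> \<Longrightarrow> (\<Sum>k\<in>d. norm (u (Sup k) - u (Inf k))) < e / 2"
      by blast
    have Nl: "N \<in> sets lebesgue"
      using N negligible_imp_sets by blast
    obtain G where G: "open G" "N \<subseteq> G" "G - N \<in> lmeasurable" "emeasure lebesgue (G - N) < ennreal \<delta>"
      using sets_lebesgue_outer_open[OF Nl \<delta>] by metis
    have mG: "G \<in> lmeasurable" "measure lebesgue G < \<delta>"
    proof -
      have "G = (G - N) \<union> N" using G(2) by blast
      moreover have "N \<in> lmeasurable" "measure lebesgue N = 0"
        using N negligible_iff_measure by auto
      ultimately show "G \<in> lmeasurable" using G(3) by (metis fmeasurable.Un)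
      have "measure lebesgue G \<le> measure lebesgue (G - N) + measure lebesgue N"
        using \<open>G = _\<close> G(3) \<open>N \<in> lmeasurable\<close> by (metis measure_Un_le fmeasurableD)
      moreover have "measure lebesgue (G - N) < \<delta>"
        using G(3,4) \<delta> by (simp add: emeasure_eq_measure2 ennreal_less_iff)
      ultimately show "measure lebesgue G < \<delta>" using \<open>measure lebesgue N = 0\<close> by linarith
    qed
    have "\<exists>r>0. \<forall>y\<in>{0..T}. dist y t < r \<longrightarrow> norm (u y - u t) \<le> c * \<bar>y - t\<bar>" if "t \<in> {0..T} - N" for t
      using der[OF that] c unfolding has_vector_derivative_def has_derivative_within_alt
      by (auto simp: dist_real_def)
    then obtain r where r: "\<And>t. t \<in> {0..T} - N \<Longrightarrow> r t > 0"
       "\<And>t y. t \<in> {0..T} - N \<Longrightarrow> y \<in> {0..T} \<Longrightarrow> dist y t < r t \<Longrightarrow> norm (u y - u t) \<le> c * \<bar>y - t\<bar>"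
      by metis
    \<comment> \<open>A fine division falls into two families. Intervals tagged in \<open>N\<close>
      lie inside \<open>G\<close>, so their total length is below \<open>\<delta>\<close> and
      absolute continuity bounds their increments; all others are short enough for the vanishing
      derivative at the tag to do so.\<close>
    define \<gamma> where "\<gamma> t = (if t \<in> N then G else if t \<in> {0..T} then ball t (r t) else ball t 1)" for t
    have "gauge \<gamma>"
      unfolding gauge_def \<gamma>_def using G r(1) by auto
    then obtain p where p: "p tagged_division_of {0..b}" and fine: "\<gamma> fine p"
      using fine_division_exists_real by blast
    have pK: "\<And>x K. (x,K) \<in> p \<Longrightarrow> \<exists>l m. K = {l..m} \<and> l \<le> x \<and> x \<le> m \<and> 0 \<le> l \<and> m \<le> T \<and> {l..m} \<subseteq> \<gamma> x"
    proof -
      fix x K assume xK: "(x,K) \<in> p"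
      obtain l m where K: "K = {l..m}" using p xK by (metis tagged_division_ofD(4) box_real(2))
      have "x \<in> K" "K \<subseteq> {0..b}" using p xK tagged_division_ofD by blast+
      moreover have "K \<subseteq> \<gamma> x" using fine xK by (auto simp: fine_def)
      ultimately show "\<exists>l m. K = {l..m} \<and> l \<le> x \<and> x \<le> m \<and> 0 \<le> l \<and> m \<le> T \<and> {l..m} \<subseteq> \<gamma> x"
        using K b by (intro exI[of _ l] exI[of _ m]) auto
    qed
    have fin: "finite p" using p by blast
    define p1 where "p1 = {(x,K) \<in> p. x \<in> N}"
    define p2 where "p2 = p - p1"
    have p1p: "p1 \<subseteq> p" by (auto simp: p1_def)
    have p1pd: "p1 tagged_partial_division_of {0..b}"
      by (rule tagged_partial_division_subset[OF _ p1p]) (use p in \<open>simp add: tagged_division_of_def\<close>)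
    have "u b - u 0 = (\<Sum>(x,K)\<in>p. u (Sup K) - u (Inf K))"
      using additive_tagged_division_1[OF _ p, of u] b by simp
    also have "\<dots> = (\<Sum>(x,K)\<in>p1. u (Sup K) - u (Inf K)) + (\<Sum>(x,K)\<in>p2. u (Sup K) - u (Inf K))"
      unfolding p2_def using sum.subset_diff[OF p1p fin] by (simp add: add.commute)
    finally have split: "u b - u 0 = \<dots>" .
    have 2: "norm (\<Sum>(x,K)\<in>p2. u (Sup K) - u (Inf K)) \<le> e / 2"
    proof -
      have "norm (\<Sum>(x,K)\<in>p2. u (Sup K) - u (Inf K)) \<le> (\<Sum>(x,K)\<in>p2. c * measure lborel K)"
      proof (rule sum_norm_le, clarify)
        fix x K assume xK: "(x,K) \<in> p2"
        then obtain l m where K: "K = {l..m}" "l \<le> x" "x \<le> m" "0 \<le> l" "m \<le> T" "{l..m} \<subseteq> \<gamma> x"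
          using pK p2_def by blast
        have x: "x \<in> {0..T} - N" using xK K by (auto simp: p1_def p2_def)
        have "{l..m} \<subseteq> ball x (r x)" using K(6) x by (auto simp: \<gamma>_def)
        then have "dist l x < r x" "dist m x < r x" using K by (auto simp: dist_commute subset_iff)
        then have "norm (u l - u x) \<le> c * \<bar>l - x\<bar>" "norm (u m - u x) \<le> c * \<bar>m - x\<bar>"
          using r(2)[OF x, of l] r(2)[OF x, of m] K by auto
        moreover have "norm (u m - u l) \<le> norm (u m - u x) + norm (u l - u x)"
          by (metis norm_triangle_ineq4 diff_diff_eq2 diff_add_cancel)
        moreover have "c * \<bar>l - x\<bar> + c * \<bar>m - x\<bar> = c * (m - l)"
          using K by (simp add: algebra_simps)
        ultimately have "norm (u m - u l) \<le> c * (m - l)" by linarith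
        then show "norm (u (Sup K) - u (Inf K)) \<le> c * measure lborel K"
          using K by simp
      qed
      also have "\<dots> \<le> (\<Sum>(x,K)\<in>p. c * measure lborel K)"
        by (rule sum_mono2[OF fin]) (use c in \<open>auto simp: p2_def\<close>)
      also have "\<dots> = c * (\<Sum>(x,K)\<in>p. measure lborel K)"
        by (simp add: sum_distrib_left case_prod_unfold)
      also have "(\<Sum>(x,K)\<in>p. measure lborel K) = b"
        using additive_content_tagged_division[of p 0 b] p b by simp
      also have "c * b \<le> e / 2"
      proof -
        have "c * b \<le> c * (1 + T)" using c b by (intro mult_left_mono) auto
        also have "\<dots> = e / 2" using T by (simp add: c_def divide_simps)
        finally show ?thesis .
      qed
      finally show ?thesis .
    qed
    have 1: "norm (\<Sum>(x,K)\<in>p1. u (Sup K) - u (Inf K)) \<le> e / 2"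
    proof -
      have div: "snd ` p1 division_of \<Union>(snd ` p1)"
        using p1pd by (rule partial_division_of_tagged_division)
      have cont: "Sup K - Inf K = measure lebesgue K" if "K \<in> snd ` p1" for K
        using that pK p1p by fastforce
      have "(\<Sum>K\<in>snd ` p1. Sup K - Inf K) = (\<Sum>K\<in>snd ` p1. measure lebesgue K)"
        using cont by (intro sum.cong) auto
      also have "\<dots> = measure lebesgue (\<Union>(snd ` p1))"
        using content_division[OF div] by simp
      also have "\<dots> \<le> measure lebesgue G"
      proof (rule measure_mono_fmeasurable)
        show "\<Union>(snd ` p1) \<subseteq> G"
        proof clarify
          fix x y K assume "(x,K) \<in> p1" "y \<in> snd (x,K)"
          then show "y \<in> G" using pK[of x K] by (auto simp: p1_def \<gamma>_def)
        qed
        show "\<Union>(snd ` p1) \<in> sets lebesgue"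
          using div lmeasurable_division by blast
      qed (rule mG)
      finally have less: "(\<Sum>K\<in>snd ` p1. Sup K - Inf K) < \<delta>" using mG by linarith
      have sub: "\<Union>(snd ` p1) \<subseteq> {0..T}"
      proof clarify
        fix x y K assume "(x,K) \<in> p1" "y \<in> snd (x,K)"
        then show "y \<in> {0..T}" using pK[of x K] by (auto simp: p1_def)
      qed
      have "norm (\<Sum>(x,K)\<in>p1. u (Sup K) - u (Inf K)) \<le> (\<Sum>(x,K)\<in>p1. norm (u (Sup K) - u (Inf K)))"
        by (rule order_trans[OF norm_sum]) (simp add: case_prod_unfold)
      \<comment> \<open>Passing from tagged pairs to intervals merges pairs with the same interval,
        which is legitimate for summands that vanish on degenerate intervals. Points give 0 anyway;
        \<open>Sup {}\<close> and \<open>Inf {}\<close> are unspecified, hence the explicit value at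
        the empty set.\<close>
      also have "\<dots> = (\<Sum>(x,K)\<in>p1. if K = {} then 0 else norm (u (Sup K) - u (Inf K)))"
        using pK p1p by (intro sum.cong) fastforce+
      also have "\<dots> = (\<Sum>K\<in>snd ` p1. if K = {} then 0 else norm (u (Sup K) - u (Inf K)))"
      proof (rule sum.over_tagged_division_lemma[of p1 "\<Union>(snd ` p1)"])
        show "p1 tagged_division_of \<Union>(snd ` p1)"
          using p1pd tagged_partial_division_of_Union_self by blast
      qed auto
      also have "\<dots> = (\<Sum>K\<in>snd ` p1. norm (u (Sup K) - u (Inf K)))"
        using pK p1p by (intro sum.cong) fastforce+
      also have "\<dots> < e / 2" using ac'[OF div sub less] .
      finally show ?thesis by simp
    qed
    show ?thesis
      using norm_triangle_ineq[of "\<Sum>(x,K)\<in>p1. u (Sup K) - u (Inf K)" "\<Sum>(x,K)\<in>p2. u (Sup K) - u (Inf K)"] 1 2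
      unfolding split by linarith
  qed
  then have "norm (u b - u 0) \<le> 0" by (metis dense not_less)
  then show ?thesis by simp
qed

text \<open>The differentiation theorem behind this averages over boxes whose lower corner is
  \<open>x\<close>, so it sees only increments to the right. Clearing the quotient by
  \<open>h\<close> gives a form in which left and right increments can be treated alike.\<close>

lemma integral_has_vector_derivative_ae_right:
  fixes f :: "real \<Rightarrow> 'a::euclidean_space"
  assumes f: "\<And>a b. f integrable_on {a..b}"
  obtains N where "negligible N"
    "\<And>x e. x \<notin> N \<Longrightarrow> 0 < e \<Longrightarrow> \<exists>d>0. \<forall>h. 0 < h \<and> h < d \<longrightarrow>
       norm (integral {x..x+h} f - h *\<^sub>R f x) \<le> e * h"
proof -
  have "f integrable_on cbox a b" for a b
    using f by simp
  then obtain N where N: "negligible N" and *: "\<And>x e. \<lbrakk>x \<notin> N; 0 < e\<rbrakk> \<Longrightarrow>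
      \<exists>d>0. \<forall>h. 0 < h \<and> h < d \<longrightarrow> norm(integral (cbox x (x + h *\<^sub>R One)) f /\<^sub>R h ^ DIM(real) - f x) < e"
    using integrable_ccontinuous_explicit[of f] by metis
  show thesis
  proof (rule that[OF N])
    fix x e :: real assume "x \<notin> N" "0 < e"
    then obtain d where d: "d > 0" "\<And>h. 0 < h \<Longrightarrow> h < d \<Longrightarrow> norm(integral {x..x+h} f /\<^sub>R h - f x) < e"
      using *[of x e] by auto
    have "norm (integral {x..x+h} f - h *\<^sub>R f x) \<le> e * h" if "0 < h" "h < d" for h
    proof -
      have "integral {x..x+h} f - h *\<^sub>R f x = h *\<^sub>R (integral {x..x+h} f /\<^sub>R h - f x)"
        using that by (simp add: algebra_simps)
      then have "norm (integral {x..x+h} f - h *\<^sub>R f x) = h * norm (integral {x..x+h} f /\<^sub>R h - f x)"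
        using that by simp
      then show ?thesis using d(2)[OF that] that by (simp add: mult.commute mult_left_mono)
    qed
    then show "\<exists>d>0. \<forall>h. 0 < h \<and> h < d \<longrightarrow> norm (integral {x..x+h} f - h *\<^sub>R f x) \<le> e * h"
      using d(1) by blast
  qed
qed

text \<open>Increments to the left of \<open>t\<close> are increments to the right of
  \<open>- t\<close> for the reflected integrand, so the exceptional set is \<open>N1\<close>
  together with the mirror image of \<open>N2\<close>. Extension by 0 makes \<open>f\<close>
  integrable on every interval, as both applications demand.\<close>

lemma integral_has_vector_derivative_ae:
  fixes g :: "real \<Rightarrow> 'a::euclidean_space"
  assumes g: "g absolutely_integrable_on {0..T}"
  obtains N where "negligible N"
    "\<And>t. t \<in> {0..T} - N \<Longrightarrow> ((\<lambda>t. integral {0..t} g) has_vector_derivative g t) (at t within {0..T})"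
proof -
  define f where "f t = (if t \<in> {0..T} then g t else 0)" for t
  have f: "f integrable_on {a..b}" for a b
  proof -
    have "(\<lambda>t. if t \<in> {0..T} then g t else 0) absolutely_integrable_on UNIV"
      using g by (simp only: absolutely_integrable_restrict_UNIV)
    moreover have "f = (\<lambda>t. if t \<in> {0..T} then g t else 0)"
      by (auto simp: f_def fun_eq_iff)
    ultimately have "f integrable_on UNIV"
      using set_lebesgue_integral_eq_integral(1) by metis
    then show ?thesis
      by (rule integrable_on_subinterval) auto
  qed
  have f': "(\<lambda>t. f (- t)) integrable_on {a..b}" for a b
    by (subst Henstock_Kurzweil_Integration.integrable_reflect_real[symmetric]) (use f in simp)
  obtain N1 where N1: "negligible N1"
    "\<And>x e. x \<notin> N1 \<Longrightarrow> 0 < e \<Longrightarrow> \<exists>d>0. \<forall>h. 0 < h \<and> h < d \<longrightarrow>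
       norm (integral {x..x+h} f - h *\<^sub>R f x) \<le> e * h"
    using integral_has_vector_derivative_ae_right[of f] f by blast
  obtain N2 where N2: "negligible N2"
    "\<And>x e. x \<notin> N2 \<Longrightarrow> 0 < e \<Longrightarrow> \<exists>d>0. \<forall>h. 0 < h \<and> h < d \<longrightarrow>
       norm (integral {x..x+h} (\<lambda>t. f (- t)) - h *\<^sub>R f (- x)) \<le> e * h"
    using integral_has_vector_derivative_ae_right[of "\<lambda>t. f (- t)"] f' by blast
  define N where "N = N1 \<union> uminus ` N2"
  have neg: "negligible N"
    unfolding N_def using N1(1) N2(1) by (auto intro!: negligible_differentiable_image_negligible derivative_intros)
  show thesis
  proof (rule that[OF neg])
    fix t assume t: "t \<in> {0..T} - N"
    have int: "g integrable_on {a..b}" if "0 \<le> a" "b \<le> T" for a b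
      using g that by (meson absolutely_integrable_on_subinterval atLeastatMost_subset_iff set_lebesgue_integral_eq_integral(1))
    have eqf: "integral {a..b} f = integral {a..b} g" if "0 \<le> a" "b \<le> T" for a b
      using that by (intro integral_cong) (auto simp: f_def)
    show "((\<lambda>t. integral {0..t} g) has_vector_derivative g t) (at t within {0..T})"
      unfolding has_vector_derivative_def has_derivative_within_alt
    proof (intro conjI allI impI bounded_linear_scaleR_left)
      fix e :: real assume e: "0 < e"
      have "t \<notin> N1" "- t \<notin> N2" using t by (auto simp: N_def image_iff)
      obtain d1 where d1: "d1 > 0" "\<And>h. 0 < h \<Longrightarrow> h < d1 \<Longrightarrow> norm (integral {t..t+h} f - h *\<^sub>R f t) \<le> e * h"
        using N1(2)[OF \<open>t \<notin> N1\<close> e] by auto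
      obtain d2 where d2: "d2 > 0" "\<And>h. 0 < h \<Longrightarrow> h < d2 \<Longrightarrow>
          norm (integral {-t..-t+h} (\<lambda>t. f (- t)) - h *\<^sub>R f t) \<le> e * h"
        using N2(2)[OF \<open>- t \<notin> N2\<close> e] by auto
      have ft: "f t = g t" using t by (simp add: f_def)
      show "\<exists>d>0. \<forall>y\<in>{0..T}. norm (y - t) < d \<longrightarrow>
          norm (integral {0..y} g - integral {0..t} g - (y - t) *\<^sub>R g t) \<le> e * norm (y - t)"
      proof (intro exI[of _ "min d1 d2"] conjI ballI impI)
        show "0 < min d1 d2" using d1 d2 by simp
        fix y assume y: "y \<in> {0..T}" "norm (y - t) < min d1 d2"
        consider "y = t" | "y > t" | "y < t" by linarith
        then show "norm (integral {0..y} g - integral {0..t} g - (y - t) *\<^sub>R g t) \<le> e * norm (y - t)"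
        proof cases
          case 2
          have "integral {0..t} g + integral {t..y} g = integral {0..y} g"
            using 2 t y by (intro Henstock_Kurzweil_Integration.integral_combine int) auto
          moreover have "norm (integral {t..t+(y-t)} f - (y-t) *\<^sub>R f t) \<le> e * (y - t)"
            using 2 y by (intro d1) auto
          moreover have "integral {0..y} g - integral {0..t} g - (y - t) *\<^sub>R g t = integral {t..y} g - (y-t) *\<^sub>R g t"
            using calculation(1) by (simp add: algebra_simps)
          ultimately show ?thesis using 2 t y ft by (simp add: eqf)
        next
          case 3
          have "integral {0..y} g + integral {y..t} g = integral {0..t} g"
            using 3 t y by (intro Henstock_Kurzweil_Integration.integral_combine int) auto
          moreover have "norm (integral {-t..-t+(t-y)} (\<lambda>t. f (- t)) - (t-y) *\<^sub>R f t) \<le> e * (t - y)"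
            using 3 y by (intro d2) auto
          moreover have "integral {-t..-t+(t-y)} (\<lambda>t. f (- t)) = integral {y..t} g"
            using 3 t y eqf[of y t] by simp
          moreover have "integral {0..y} g - integral {0..t} g - (y - t) *\<^sub>R g t = - (integral {y..t} g - (t-y) *\<^sub>R g t)"
            using calculation(1) by (simp add: algebra_simps)
          ultimately show ?thesis using 3 ft by (metis norm_minus_cancel norm_minus_commute real_norm_def abs_of_pos diff_gt_0_iff_gt)
        qed simp
      qed
    qed
  qed
qed

section \<open>Square integrable controls and Volterra equations\<close>

lemma L2_measurable: "f \<in> L2 T \<Longrightarrow> f \<in> borel_measurable (lebesgue_on {0..T})"
  by (simp add: L2_def)

lemma L2_square_integrable:
  assumes "f \<in> L2 T" "0 \<le> a" "b \<le> T"
  shows "(\<lambda>t. (f t)\<^sup>2) integrable_on {a..b}"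
proof -
  have "(\<lambda>t. (f t)\<^sup>2) integrable_on {0..T}"
    using assms by (auto simp: L2_def intro: integrable_on_lebesgue_on)
  then show ?thesis
    by (rule integrable_on_subinterval) (use assms in auto)
qed

lemma L2I:
  assumes "f \<in> borel_measurable (lebesgue_on {0..T})" "(\<lambda>t. (f t)\<^sup>2) integrable_on {0..T}"
  shows "f \<in> L2 T"
proof -
  have "(\<lambda>t. (f t)\<^sup>2) absolutely_integrable_on {0..T}"
    using assms by (intro nonnegative_absolutely_integrable_1) auto
  then show ?thesis
    using assms by (simp add: L2_def set_integrable_def integrable_restrict_space)
qed

lemma L2norm_power2:
  assumes "f \<in> L2 T"
  shows "(L2norm T f)\<^sup>2 = integral {0..T} (\<lambda>t. (f t)\<^sup>2)"
proof -
  have "integral\<^sup>L (lebesgue_on {0..T}) (\<lambda>t. (f t)\<^sup>2) = integral {0..T} (\<lambda>t. (f t)\<^sup>2)"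
    using assms by (intro lebesgue_integral_eq_integral) (auto simp: L2_def)
  moreover have "integral\<^sup>L (lebesgue_on {0..T}) (\<lambda>t. (f t)\<^sup>2) \<ge> 0" by simp
  ultimately show ?thesis by (simp add: L2norm_def)
qed

lemma L2norm_nonneg [simp]: "0 \<le> L2norm T f"
  by (simp add: L2norm_def)

lemma L2_add: assumes "f \<in> L2 T" "g \<in> L2 T" shows "(\<lambda>t. f t + g t) \<in> L2 T"
proof (rule L2I)
  show m: "(\<lambda>t. f t + g t) \<in> borel_measurable (lebesgue_on {0..T})"
    using assms by (auto simp: L2_def)
  have "(\<lambda>t. (f t + g t)\<^sup>2) absolutely_integrable_on {0..T}"
  proof (rule measurable_bounded_by_integrable_imp_absolutely_integrable)
    show "(\<lambda>t. 2 * (f t)\<^sup>2 + 2 * (g t)\<^sup>2) integrable_on {0..T}"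
      using assms by (intro integrable_add integrable_on_mult_right L2_square_integrable) auto
    fix t
    have "0 \<le> (f t - g t)\<^sup>2" by simp
    then have "(f t + g t)\<^sup>2 \<le> 2 * (f t)\<^sup>2 + 2 * (g t)\<^sup>2"
      by (simp add: power2_eq_square algebra_simps)
    then show "norm ((f t + g t)\<^sup>2) \<le> 2 * (f t)\<^sup>2 + 2 * (g t)\<^sup>2" by simp
  qed (use m in auto)
  then show "(\<lambda>t. (f t + g t)\<^sup>2) integrable_on {0..T}"
    using set_lebesgue_integral_eq_integral(1) by blast
qed

lemma L2_cmult: assumes "f \<in> L2 T" shows "(\<lambda>t. c * f t) \<in> L2 T"
  using assms by (auto simp: L2_def power_mult_distrib)

lemma L2_bounded:
  assumes "f \<in> borel_measurable (lebesgue_on {0..T})" "\<And>t. t \<in> {0..T} \<Longrightarrow> \<bar>f t\<bar> \<le> K"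
  shows "f \<in> L2 T"
proof (rule L2I[OF assms(1)])
  have "(\<lambda>t. (f t)\<^sup>2) absolutely_integrable_on {0..T}"
  proof (rule measurable_bounded_by_integrable_imp_absolutely_integrable)
    show "norm ((f t)\<^sup>2) \<le> K\<^sup>2" if "t \<in> {0..T}" for t
      using assms(2)[OF that] power_mono[of "\<bar>f t\<bar>" K 2] by simp
  qed (use assms in auto)
  then show "(\<lambda>t. (f t)\<^sup>2) integrable_on {0..T}"
    using set_lebesgue_integral_eq_integral(1) by blast
qed

lemma L2_continuous: "continuous_on {0..T} f \<Longrightarrow> f \<in> L2 T"
  by (intro L2I continuous_imp_measurable_on_sets_lebesgue integrable_continuous_real continuous_intros) auto

text \<open>A crude triangle inequality, straight from
  \<open>(a + b)^2 \<le> 2 * a^2 + 2 * b^2\<close>; its purpose is to keep \<open>f + d\<close> in a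
  ball of fixed radius.\<close>

lemma L2norm_add_le:
  assumes "f \<in> L2 T" "g \<in> L2 T"
  shows "L2norm T (\<lambda>t. f t + g t) \<le> 2 * (L2norm T f + L2norm T g)"
proof (rule power2_le_imp_le)
  have "(L2norm T (\<lambda>t. f t + g t))\<^sup>2 = integral {0..T} (\<lambda>t. (f t + g t)\<^sup>2)"
    by (rule L2norm_power2[OF L2_add[OF assms]])
  also have "\<dots> \<le> integral {0..T} (\<lambda>t. 2 * (f t)\<^sup>2 + 2 * (g t)\<^sup>2)"
  proof (rule integral_le)
    fix t
    have "0 \<le> (f t - g t)\<^sup>2" by simp
    then show "(f t + g t)\<^sup>2 \<le> 2 * (f t)\<^sup>2 + 2 * (g t)\<^sup>2"
      by (simp add: power2_eq_square algebra_simps)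
  qed (use assms L2_add[OF assms] in \<open>auto intro!: integrable_add integrable_on_mult_right L2_square_integrable\<close>)
  also have "\<dots> = 2 * (L2norm T f)\<^sup>2 + 2 * (L2norm T g)\<^sup>2"
    using assms by (subst integral_add)
      (auto simp: L2norm_power2 intro!: integrable_on_mult_right L2_square_integrable)
  also have "\<dots> \<le> (2 * (L2norm T f + L2norm T g))\<^sup>2"
    by (simp add: power2_eq_square algebra_simps)
  finally show "(L2norm T (\<lambda>t. f t + g t))\<^sup>2 \<le> (2 * (L2norm T f + L2norm T g))\<^sup>2" .
qed simp

lemma continuous_on_interval_norm_bound:
  fixes y :: "real \<Rightarrow> 'a::real_normed_vector"
  assumes "continuous_on {a..b} y"
  obtains K where "0 < K" "\<And>s. s \<in> {a..b} \<Longrightarrow> norm (y s) \<le> K"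
proof -
  have "bounded (y ` {a..b})"
    using assms compact_continuous_image compact_imp_bounded by blast
  then obtain K where "0 < K" "\<forall>x\<in>y ` {a..b}. norm x \<le> K"
    using bounded_pos by blast
  then show thesis using that[of K] by simp
qed

text \<open>On a bounded interval square integrability implies integrability through
  \<open>\<bar>f s\<bar> \<le> 1 + (f s)^2\<close>, which supplies the dominating function.\<close>

lemma L2_scaleR_continuous:
  fixes y :: "real \<Rightarrow> 'a::euclidean_space"
  assumes f: "f \<in> L2 T" and y: "continuous_on {0..T} y"
  shows "(\<lambda>s. f s *\<^sub>R y s) absolutely_integrable_on {0..T}"
proof -
  obtain K where K: "K > 0" "\<And>s. s \<in> {0..T} \<Longrightarrow> norm (y s) \<le> K"
    using continuous_on_interval_norm_bound[OF y] by blast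
  show ?thesis
  proof (rule measurable_bounded_by_integrable_imp_absolutely_integrable)
    show "(\<lambda>s. f s *\<^sub>R y s) \<in> borel_measurable (lebesgue_on {0..T})"
      using L2_measurable[OF f] continuous_imp_measurable_on_sets_lebesgue[OF y] by auto
    show "(\<lambda>s. K * (1 + (f s)\<^sup>2)) integrable_on {0..T}"
      using f by (intro integrable_on_mult_right integrable_add L2_square_integrable) auto
    fix s assume s: "s \<in> {0..T}"
    have "0 \<le> (\<bar>f s\<bar> - 1)\<^sup>2" by simp
    then have "\<bar>f s\<bar> \<le> 1 + (f s)\<^sup>2"
      by (simp add: power2_eq_square algebra_simps)
    then have "\<bar>f s\<bar> * norm (y s) \<le> (1 + (f s)\<^sup>2) * K"
      using K(2)[OF s] by (intro mult_mono) auto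
    then show "norm (f s *\<^sub>R y s) \<le> K * (1 + (f s)\<^sup>2)" by (simp add: mult.commute)
  qed auto
qed

lemma L2_scaleR_continuous_integrable:
  fixes y :: "real \<Rightarrow> 'a::euclidean_space"
  assumes f: "f \<in> L2 T" and y: "continuous_on {0..T} y" and "0 \<le> a" "b \<le> T"
  shows "(\<lambda>s. f s *\<^sub>R y s) integrable_on {a..b}"
  by (rule integrable_on_subinterval[of _ "{0..T}"])
    (use L2_scaleR_continuous[OF f y] set_lebesgue_integral_eq_integral(1) assms in auto)

lemma L2_abs: "f \<in> L2 T \<Longrightarrow> (\<lambda>t. \<bar>f t\<bar>) \<in> L2 T"
  by (auto simp: L2_def)

text \<open>Discriminant argument: the integral of \<open>(f - c * u)^2\<close> over
  \<open>{0..t}\<close> is nonnegative for every real \<open>c\<close>. The norm of \<open>f\<close>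
  is then extended to all of \<open>{0..T}\<close>, while the integral of \<open>u^2\<close> keeps
  its upper limit \<open>t\<close>, as Gronwall's argument requires.\<close>

lemma L2_Cauchy_Schwarz:
  fixes u :: "real \<Rightarrow> real"
  assumes f: "f \<in> L2 T" and u: "continuous_on {0..T} u" and t: "t \<in> {0..T}"
  shows "(integral {0..t} (\<lambda>s. f s * u s))\<^sup>2 \<le> (L2norm T f)\<^sup>2 * integral {0..t} (\<lambda>s. (u s)\<^sup>2)"
proof -
  define A P Q where "A = integral {0..t} (\<lambda>s. (f s)\<^sup>2)" and "P = integral {0..t} (\<lambda>s. f s * u s)"
    and "Q = integral {0..t} (\<lambda>s. (u s)\<^sup>2)"
  have i1: "(\<lambda>s. (f s)\<^sup>2) integrable_on {0..t}"
    using f t by (auto intro: L2_square_integrable)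
  have i2: "(\<lambda>s. f s * u s) integrable_on {0..t}"
    using L2_scaleR_continuous_integrable[OF f u, of 0 t] t by auto
  have i3: "(\<lambda>s. (u s)\<^sup>2) integrable_on {0..t}"
    by (intro integrable_continuous_real continuous_intros continuous_on_subset[OF u]) (use t in auto)
  have quad: "A - 2 * c * P + c\<^sup>2 * Q \<ge> 0" for c
  proof -
    have "((\<lambda>s. (f s)\<^sup>2 - 2 * c * (f s * u s) + c\<^sup>2 * (u s)\<^sup>2) has_integral A - 2 * c * P + c\<^sup>2 * Q) {0..t}"
      unfolding A_def P_def Q_def
      by (intro has_integral_add has_integral_diff has_integral_mult_right integrable_integral i1 i2 i3)
    moreover have "(f s)\<^sup>2 - 2 * c * (f s * u s) + c\<^sup>2 * (u s)\<^sup>2 = (f s - c * u s)\<^sup>2" for s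
      by (simp add: power2_eq_square algebra_simps)
    ultimately show ?thesis by (metis (mono_tags, lifting) has_integral_nonneg zero_le_power2)
  qed
  have Q: "Q \<ge> 0" unfolding Q_def by (intro integral_nonneg i3) auto
  have "P\<^sup>2 \<le> A * Q"
  proof (cases "Q = 0")
    case True
    have "P = 0"
    proof (rule ccontr)
      assume "P \<noteq> 0"
      \<comment> \<open>With \<open>Q = 0\<close> the quadratic is affine in \<open>c\<close>; this
        choice gives it the value \<open>- 1\<close>.\<close>
      then show False using quad[of "(A + 1) / (2 * P)"] True by simp
    qed
    then show ?thesis using True by simp
  next
    case False
    then have "Q > 0" using Q by simp
    have "0 \<le> (A - 2 * (P / Q) * P + (P / Q)\<^sup>2 * Q) * Q"
      using quad[of "P / Q"] Q by (intro mult_nonneg_nonneg)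
    also have "\<dots> = A * Q - P\<^sup>2"
      using \<open>Q > 0\<close> by (simp add: power2_eq_square field_simps)
    finally show ?thesis by simp
  qed
  also have "A * Q \<le> (L2norm T f)\<^sup>2 * Q"
  proof (rule mult_right_mono[OF _ Q])
    show "A \<le> (L2norm T f)\<^sup>2"
      unfolding A_def L2norm_power2[OF f]
      by (rule integral_subset_le) (use t f in \<open>auto intro!: L2_square_integrable\<close>)
  qed
  finally show ?thesis by (simp add: P_def Q_def)
qed

section \<open>Gronwall inequalities with constant and with square integrable kernel\<close>

lemma Gronwall_integral:
  fixes w :: "real \<Rightarrow> real"
  assumes w: "continuous_on {0..T} w" and le: "\<And>t. t \<in> {0..T} \<Longrightarrow> w t \<le> a + c * integral {0..t} w"
    and c: "c \<ge> 0" and t: "t \<in> {0..T}"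
  shows "w t \<le> a * exp (c * t)"
proof -
  define W where "W t = integral {0..t} w" for t
  have W: "(W has_vector_derivative w s) (at s within {0..t})" if "s \<in> {0..t}" for s
    unfolding W_def [abs_def] using that t
    by (intro has_vector_derivative_within_subset[OF integral_has_vector_derivative[OF w]]) auto
  \<comment> \<open>Integrating factor: the derivative is a nonnegative multiple of
    \<open>w s - (a + c * W s)\<close>, which \<open>le\<close> makes nonpositive, so the function
    cannot exceed its initial value \<open>a\<close>.\<close>
  have "((\<lambda>s. exp (- (c * s)) * (a + c * W s)) has_vector_derivative
       exp (- (c * s)) * (c * (w s - (a + c * W s)))) (at s within {0..t})" if "s \<in> {0..t}" for s
    using W[OF that] unfolding has_real_derivative_iff_has_vector_derivative[symmetric]
    by (auto intro!: derivative_eq_intros simp: algebra_simps)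
  then have "((\<lambda>s. exp (- (c * s)) * (c * (w s - (a + c * W s)))) has_integral
      exp (- (c * t)) * (a + c * W t) - exp (- (c * 0)) * (a + c * W 0)) {0..t}"
    using t by (intro fundamental_theorem_of_calculus) auto
  then have "exp (- (c * t)) * (a + c * W t) - exp (- (c * 0)) * (a + c * W 0) \<le> 0"
  proof (rule has_integral_le[OF _ has_integral_0])
    show "exp (- (c * s)) * (c * (w s - (a + c * W s))) \<le> 0" if "s \<in> {0..t}" for s
      using le[of s] that t c by (auto simp: W_def mult_nonneg_nonpos)
  qed
  then have "exp (- (c * t)) * (a + c * W t) \<le> a"
    by (simp add: W_def)
  then have "exp (c * t) * (exp (- (c * t)) * (a + c * W t)) \<le> exp (c * t) * a"
    by (intro mult_left_mono) auto
  then have "a + c * W t \<le> a * exp (c * t)"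
    by (simp add: mult.assoc[symmetric] exp_minus mult.commute)
  then show ?thesis using le[OF t] by (simp add: W_def)
qed

text \<open>Squaring and Cauchy-Schwarz reduce the \<open>L\<^sub>2\<close> kernel to a constant one.\<close>

lemma Gronwall_L2:
  assumes f: "f \<in> L2 T" and u: "continuous_on {0..T} u"
    and le: "\<And>t. t \<in> {0..T} \<Longrightarrow> 0 \<le> u t \<and> u t \<le> G + M * integral {0..t} (\<lambda>s. \<bar>f s\<bar> * u s)"
    and M: "M \<ge> 0" and r: "L2norm T f \<le> r" and t: "t \<in> {0..T}"
  shows "u t \<le> sqrt 2 * exp (M\<^sup>2 * r\<^sup>2 * T) * G"
proof -
  have T: "0 \<le> T" using t by auto
  have G: "G \<ge> 0" using le[of 0] T by simp
  have r0: "r \<ge> 0" using r L2norm_nonneg order_trans by blast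
  have "(u s)\<^sup>2 \<le> 2 * G\<^sup>2 + (2 * M\<^sup>2 * r\<^sup>2) * integral {0..s} (\<lambda>s. (u s)\<^sup>2)" if s: "s \<in> {0..T}" for s
  proof -
    define P where "P = integral {0..s} (\<lambda>s. \<bar>f s\<bar> * u s)"
    have "(u s)\<^sup>2 \<le> (G + M * P)\<^sup>2"
      using le[OF s] unfolding P_def by (intro power_mono) auto
    also have "\<dots> \<le> 2 * G\<^sup>2 + 2 * M\<^sup>2 * P\<^sup>2"
    proof -
      have "0 \<le> (G - M * P)\<^sup>2" by simp
      then show ?thesis by (simp add: power2_eq_square algebra_simps)
    qed
    also have "P\<^sup>2 \<le> r\<^sup>2 * integral {0..s} (\<lambda>s. (u s)\<^sup>2)"
    proof -
      have "P\<^sup>2 \<le> (L2norm T (\<lambda>t. \<bar>f t\<bar>))\<^sup>2 * integral {0..s} (\<lambda>s. (u s)\<^sup>2)"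
        unfolding P_def by (rule L2_Cauchy_Schwarz[OF L2_abs[OF f] u s])
      also have "L2norm T (\<lambda>t. \<bar>f t\<bar>) = L2norm T f" by (simp add: L2norm_def)
      also have "(L2norm T f)\<^sup>2 * integral {0..s} (\<lambda>s. (u s)\<^sup>2) \<le> r\<^sup>2 * integral {0..s} (\<lambda>s. (u s)\<^sup>2)"
      proof (intro mult_right_mono power_mono r L2norm_nonneg integral_nonneg)
        show "(\<lambda>s. (u s)\<^sup>2) integrable_on {0..s}"
          by (intro integrable_continuous_real continuous_intros continuous_on_subset[OF u]) (use s in auto)
      qed auto
      finally show ?thesis .
    qed
    finally show ?thesis by (simp add: mult_left_mono mult.assoc)
  qed
  then have "(u t)\<^sup>2 \<le> 2 * G\<^sup>2 * exp (2 * M\<^sup>2 * r\<^sup>2 * t)"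
    by (intro Gronwall_integral[OF _ _ _ t] continuous_intros u) auto
  also have "\<dots> \<le> 2 * G\<^sup>2 * exp (2 * M\<^sup>2 * r\<^sup>2 * T)"
    using t by (intro mult_left_mono) (auto intro!: mult_left_mono)
  also have "\<dots> = (sqrt 2 * exp (M\<^sup>2 * r\<^sup>2 * T) * G)\<^sup>2"
    by (simp add: power_mult_distrib exp_double[symmetric] mult.assoc)
  finally show ?thesis
    by (rule power2_le_imp_le) (use G in auto)
qed

text \<open>The interaction picture equation \<open>x' = f(t) B(t) x\<close> in abstract form.
  Continuity of \<open>B\<close> is asked along continuous curves, the only arguments it meets. The
  horizon is a parameter because the pulse argument uses the same equation on a short interval
  \<open>{0..\<delta>}\<close>.\<close>

locale volterra =
  fixes T M :: real and B :: "real \<Rightarrow> 'a::euclidean_space \<Rightarrow> 'a"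
  assumes T_pos: "0 < T" and M_nonneg: "0 \<le> M"
    and linear_B: "linear (B s)"
    and norm_B: "norm (B s x) \<le> M * norm x"
    and continuous_B: "continuous_on {0..T} y \<Longrightarrow> continuous_on {0..T} (\<lambda>s. B s (y s))"
begin

definition volt :: "(real \<Rightarrow> real) \<Rightarrow> (real \<Rightarrow> 'a) \<Rightarrow> real \<Rightarrow> 'a" where
  "volt f y t = integral {0..t} (\<lambda>s. f s *\<^sub>R B s (y s))"

lemma volt_integrable:
  assumes "f \<in> L2 T" "continuous_on {0..T} y" "t \<le> T"
  shows "(\<lambda>s. f s *\<^sub>R B s (y s)) integrable_on {0..t}"
  using assms by (intro L2_scaleR_continuous_integrable[OF _ continuous_B[OF assms(2)]]) auto

lemma volt_continuous:
  assumes "f \<in> L2 T" "continuous_on {0..T} y"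
  shows "continuous_on {0..T} (volt f y)"
  unfolding volt_def [abs_def] using assms
  by (intro indefinite_integral_continuous_1 volt_integrable) auto

lemma volt_cong:
  "(\<And>s. s \<in> {0..t} \<Longrightarrow> y s = z s) \<Longrightarrow> volt f y t = volt f z t"
  unfolding volt_def by (intro integral_cong) auto

lemma volt_0 [simp]: "volt f y 0 = 0"
  by (simp add: volt_def)

lemma volt_zero_control [simp]: "volt (\<lambda>t. 0) y t = 0"
  by (simp add: volt_def)

lemma volt_add:
  assumes "f \<in> L2 T" "continuous_on {0..T} y" "continuous_on {0..T} z" "t \<le> T"
  shows "volt f (\<lambda>s. y s + z s) t = volt f y t + volt f z t"
  unfolding volt_def linear_add[OF linear_B] scaleR_add_right
  using assms by (intro integral_add volt_integrable)

lemma volt_diff: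
  assumes "f \<in> L2 T" "continuous_on {0..T} y" "continuous_on {0..T} z" "t \<le> T"
  shows "volt f (\<lambda>s. y s - z s) t = volt f y t - volt f z t"
  unfolding volt_def linear_diff[OF linear_B] scaleR_diff_right
  using assms by (intro integral_diff volt_integrable)

lemma volt_cmult: "volt f (\<lambda>s. c *\<^sub>R y s) t = c *\<^sub>R volt f y t"
  unfolding volt_def linear_cmul[OF linear_B] scaleR_left_commute[of _ c] by (simp flip: scaleR_scaleR)

lemma volt_control_add:
  assumes "f \<in> L2 T" "g \<in> L2 T" "continuous_on {0..T} y" "t \<le> T"
  shows "volt (\<lambda>s. f s + g s) y t = volt f y t + volt g y t"
  unfolding volt_def scaleR_add_left
  using assms by (intro integral_add volt_integrable)

lemma volt_control_cmult: "volt (\<lambda>s. c * f s) y t = c *\<^sub>R volt f y t"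
  by (simp add: volt_def flip: scaleR_scaleR)

lemma volt_abs_integrable:
  assumes f: "f \<in> L2 T" and y: "continuous_on {0..T} y" and t: "t \<in> {0..T}"
  shows "(\<lambda>s. \<bar>f s\<bar> * norm (y s)) integrable_on {0..t}"
  using L2_scaleR_continuous_integrable[OF L2_abs[OF f] continuous_on_norm[OF y], of 0 t] t by auto

lemma norm_volt_le:
  assumes f: "f \<in> L2 T" and y: "continuous_on {0..T} y" and t: "t \<in> {0..T}"
  shows "norm (volt f y t) \<le> M * integral {0..t} (\<lambda>s. \<bar>f s\<bar> * norm (y s))"
proof -
  have "norm (volt f y t) \<le> integral {0..t} (\<lambda>s. M * (\<bar>f s\<bar> * norm (y s)))"
    unfolding volt_def
  proof (rule integral_norm_bound_integral)
    show "(\<lambda>s. f s *\<^sub>R B s (y s)) integrable_on {0..t}"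
      using volt_integrable f y t by auto
    show "(\<lambda>s. M * (\<bar>f s\<bar> * norm (y s))) integrable_on {0..t}"
      using volt_abs_integrable[OF f y t] by (intro integrable_on_mult_right)
    show "norm (f s *\<^sub>R B s (y s)) \<le> M * (\<bar>f s\<bar> * norm (y s))" for s
      using mult_left_mono[OF norm_B[of s "y s"], of "\<bar>f s\<bar>"] by (simp add: mult_ac)
  qed
  then show ?thesis by simp
qed

text \<open>In contrast to a bound by the supremum of \<open>y\<close>, this keeps the integral up
  to \<open>t\<close>; it is this integral from which the iterates gain a factorial.\<close>

lemma norm_volt_power2_le:
  assumes f: "f \<in> L2 T" and y: "continuous_on {0..T} y" and t: "t \<in> {0..T}"
  shows "(norm (volt f y t))\<^sup>2 \<le> (M * L2norm T f)\<^sup>2 * integral {0..t} (\<lambda>s. (norm (y s))\<^sup>2)"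
proof -
  define P where "P = integral {0..t} (\<lambda>s. \<bar>f s\<bar> * norm (y s))"
  have "(norm (volt f y t))\<^sup>2 \<le> (M * P)\<^sup>2"
    using norm_volt_le[OF assms] by (intro power_mono) (auto simp: P_def)
  also have "\<dots> = M\<^sup>2 * P\<^sup>2" by (simp add: power_mult_distrib)
  also have "\<dots> \<le> M\<^sup>2 * ((L2norm T (\<lambda>t. \<bar>f t\<bar>))\<^sup>2 * integral {0..t} (\<lambda>s. (norm (y s))\<^sup>2))"
    unfolding P_def
    by (intro mult_left_mono L2_Cauchy_Schwarz[OF L2_abs[OF f] continuous_on_norm[OF y] t]) auto
  also have "L2norm T (\<lambda>t. \<bar>f t\<bar>) = L2norm T f" by (simp add: L2norm_def)
  finally show ?thesis by (simp add: power_mult_distrib mult.assoc)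
qed

lemma norm_volt_bound:
  assumes f: "f \<in> L2 T" and y: "continuous_on {0..T} y" and t: "t \<in> {0..T}"
    and K: "\<And>s. s \<in> {0..T} \<Longrightarrow> norm (y s) \<le> K"
  shows "norm (volt f y t) \<le> M * sqrt T * L2norm T f * K"
proof (rule power2_le_imp_le)
  have K0: "K \<ge> 0" using K[OF t] norm_ge_zero order_trans by blast
  have "integral {0..t} (\<lambda>s. (norm (y s))\<^sup>2) \<le> integral {0..t} (\<lambda>s. K\<^sup>2)"
    using t K by (intro integral_le integrable_continuous_real continuous_intros continuous_on_subset[OF y] power_mono) auto
  also have "\<dots> \<le> T * K\<^sup>2" using t by (simp add: mult_right_mono)
  finally have "(M * L2norm T f)\<^sup>2 * integral {0..t} (\<lambda>s. (norm (y s))\<^sup>2) \<le> (M * L2norm T f)\<^sup>2 * (T * K\<^sup>2)"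
    by (rule mult_left_mono) auto
  then have "(norm (volt f y t))\<^sup>2 \<le> (M * L2norm T f)\<^sup>2 * (T * K\<^sup>2)"
    using norm_volt_power2_le[OF f y t] by linarith
  also have "\<dots> = (M * sqrt T * L2norm T f * K)\<^sup>2"
    using T_pos by (simp add: power_mult_distrib)
  finally show "(norm (volt f y t))\<^sup>2 \<le> (M * sqrt T * L2norm T f * K)\<^sup>2" .
  show "0 \<le> M * sqrt T * L2norm T f * K"
    using K0 M_nonneg T_pos by simp
qed

text \<open>The inhomogeneity \<open>g\<close> is an arbitrary function of time because differences
  and variations of solutions obey the same equation with other right-hand sides.\<close>

definition solves :: "(real \<Rightarrow> real) \<Rightarrow> (real \<Rightarrow> 'a) \<Rightarrow> (real \<Rightarrow> 'a) \<Rightarrow> bool" where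
  "solves f g x \<longleftrightarrow> continuous_on {0..T} x \<and> (\<forall>t\<in>{0..T}. x t = g t + volt f x t)"

definition growth :: "real \<Rightarrow> real" where
  "growth r = sqrt 2 * exp (M\<^sup>2 * r\<^sup>2 * T)"

lemma growth_pos: "0 < growth r"
  by (simp add: growth_def)

lemma solves_bound:
  assumes f: "f \<in> L2 T" and x: "solves f g x" and g: "\<And>t. t \<in> {0..T} \<Longrightarrow> norm (g t) \<le> G"
    and r: "L2norm T f \<le> r" and t: "t \<in> {0..T}"
  shows "norm (x t) \<le> growth r * G"
  unfolding growth_def
proof (rule Gronwall_L2[OF f _ _ M_nonneg r t])
  show "continuous_on {0..T} (\<lambda>t. norm (x t))"
    using x by (auto simp: solves_def intro!: continuous_intros)
  fix s assume s: "s \<in> {0..T}"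
  have "norm (x s) \<le> norm (g s) + norm (volt f x s)"
    using x s norm_triangle_ineq by (auto simp: solves_def)
  also have "\<dots> \<le> G + M * integral {0..s} (\<lambda>s. \<bar>f s\<bar> * norm (x s))"
    using g[OF s] norm_volt_le[OF f _ s, of x] x by (auto simp: solves_def)
  finally show "0 \<le> norm (x s) \<and> norm (x s) \<le> G + M * integral {0..s} (\<lambda>s. \<bar>f s\<bar> * norm (x s))" by simp
qed

lemma solves_unique:
  assumes f: "f \<in> L2 T" and x: "solves f g x" and y: "solves f g y" and t: "t \<in> {0..T}"
  shows "x t = y t"
proof -
  have "solves f (\<lambda>t. 0) (\<lambda>t. x t - y t)"
    using x y f by (auto simp: solves_def volt_diff intro!: continuous_intros)
  from solves_bound[OF f this, of 0 _ t] t have "norm (x t - y t) \<le> 0" by auto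
  then show ?thesis by simp
qed

text \<open>Squared norms are iterated, since Cauchy-Schwarz pairs the square integrable control
  with the square of \<open>y\<close>. Each step integrates a power of \<open>t\<close>, and the
  \<open>n\<close> integrations produce \<open>1 / fact n\<close>.\<close>

lemma volt_iterate_bound:
  assumes f: "f \<in> L2 T" and g: "continuous_on {0..T} g" and G: "\<And>t. t \<in> {0..T} \<Longrightarrow> norm (g t) \<le> G"
  shows "continuous_on {0..T} ((volt f ^^ n) g) \<and>
    (\<forall>t\<in>{0..T}. (norm ((volt f ^^ n) g t))\<^sup>2 \<le> G\<^sup>2 * ((M * L2norm T f)\<^sup>2) ^ n * t ^ n / fact n)"
proof (induction n)
  case 0
  show ?case using g G by (auto intro!: power_mono)
next
  case (Suc n)
  define y where "y = (volt f ^^ n) g"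
  define q where "q = (M * L2norm T f)\<^sup>2"
  have y: "continuous_on {0..T} y" and yb: "\<And>t. t \<in> {0..T} \<Longrightarrow> (norm (y t))\<^sup>2 \<le> G\<^sup>2 * q ^ n * t ^ n / fact n"
    using Suc by (auto simp: y_def q_def)
  have "(norm (volt f y t))\<^sup>2 \<le> G\<^sup>2 * q ^ Suc n * t ^ Suc n / fact (Suc n)" if t: "t \<in> {0..T}" for t
  proof -
    have "((\<lambda>s. s ^ n) has_integral (t ^ Suc n / Suc n - 0 ^ Suc n / Suc n)) {0..t}"
    proof (rule fundamental_theorem_of_calculus)
      show "((\<lambda>x. x ^ Suc n / Suc n) has_vector_derivative s ^ n) (at s within {0..t})" for s
        unfolding has_real_derivative_iff_has_vector_derivative[symmetric]
        by (rule derivative_eq_intros refl | simp)+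
    qed (use t in auto)
    then have I: "((\<lambda>s. G\<^sup>2 * q ^ n / fact n * s ^ n) has_integral (G\<^sup>2 * q ^ n / fact n * (t ^ Suc n / Suc n))) {0..t}"
      by (intro has_integral_mult_right) simp
    have "integral {0..t} (\<lambda>s. (norm (y s))\<^sup>2) \<le> G\<^sup>2 * q ^ n / fact n * (t ^ Suc n / Suc n)"
    proof (rule has_integral_le[OF integrable_integral I])
      show "(\<lambda>s. (norm (y s))\<^sup>2) integrable_on {0..t}"
        using t by (intro integrable_continuous_real continuous_intros continuous_on_subset[OF y]) auto
      show "(norm (y s))\<^sup>2 \<le> G\<^sup>2 * q ^ n / fact n * s ^ n" if "s \<in> {0..t}" for s
        using yb[of s] that t by simp
    qed
    then have "q * integral {0..t} (\<lambda>s. (norm (y s))\<^sup>2) \<le> q * (G\<^sup>2 * q ^ n / fact n * (t ^ Suc n / Suc n))"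
      by (intro mult_left_mono) (auto simp: q_def)
    then have "(norm (volt f y t))\<^sup>2 \<le> q * (G\<^sup>2 * q ^ n / fact n * (t ^ Suc n / Suc n))"
      using norm_volt_power2_le[OF f y t] unfolding q_def by linarith
    also have "\<dots> = G\<^sup>2 * q ^ Suc n * t ^ Suc n / fact (Suc n)"
      by (simp add: field_simps)
    finally show ?thesis .
  qed
  then show ?case
    using volt_continuous[OF f y] unfolding y_def q_def by simp
qed

text \<open>Neumann series: the iterates of \<open>volt f\<close> on \<open>g\<close> are summable
  uniformly in time for a control of any norm, so the solution is obtained on all of
  \<open>{0..T}\<close> at once.\<close>

lemma solves_exists:
  assumes f: "f \<in> L2 T" and g: "continuous_on {0..T} g"
  shows "\<exists>x. solves f g x"
proof -
  define e where "e n = (volt f ^^ n) g" for n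
  obtain G where G0: "G > 0" and G: "\<And>s. s \<in> {0..T} \<Longrightarrow> norm (g s) \<le> G"
    using continuous_on_interval_norm_bound[OF g] by blast
  define q where "q = (M * L2norm T f)\<^sup>2 * T"
  have q: "q \<ge> 0" using T_pos by (simp add: q_def)
  have ec: "continuous_on {0..T} (e n)" for n
    using volt_iterate_bound[OF f g G] by (simp add: e_def)
  have eb: "norm (e n t) \<le> G * sqrt (exp (4 * q)) * (1/2) ^ n" if t: "t \<in> {0..T}" for n t
  proof (rule power2_le_imp_le)
    have "(norm (e n t))\<^sup>2 \<le> G\<^sup>2 * ((M * L2norm T f)\<^sup>2) ^ n * t ^ n / fact n"
      using volt_iterate_bound[OF f g G] t by (simp add: e_def)
    also have "\<dots> \<le> G\<^sup>2 * ((M * L2norm T f)\<^sup>2) ^ n * T ^ n / fact n"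
      using t by (intro divide_right_mono mult_left_mono power_mono) auto
    \<comment> \<open>One term of the exponential series bounds \<open>(4 * q)^n / fact n\<close>.
      The factor 4 is inserted so that \<open>(1/4)^n\<close> remains, whose square root is the
      geometric majorant \<open>(1/2)^n\<close>.\<close>
    also have "\<dots> = G\<^sup>2 * ((4 * q) ^ n / fact n) * (1/4) ^ n"
      by (simp add: q_def power_mult_distrib power_divide)
    also have "\<dots> \<le> G\<^sup>2 * exp (4 * q) * (1/4) ^ n"
    proof -
      have "(\<Sum>k\<in>{n}. inverse (fact k) * (4 * q) ^ k) \<le> (\<Sum>k. inverse (fact k) * (4 * q) ^ k)"
        by (intro sum_le_suminf) (use q summable_exp[of "4 * q"] in auto)
      then have "(4 * q) ^ n / fact n \<le> exp (4 * q)"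
        by (simp add: exp_def divide_inverse mult.commute)
      then show ?thesis
        by (intro mult_right_mono mult_left_mono) auto
    qed
    also have "\<dots> = (G * sqrt (exp (4 * q)) * (1/2) ^ n)\<^sup>2"
    proof -
      have "((1/2::real) ^ n)\<^sup>2 = (1/4) ^ n"
        by (simp add: power2_eq_square flip: power_mult_distrib)
      then show ?thesis by (simp add: power_mult_distrib)
    qed
    finally show "(norm (e n t))\<^sup>2 \<le> (G * sqrt (exp (4 * q)) * (1/2) ^ n)\<^sup>2" .
  qed (use G0 in auto)
  define P where "P n t = (\<Sum>i<n. e i t)" for n t
  define x where "x t = (\<Sum>i. e i t)" for t
  have unif: "uniform_limit {0..T} P x sequentially"
    unfolding P_def [abs_def] x_def [abs_def]
    by (rule Weierstrass_m_test[of _ _ "\<lambda>n. G * sqrt (exp (4 * q)) * (1/2) ^ n"])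
      (use eb in \<open>auto intro!: summable_mult summable_geometric\<close>)
  have Pc: "continuous_on {0..T} (P n)" for n
    unfolding P_def [abs_def] using ec by (intro continuous_intros) auto
  have xc: "continuous_on {0..T} x"
    by (rule uniform_limit_theorem[OF _ unif]) (use Pc in auto)
  have PSuc: "P (Suc n) t = g t + volt f (P n) t" if t: "t \<in> {0..T}" for n t
  proof (induction n)
    case 0
    then show ?case
      using volt_cmult[of f 0 "\<lambda>_. 0" t] by (simp add: P_def [abs_def] e_def)
  next
    case (Suc n)
    have "volt f (P (Suc n)) t = volt f (\<lambda>t. P n t + e n t) t"
      by (simp add: P_def [abs_def])
    also have "\<dots> = volt f (P n) t + volt f (e n) t"
      using t by (intro volt_add f Pc ec) auto
    finally have "volt f (P (Suc n)) t = volt f (P n) t + volt f (e n) t" .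
    moreover have "P (Suc (Suc n)) t = P (Suc n) t + e (Suc n) t"
      by (simp add: P_def)
    moreover have "e (Suc n) t = volt f (e n) t"
      by (simp add: e_def)
    ultimately show ?case using Suc by simp
  qed
  have "x t = g t + volt f x t" if t: "t \<in> {0..T}" for t
  proof -
    have 1: "(\<lambda>n. P (Suc n) t) \<longlonglongrightarrow> x t"
      using tendsto_uniform_limitI[OF unif t] by (rule LIMSEQ_Suc)
    have "(\<lambda>n. volt f (P n) t) \<longlonglongrightarrow> volt f x t"
    proof (rule LIMSEQ_I)
      fix r :: real assume r: "r > 0"
      define c where "c = M * sqrt T * L2norm T f + 1"
      have c: "c > 0" using M_nonneg T_pos by (simp add: c_def add_nonneg_pos)
      have "r / c > 0" using r c by simp
      then obtain N where N: "\<And>n s. n \<ge> N \<Longrightarrow> s \<in> {0..T} \<Longrightarrow> dist (P n s) (x s) < r / c"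
        using unif unfolding uniform_limit_sequentially_iff by metis
      have "norm (volt f (P n) t - volt f x t) < r" if n: "n \<ge> N" for n
      proof -
        have "volt f (P n) t - volt f x t = volt f (\<lambda>s. P n s - x s) t"
          using t by (intro volt_diff[symmetric] f Pc xc) auto
        also have "norm \<dots> \<le> M * sqrt T * L2norm T f * (r / c)"
          using N[OF n] by (intro norm_volt_bound f t continuous_intros Pc xc) (auto simp: dist_norm less_imp_le)
        also have "\<dots> < c * (r / c)"
          using \<open>r / c > 0\<close> by (intro mult_strict_right_mono) (auto simp: c_def)
        finally show ?thesis using c by simp
      qed
      then show "\<exists>no. \<forall>n\<ge>no. norm (volt f (P n) t - volt f x t) < r" by blast
    qed
    then have "(\<lambda>n. g t + volt f (P n) t) \<longlonglongrightarrow> g t + volt f x t"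
      by (intro tendsto_intros)
    then show ?thesis
      using 1 LIMSEQ_unique unfolding PSuc[OF t] by blast
  qed
  then show ?thesis using xc by (auto simp: solves_def)
qed

text \<open>Fixed only on \<open>{0..T}\<close>, by \<open>solves_unique\<close>; outside the
  interval the choice is arbitrary.\<close>

definition sol :: "(real \<Rightarrow> real) \<Rightarrow> (real \<Rightarrow> 'a) \<Rightarrow> real \<Rightarrow> 'a" where
  "sol f g = (SOME x. solves f g x)"

lemma sol_solves:
  assumes "f \<in> L2 T" "continuous_on {0..T} g"
  shows "solves f g (sol f g)"
  unfolding sol_def using solves_exists[OF assms] by (rule someI_ex)

end

section \<open>Variations of the solution with respect to the control\<close>

context volterra
begin

lemma solves_cong:
  "solves f g x \<Longrightarrow> (\<And>t. t \<in> {0..T} \<Longrightarrow> g t = g' t) \<Longrightarrow> solves f g' x"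
  by (simp add: solves_def)

lemma solves_add:
  assumes "f \<in> L2 T" "solves f g x" "solves f g' x'"
  shows "solves f (\<lambda>t. g t + g' t) (\<lambda>t. x t + x' t)"
  using assms by (auto simp: solves_def volt_add intro!: continuous_intros)

lemma solves_diff:
  assumes "f \<in> L2 T" "solves f g x" "solves f g' x'"
  shows "solves f (\<lambda>t. g t - g' t) (\<lambda>t. x t - x' t)"
  using assms by (auto simp: solves_def volt_diff intro!: continuous_intros)

lemma solves_cmult:
  assumes "solves f g x"
  shows "solves f (\<lambda>t. c *\<^sub>R g t) (\<lambda>t. c *\<^sub>R x t)"
  using assms by (auto simp: solves_def volt_cmult scaleR_add_right intro!: continuous_intros)

text \<open>
  \<open>var n x0 f h S\<close>, for \<open>n = card S\<close>, is the mixed variation of order \<open>n\<close> of the solution at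
  the control \<open>f\<close> in the directions \<open>h i\<close>, \<open>i \<in> S\<close>.
\<close>

primrec var :: "nat \<Rightarrow> 'a \<Rightarrow> (real \<Rightarrow> real) \<Rightarrow> (nat \<Rightarrow> real \<Rightarrow> real) \<Rightarrow> nat set \<Rightarrow> real \<Rightarrow> 'a" where
  "var 0 x0 f h S = sol f (\<lambda>t. x0)"
| "var (Suc n) x0 f h S = sol f (\<lambda>t. \<Sum>i\<in>S. volt (h i) (var n x0 f h (S - {i})) t)"

lemma var_continuous:
  assumes "f \<in> L2 T" "\<And>i. i \<in> S \<Longrightarrow> h i \<in> L2 T"
  shows "continuous_on {0..T} (var n x0 f h S)"
  using assms(2)
proof (induction n arbitrary: S)
  case 0
  show ?case
    using sol_solves[OF assms(1), of "\<lambda>t. x0"] by (simp add: solves_def)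
next
  case (Suc n)
  have "continuous_on {0..T} (\<lambda>t. \<Sum>i\<in>S. volt (h i) (var n x0 f h (S - {i})) t)"
    by (intro continuous_on_sum volt_continuous Suc.IH) (auto intro: Suc.prems)
  then show ?case
    using sol_solves[OF assms(1)] by (simp add: solves_def)
qed

text \<open>Differentiating \<open>x = x0 + volt f x\<close> once in each direction of
  \<open>S\<close> leaves the implicit term and one further term for each direction that hits the
  control explicitly. The conditional treats order 0 and higher orders in one equation, which spares
  the estimates a case distinction.\<close>

lemma var_solves:
  assumes "f \<in> L2 T" "\<And>i. i \<in> S \<Longrightarrow> h i \<in> L2 T" "finite S" "card S = n"
  shows "solves f (\<lambda>t. (if n = 0 then x0 else 0) +
      (\<Sum>i\<in>S. volt (h i) (var (n - 1) x0 f h (S - {i})) t)) (var n x0 f h S)"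
proof (cases n)
  case 0
  then show ?thesis
    using sol_solves[OF assms(1), of "\<lambda>t. x0"] assms by simp
next
  case (Suc m)
  have "continuous_on {0..T} (\<lambda>t. \<Sum>i\<in>S. volt (h i) (var m x0 f h (S - {i})) t)"
    using assms by (intro continuous_on_sum volt_continuous var_continuous) auto
  from sol_solves[OF assms(1) this] show ?thesis by (simp add: Suc)
qed

lemma var_cong:
  "(\<And>i. i \<in> S \<Longrightarrow> h i = h' i) \<Longrightarrow> var n x0 f h S = var n x0 f h' S"
proof (induction n arbitrary: S)
  case (Suc n)
  have "(\<Sum>i\<in>S. volt (h i) (var n x0 f h (S - {i})) t) =
        (\<Sum>i\<in>S. volt (h' i) (var n x0 f h' (S - {i})) t)" for t
  proof (rule sum.cong)
    fix i assume "i \<in> S"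
    then have "var n x0 f h (S - {i}) = var n x0 f h' (S - {i})" "h i = h' i"
      using Suc.prems by (auto intro!: Suc.IH)
    then show "volt (h i) (var n x0 f h (S - {i})) t = volt (h' i) (var n x0 f h' (S - {i})) t" by simp
  qed simp
  then show ?case by simp
qed simp

text \<open>Both sides solve the same Volterra equation, so uniqueness identifies them. In the
  inhomogeneity the term \<open>j = i\<close> is linear in the control explicitly, because the
  variation over \<open>S - {i}\<close> does not see \<open>h i\<close>; the other terms are linear
  by induction.\<close>

lemma var_linear:
  assumes f: "f \<in> L2 T" and p: "p \<in> L2 T" and q: "q \<in> L2 T"
    and h: "\<And>j. j \<in> S \<Longrightarrow> h j \<in> L2 T" and S: "finite S" "card S = n" and i: "i \<in> S"
    and t: "t \<in> {0..T}"
  shows "var n x0 f (h(i := \<lambda>s. a * p s + b * q s)) S t =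
    a *\<^sub>R var n x0 f (h(i := p)) S t + b *\<^sub>R var n x0 f (h(i := q)) S t"
  using h S i t
proof (induction n arbitrary: S t)
  case 0
  then show ?case by simp
next
  case (Suc n)
  let ?l = "\<lambda>s. a * p s + b * q s"
  have l: "?l \<in> L2 T" using p q by (intro L2_add L2_cmult)
  have mem: "(h(i := g)) j \<in> L2 T" if "g \<in> L2 T" "j \<in> S" for g j
    using that Suc.prems(1) by auto
  have sol: "solves f (\<lambda>t. \<Sum>j\<in>S. volt ((h(i := g)) j) (var n x0 f (h(i := g)) (S - {j})) t)
      (var (Suc n) x0 f (h(i := g)) S)" if "g \<in> L2 T" for g
    using var_solves[OF f, of S "h(i := g)" "Suc n" x0] mem[OF that] Suc.prems(2,3) by simp
  have comb: "solves f (\<lambda>t. a *\<^sub>R (\<Sum>j\<in>S. volt ((h(i := p)) j) (var n x0 f (h(i := p)) (S - {j})) t)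
      + b *\<^sub>R (\<Sum>j\<in>S. volt ((h(i := q)) j) (var n x0 f (h(i := q)) (S - {j})) t))
      (\<lambda>t. a *\<^sub>R var (Suc n) x0 f (h(i := p)) S t + b *\<^sub>R var (Suc n) x0 f (h(i := q)) S t)"
    by (intro solves_add solves_cmult f sol p q)
  have "solves f (\<lambda>t. \<Sum>j\<in>S. volt ((h(i := ?l)) j) (var n x0 f (h(i := ?l)) (S - {j})) t)
      (\<lambda>t. a *\<^sub>R var (Suc n) x0 f (h(i := p)) S t + b *\<^sub>R var (Suc n) x0 f (h(i := q)) S t)"
  proof (rule solves_cong[OF comb])
    fix t assume t: "t \<in> {0..T}"
    have vc: "continuous_on {0..T} (var n x0 f (h(i := g)) (S - {j}))" if "g \<in> L2 T" for g j
      using mem that f by (intro var_continuous) auto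
    have "a *\<^sub>R volt ((h(i := p)) j) (var n x0 f (h(i := p)) (S - {j})) t
        + b *\<^sub>R volt ((h(i := q)) j) (var n x0 f (h(i := q)) (S - {j})) t
        = volt ((h(i := ?l)) j) (var n x0 f (h(i := ?l)) (S - {j})) t" if j: "j \<in> S" for j
    proof (cases "j = i")
      case True
      have "var n x0 f (h(i := g)) (S - {i}) = var n x0 f h (S - {i})" for g
        by (intro var_cong) auto
      moreover have "continuous_on {0..T} (var n x0 f h (S - {i}))"
        using Suc.prems f by (intro var_continuous) auto
      ultimately show ?thesis
        using True t p q by (simp add: volt_control_add volt_control_cmult L2_cmult)
    next
      case False
      have "var n x0 f (h(i := ?l)) (S - {j}) s =
          a *\<^sub>R var n x0 f (h(i := p)) (S - {j}) s + b *\<^sub>R var n x0 f (h(i := q)) (S - {j}) s"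
        if "s \<in> {0..T}" for s
        using Suc.prems False j that by (intro Suc.IH) auto
      then have "volt (h j) (var n x0 f (h(i := ?l)) (S - {j})) t =
          volt (h j) (\<lambda>s. a *\<^sub>R var n x0 f (h(i := p)) (S - {j}) s + b *\<^sub>R var n x0 f (h(i := q)) (S - {j}) s) t"
        using t by (intro volt_cong) auto
      also have "\<dots> = a *\<^sub>R volt (h j) (var n x0 f (h(i := p)) (S - {j})) t
          + b *\<^sub>R volt (h j) (var n x0 f (h(i := q)) (S - {j})) t"
        using t vc[OF p] vc[OF q] Suc.prems(1)[OF j]
        by (subst volt_add) (auto simp: volt_cmult intro!: continuous_intros)
      finally show ?thesis using False by simp
    qed
    then show "a *\<^sub>R (\<Sum>j\<in>S. volt ((h(i := p)) j) (var n x0 f (h(i := p)) (S - {j})) t)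
      + b *\<^sub>R (\<Sum>j\<in>S. volt ((h(i := q)) j) (var n x0 f (h(i := q)) (S - {j})) t)
      = (\<Sum>j\<in>S. volt ((h(i := ?l)) j) (var n x0 f (h(i := ?l)) (S - {j})) t)"
      unfolding scaleR_sum_right sum.distrib[symmetric] by (intro sum.cong) auto
  qed
  from solves_unique[OF f sol[OF l] this Suc.prems(5)] show ?case .
qed

section \<open>Uniform bounds on variations, their differences and their second-order
  remainders\<close>

definition step :: real where "step = M * sqrt T"

lemma step_nonneg: "0 \<le> step"
  using M_nonneg T_pos by (simp add: step_def)

text \<open>\<open>bnd\<close>, \<open>lip\<close> and \<open>quad\<close> are the constants of
  \<open>var_bound\<close>, \<open>var_lipschitz\<close> and \<open>var_quadratic\<close>:
  Gronwall's factor \<open>growth r\<close> times the size of the inhomogeneity, with the lower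
  order entering through the sum over directions. The control enters only through \<open>r\<close>,
  so the bounds are uniform on balls.\<close>

fun bnd :: "'a \<Rightarrow> real \<Rightarrow> nat \<Rightarrow> real" where
  "bnd x0 r n = growth r * ((if n = 0 then norm x0 else 0) + real n * (step * (if n = 0 then 0 else bnd x0 r (n - 1))))"

fun lip :: "'a \<Rightarrow> real \<Rightarrow> nat \<Rightarrow> real" where
  "lip x0 r n = growth r * (real n * (step * (if n = 0 then 0 else lip x0 r (n - 1))) + step * bnd x0 r n)"

fun quad :: "'a \<Rightarrow> real \<Rightarrow> nat \<Rightarrow> real" where
  "quad x0 r n = growth r * (real n * (step * (if n = 0 then 0 else quad x0 r (n - 1))) + step * lip x0 r n)"

declare bnd.simps [simp del] lip.simps [simp del] quad.simps [simp del]

lemma norm_volt_step: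
  assumes "f \<in> L2 T" "continuous_on {0..T} y" "t \<in> {0..T}" "\<And>s. s \<in> {0..T} \<Longrightarrow> norm (y s) \<le> K"
  shows "norm (volt f y t) \<le> step * L2norm T f * K"
  using norm_volt_bound[OF assms] by (simp add: step_def)

lemma norm_sum_volt_le:
  assumes S: "finite S" and h: "\<And>i. i \<in> S \<Longrightarrow> h i \<in> L2 T"
    and y: "\<And>i. i \<in> S \<Longrightarrow> continuous_on {0..T} (y i)"
    and K: "\<And>i s. i \<in> S \<Longrightarrow> s \<in> {0..T} \<Longrightarrow> norm (y i s) \<le> K * (\<Prod>j\<in>S - {i}. L2norm T (h j))"
    and t: "t \<in> {0..T}"
  shows "norm (\<Sum>i\<in>S. volt (h i) (y i) t) \<le> real (card S) * (step * K) * (\<Prod>j\<in>S. L2norm T (h j))"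
proof -
  have "norm (volt (h i) (y i) t) \<le> step * K * (\<Prod>j\<in>S. L2norm T (h j))" if i: "i \<in> S" for i
  proof -
    have "norm (volt (h i) (y i) t) \<le> step * L2norm T (h i) * (K * (\<Prod>j\<in>S - {i}. L2norm T (h j)))"
      by (intro norm_volt_step h i y t K)
    also have "\<dots> = step * K * (\<Prod>j\<in>S. L2norm T (h j))"
      by (simp add: prod.remove[OF S i] mult_ac)
    finally show ?thesis .
  qed
  then have "norm (\<Sum>i\<in>S. volt (h i) (y i) t) \<le> of_nat (card S) * (step * K * (\<Prod>j\<in>S. L2norm T (h j)))"
    by (intro order_trans[OF norm_sum] sum_bounded_above) auto
  then show ?thesis by (simp add: mult_ac)
qed

lemma var_bound:
  assumes f: "f \<in> L2 T" and r: "L2norm T f \<le> r"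
    and h: "\<And>i. i \<in> S \<Longrightarrow> h i \<in> L2 T" and S: "finite S" "card S = n" and t: "t \<in> {0..T}"
  shows "norm (var n x0 f h S t) \<le> bnd x0 r n * (\<Prod>i\<in>S. L2norm T (h i))"
  using h S t
proof (induction n arbitrary: S t rule: less_induct)
  case (less n)
  let ?K = "if n = 0 then 0 else bnd x0 r (n - 1)"
  let ?P = "\<Prod>i\<in>S. L2norm T (h i)"
  have "norm (var n x0 f h S t) \<le> growth r * (((if n = 0 then norm x0 else 0) + real n * (step * ?K)) * ?P)"
  proof (rule solves_bound[OF f var_solves[OF f less.prems(1-3)] _ r less.prems(4)])
    fix t assume t: "t \<in> {0..T}"
    have "norm (\<Sum>i\<in>S. volt (h i) (var (n - 1) x0 f h (S - {i})) t) \<le> real (card S) * (step * ?K) * ?P"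
    proof (rule norm_sum_volt_le)
      fix i s assume i: "i \<in> S" and s: "s \<in> {0..T}"
      then have "n > 0" using less.prems card_gt_0_iff by blast
      then show "norm (var (n - 1) x0 f h (S - {i}) s) \<le> ?K * (\<Prod>j\<in>S - {i}. L2norm T (h j))"
        using less.IH[of "n - 1" "S - {i}" s] less.prems i s by auto
    qed (use less.prems t f in \<open>auto intro!: var_continuous\<close>)
    moreover have "norm (if n = 0 then x0 else 0) = (if n = 0 then norm x0 else 0) * ?P"
      using less.prems by auto
    ultimately show "norm ((if n = 0 then x0 else 0) + (\<Sum>i\<in>S. volt (h i) (var (n - 1) x0 f h (S - {i})) t))
        \<le> ((if n = 0 then norm x0 else 0) + real n * (step * ?K)) * ?P"
      unfolding distrib_right less.prems(3) by (intro norm_triangle_le) linarith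
  qed auto
  then show ?case by (subst bnd.simps) (simp add: mult.assoc)
qed

text \<open>An equation at \<open>f + d\<close> is read as one at \<open>f\<close>: the surplus
  \<open>volt d x\<close> moves into the inhomogeneity, with the perturbed solution \<open>x\<close>
  in it. All estimates can then apply Gronwall at the fixed control \<open>f\<close>.\<close>

lemma solves_control_diff:
  assumes f: "f \<in> L2 T" and d: "d \<in> L2 T"
    and x: "solves (\<lambda>t. f t + d t) g x" and y: "solves f g' y"
  shows "solves f (\<lambda>t. (g t - g' t) + volt d x t) (\<lambda>t. x t - y t)"
  using assms by (auto simp: solves_def volt_control_add volt_diff intro!: continuous_intros)

lemma bnd_nonneg: "0 \<le> bnd x0 r n"
proof (induction n rule: less_induct)
  case (less n)
  then have "0 \<le> (if n = 0 then 0 else bnd x0 r (n - 1))" by simp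
  then show ?case
    by (subst bnd.simps) (intro mult_nonneg_nonneg add_nonneg_nonneg step_nonneg
        less_imp_le[OF growth_pos] of_nat_0_le_iff, auto)
qed

text \<open>By \<open>solves_control_diff\<close> the inhomogeneity consists of lower-order
  differences, covered by induction, and of \<open>volt d\<close> applied to the perturbed
  variation. The latter yields the factor \<open>L2norm T d\<close> by way of
  \<open>var_bound\<close>, whence the bound \<open>r\<close> on the norm of the perturbed
  control.\<close>

lemma var_lipschitz:
  assumes f: "f \<in> L2 T" and d: "d \<in> L2 T" and r: "L2norm T f \<le> r" "L2norm T (\<lambda>t. f t + d t) \<le> r"
    and h: "\<And>i. i \<in> S \<Longrightarrow> h i \<in> L2 T" and S: "finite S" "card S = n" and t: "t \<in> {0..T}"
  shows "norm (var n x0 (\<lambda>t. f t + d t) h S t - var n x0 f h S t)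
    \<le> lip x0 r n * L2norm T d * (\<Prod>i\<in>S. L2norm T (h i))"
  using h S t
proof (induction n arbitrary: S t rule: less_induct)
  case (less n)
  let ?f' = "\<lambda>t. f t + d t"
  have f': "?f' \<in> L2 T" using f d by (rule L2_add)
  let ?K = "(if n = 0 then 0 else lip x0 r (n - 1)) * L2norm T d"
  let ?P = "\<Prod>i\<in>S. L2norm T (h i)"
  have "norm (var n x0 ?f' h S t - var n x0 f h S t)
      \<le> growth r * (real n * (step * ?K) * ?P + step * L2norm T d * (bnd x0 r n * ?P))"
  proof (rule solves_bound[OF f solves_control_diff[OF f d var_solves[OF f'] var_solves[OF f]] _ r(1)])
    fix t assume t: "t \<in> {0..T}"
    have 1: "norm (\<Sum>i\<in>S. volt (h i) (\<lambda>s. var (n - 1) x0 ?f' h (S - {i}) s - var (n - 1) x0 f h (S - {i}) s) t)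
        \<le> real (card S) * (step * ?K) * ?P"
    proof (rule norm_sum_volt_le)
      fix i s assume i: "i \<in> S" and s: "s \<in> {0..T}"
      then have "n > 0" using less.prems card_gt_0_iff by blast
      then show "norm (var (n - 1) x0 ?f' h (S - {i}) s - var (n - 1) x0 f h (S - {i}) s)
          \<le> ?K * (\<Prod>j\<in>S - {i}. L2norm T (h j))"
        using less.IH[of "n - 1" "S - {i}" s] less.prems i s by auto
    qed (use less.prems t f f' in \<open>auto intro!: var_continuous continuous_intros\<close>)
    have 2: "norm (volt d (var n x0 ?f' h S) t) \<le> step * L2norm T d * (bnd x0 r n * ?P)"
      using less.prems t f' d r by (intro norm_volt_step var_continuous var_bound) auto
    have "(\<Sum>i\<in>S. volt (h i) (var (n - 1) x0 ?f' h (S - {i})) t) - (\<Sum>i\<in>S. volt (h i) (var (n - 1) x0 f h (S - {i})) t)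
        = (\<Sum>i\<in>S. volt (h i) (\<lambda>s. var (n - 1) x0 ?f' h (S - {i}) s - var (n - 1) x0 f h (S - {i}) s) t)"
      unfolding sum_subtractf[symmetric] using less.prems t f f'
      by (intro sum.cong refl volt_diff[symmetric] var_continuous) auto
    then show "norm ((if n = 0 then x0 else 0) + (\<Sum>i\<in>S. volt (h i) (var (n - 1) x0 ?f' h (S - {i})) t) -
          ((if n = 0 then x0 else 0) + (\<Sum>i\<in>S. volt (h i) (var (n - 1) x0 f h (S - {i})) t)) + volt d (var n x0 ?f' h S) t)
        \<le> real n * (step * ?K) * ?P + step * L2norm T d * (bnd x0 r n * ?P)"
      using 1 2 less.prems(3) by (intro norm_triangle_le) auto
  qed (use less.prems in auto)
  then show ?case by (subst lip.simps) (simp add: algebra_simps)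
qed

text \<open>The derivative in direction \<open>d\<close> of a variation is the variation with
  \<open>d\<close> added under a fresh index \<open>k\<close>. In the equation for the remainder the
  term of index \<open>k\<close> is \<open>volt d\<close> of the unperturbed variation; against
  \<open>volt d\<close> of the perturbed one it leaves a first difference, and
  \<open>var_lipschitz\<close> gives the second factor \<open>L2norm T d\<close>.\<close>

lemma var_quadratic:
  assumes f: "f \<in> L2 T" and d: "d \<in> L2 T" and r: "L2norm T f \<le> r" "L2norm T (\<lambda>t. f t + d t) \<le> r"
    and h: "\<And>i. i \<in> S \<Longrightarrow> h i \<in> L2 T" and S: "finite S" "card S = n" and k: "k \<notin> S" and t: "t \<in> {0..T}"
  shows "norm (var n x0 (\<lambda>t. f t + d t) h S t - var n x0 f h S t - var (Suc n) x0 f (h(k := d)) (insert k S) t)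
    \<le> quad x0 r n * (L2norm T d)\<^sup>2 * (\<Prod>i\<in>S. L2norm T (h i))"
  using h S k t
proof (induction n arbitrary: S t rule: less_induct)
  case (less n)
  let ?f' = "\<lambda>t. f t + d t" and ?h' = "h(k := d)"
  have f': "?f' \<in> L2 T" using f d by (rule L2_add)
  let ?K = "(if n = 0 then 0 else quad x0 r (n - 1)) * (L2norm T d)\<^sup>2"
  let ?P = "\<Prod>i\<in>S. L2norm T (h i)"
  let ?z = "\<lambda>i s. var (n - 1) x0 ?f' h (S - {i}) s - var (n - 1) x0 f h (S - {i}) s - var n x0 f ?h' (insert k (S - {i})) s"
  have mem: "?h' i \<in> L2 T" if "i \<in> insert k S" for i
    using that less.prems d by auto
  have c': "card (insert k S) = Suc n" using less.prems by simp
  have vc: "continuous_on {0..T} (var m x0 f ?h' A)" if "A \<subseteq> insert k S" for A m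
    using that by (intro var_continuous[OF f] mem) auto
  have "norm (var n x0 ?f' h S t - var n x0 f h S t - var (Suc n) x0 f ?h' (insert k S) t)
      \<le> growth r * (real n * (step * ?K) * ?P + step * L2norm T d * (lip x0 r n * L2norm T d * ?P))"
  proof (rule solves_bound[OF f solves_diff[OF f solves_control_diff[OF f d var_solves[OF f'] var_solves[OF f]]
            var_solves[OF f mem _ c']] _ r(1)])
    fix t assume t: "t \<in> {0..T}"
    have 1: "norm (\<Sum>i\<in>S. volt (h i) (?z i) t) \<le> real (card S) * (step * ?K) * ?P"
    proof (rule norm_sum_volt_le)
      fix i s assume i: "i \<in> S" and s: "s \<in> {0..T}"
      then have "n > 0" using less.prems card_gt_0_iff by blast
      then have n: "Suc (n - 1) = n" by simp
      have "norm (?z i s) \<le> quad x0 r (n - 1) * (L2norm T d)\<^sup>2 * (\<Prod>j\<in>S - {i}. L2norm T (h j))"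
        by (rule less.IH[of "n - 1" "S - {i}" s, unfolded n]) (use \<open>n > 0\<close> less.prems i s in auto)
      then show "norm (?z i s) \<le> ?K * (\<Prod>j\<in>S - {i}. L2norm T (h j))"
        using \<open>n > 0\<close> by simp
    qed (use less.prems t f f' in \<open>auto intro!: var_continuous continuous_intros vc\<close>)
    have 2: "norm (volt d (\<lambda>s. var n x0 ?f' h S s - var n x0 f h S s) t) \<le> step * L2norm T d * (lip x0 r n * L2norm T d * ?P)"
      using less.prems t f f' d r by (intro norm_volt_step var_continuous var_lipschitz continuous_intros) auto
    have "(\<Sum>i\<in>insert k S. volt (?h' i) (var n x0 f ?h' (insert k S - {i})) t)
        = volt d (var n x0 f h S) t + (\<Sum>i\<in>S. volt (h i) (var n x0 f ?h' (insert k (S - {i}))) t)"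
    proof -
      have "var n x0 f ?h' S = var n x0 f h S"
        using less.prems by (intro var_cong) auto
      moreover have "(\<Sum>i\<in>S. volt (?h' i) (var n x0 f ?h' (insert k S - {i})) t)
          = (\<Sum>i\<in>S. volt (h i) (var n x0 f ?h' (insert k (S - {i}))) t)"
        using less.prems by (intro sum.cong) (auto simp: insert_Diff_if)
      ultimately show ?thesis using less.prems by simp
    qed
    moreover have "(\<Sum>i\<in>S. volt (h i) (?z i) t) = (\<Sum>i\<in>S. volt (h i) (var (n - 1) x0 ?f' h (S - {i})) t)
        - (\<Sum>i\<in>S. volt (h i) (var (n - 1) x0 f h (S - {i})) t)
        - (\<Sum>i\<in>S. volt (h i) (var n x0 f ?h' (insert k (S - {i}))) t)"
      unfolding sum_subtractf[symmetric]
    proof (intro sum.cong refl)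
      fix i assume i: "i \<in> S"
      have a: "continuous_on {0..T} (var (n - 1) x0 ?f' h (S - {i}))" "continuous_on {0..T} (var (n - 1) x0 f h (S - {i}))"
        "continuous_on {0..T} (var n x0 f ?h' (insert k (S - {i})))" "h i \<in> L2 T"
        using less.prems i f f' by (auto intro!: var_continuous vc)
      show "volt (h i) (?z i) t = volt (h i) (var (n - 1) x0 ?f' h (S - {i})) t -
         volt (h i) (var (n - 1) x0 f h (S - {i})) t - volt (h i) (var n x0 f ?h' (insert k (S - {i}))) t"
        using t a by (simp add: volt_diff continuous_on_diff)
    qed
    moreover have "volt d (\<lambda>s. var n x0 ?f' h S s - var n x0 f h S s) t = volt d (var n x0 ?f' h S) t - volt d (var n x0 f h S) t"
      using less.prems t f f' d by (intro volt_diff var_continuous) auto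
    ultimately have eq: "((if n = 0 then x0 else 0) + (\<Sum>i\<in>S. volt (h i) (var (n - 1) x0 ?f' h (S - {i})) t) -
          ((if n = 0 then x0 else 0) + (\<Sum>i\<in>S. volt (h i) (var (n - 1) x0 f h (S - {i})) t)) + volt d (var n x0 ?f' h S) t)
        - ((if Suc n = 0 then x0 else 0) + (\<Sum>i\<in>insert k S. volt (?h' i) (var (Suc n - 1) x0 f ?h' (insert k S - {i})) t))
      = (\<Sum>i\<in>S. volt (h i) (?z i) t) + volt d (\<lambda>s. var n x0 ?f' h S s - var n x0 f h S s) t"
      by (simp add: algebra_simps)
    show "norm (((if n = 0 then x0 else 0) + (\<Sum>i\<in>S. volt (h i) (var (n - 1) x0 ?f' h (S - {i})) t) -
          ((if n = 0 then x0 else 0) + (\<Sum>i\<in>S. volt (h i) (var (n - 1) x0 f h (S - {i})) t)) + volt d (var n x0 ?f' h S) t)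
        - ((if Suc n = 0 then x0 else 0) + (\<Sum>i\<in>insert k S. volt (?h' i) (var (Suc n - 1) x0 f ?h' (insert k S - {i})) t)))
        \<le> real n * (step * ?K) * ?P + step * L2norm T d * (lip x0 r n * L2norm T d * ?P)"
      unfolding eq by (rule norm_triangle_mono[OF 1[unfolded less.prems(3)] 2])
  qed (use less.prems in auto)
  then show ?case by (subst quad.simps) (simp add: algebra_simps power2_eq_square)
qed

lemma lip_nonneg: "0 \<le> lip x0 r n"
proof (induction n rule: less_induct)
  case (less n)
  then have "0 \<le> (if n = 0 then 0 else lip x0 r (n - 1))" by simp
  then show ?case
    by (subst lip.simps) (intro mult_nonneg_nonneg add_nonneg_nonneg step_nonneg bnd_nonneg
        less_imp_le[OF growth_pos] of_nat_0_le_iff)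
qed

lemma quad_nonneg: "0 \<le> quad x0 r n"
proof (induction n rule: less_induct)
  case (less n)
  define q where "q = (if n = 0 then 0 else quad x0 r (n - 1))"
  have "0 \<le> q" using less by (simp add: q_def)
  then have "0 \<le> real n * (step * q)"
    using step_nonneg by simp
  moreover have "0 \<le> step * lip x0 r n"
    using step_nonneg lip_nonneg by (rule mult_nonneg_nonneg)
  ultimately have "0 \<le> growth r * (real n * (step * q) + step * lip x0 r n)"
    by (intro mult_nonneg_nonneg[OF less_imp_le[OF growth_pos]] add_nonneg_nonneg)
  then show ?case
    unfolding q_def by (subst quad.simps)
qed

declare var.simps [simp del]

end

section \<open>Quadratic functionals of the solution\<close>

text \<open>In the application \<open>\<beta>\<close> is the polarised objective and
  \<open>c0\<close> the value left when normalisation eliminates the third population.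
  \<open>J\<close> is a separate parameter, tied to the solution on \<open>L2 T\<close>
  only.\<close>

locale quadratic_objective = volterra T M B
  for T M :: real and B :: "real \<Rightarrow> 'a::euclidean_space \<Rightarrow> 'a" +
  fixes x0 :: 'a and \<beta> :: "'a \<Rightarrow> 'a \<Rightarrow> real" and c0 :: real and J :: "(real \<Rightarrow> real) \<Rightarrow> real"
  assumes bilinear_\<beta>: "bounded_bilinear \<beta>"
    and J_eq: "f \<in> L2 T \<Longrightarrow> J f = c0 + \<beta> (sol f (\<lambda>t. x0) T) (sol f (\<lambda>t. x0) T)"
begin

sublocale \<beta>: bounded_bilinear \<beta> by (rule bilinear_\<beta>)

abbreviation vr :: "(real \<Rightarrow> real) \<Rightarrow> (nat \<Rightarrow> real \<Rightarrow> real) \<Rightarrow> nat set \<Rightarrow> 'a" where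
  "vr f h S \<equiv> var (card S) x0 f h S T"

text \<open>Leibniz rule: each direction falls on one of the two arguments of
  \<open>\<beta>\<close>, and \<open>A\<close> collects those that fall on the first.\<close>

definition form :: "(real \<Rightarrow> real) \<Rightarrow> (nat \<Rightarrow> real \<Rightarrow> real) \<Rightarrow> nat set \<Rightarrow> real" where
  "form f h S = (\<Sum>A\<in>Pow S. \<beta> (vr f h A) (vr f h (S - A)))"

definition K\<beta> :: real where "K\<beta> = (SOME K. 0 < K \<and> (\<forall>x y. \<bar>\<beta> x y\<bar> \<le> norm x * norm y * K))"

lemma K\<beta>: "0 < K\<beta>" "\<bar>\<beta> x y\<bar> \<le> norm x * norm y * K\<beta>"
proof -
  have "\<exists>K. 0 < K \<and> (\<forall>x y. \<bar>\<beta> x y\<bar> \<le> norm x * norm y * K)"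
    using \<beta>.pos_bounded by simp
  from someI_ex[OF this] show "0 < K\<beta>" "\<bar>\<beta> x y\<bar> \<le> norm x * norm y * K\<beta>"
    by (auto simp: K\<beta>_def)
qed

lemma K\<beta>_le:
  assumes "norm x \<le> a" "norm y \<le> b"
  shows "\<bar>\<beta> x y\<bar> \<le> a * b * K\<beta>"
proof -
  have "0 \<le> a" using assms(1) norm_ge_zero order_trans by blast
  then have "norm x * norm y * K\<beta> \<le> a * b * K\<beta>"
    using assms K\<beta>(1) by (intro mult_right_mono mult_mono) auto
  then show ?thesis using K\<beta>(2)[of x y] by linarith
qed

lemma form_cong:
  assumes "\<And>i. i \<in> S \<Longrightarrow> h i = h' i"
  shows "form f h S = form f h' S"
  unfolding form_def
proof (rule sum.cong[OF refl])
  fix A assume "A \<in> Pow S"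
  then have "var n x0 f h A = var n x0 f h' A" "var n x0 f h (S - A) = var n x0 f h' (S - A)" for n
    using assms by (auto intro!: var_cong)
  then show "\<beta> (vr f h A) (vr f h (S - A)) = \<beta> (vr f h' A) (vr f h' (S - A))" by simp
qed

text \<open>Index \<open>i\<close> lies in exactly one of \<open>A\<close> and \<open>S - A\<close>,
  so each summand depends on \<open>h i\<close> through one variation only, and
  \<open>var_linear\<close> applies to that one.\<close>

lemma form_linear:
  assumes f: "f \<in> L2 T" and p: "p \<in> L2 T" and q: "q \<in> L2 T"
    and h: "\<And>j. j \<in> S \<Longrightarrow> h j \<in> L2 T" and S: "finite S" and i: "i \<in> S"
  shows "form f (h(i := \<lambda>s. a * p s + b * q s)) S = a * form f (h(i := p)) S + b * form f (h(i := q)) S"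
  unfolding form_def sum_distrib_left sum.distrib[symmetric]
proof (rule sum.cong[OF refl])
  fix A assume "A \<in> Pow S"
  then have A: "finite A" "finite (S - A)" "A \<subseteq> S" using S finite_subset by auto
  let ?l = "\<lambda>s. a * p s + b * q s"
  have indep: "vr f (h(i := g)) C = vr f h C" if "i \<notin> C" for g C
    by (rule fun_cong[of _ _ T], rule var_cong) (use that in auto)
  have lin: "vr f (h(i := ?l)) C = a *\<^sub>R vr f (h(i := p)) C + b *\<^sub>R vr f (h(i := q)) C"
    if "i \<in> C" "finite C" "C \<subseteq> S" for C
    using that h T_pos by (intro var_linear f p q) auto
  show "\<beta> (vr f (h(i := ?l)) A) (vr f (h(i := ?l)) (S - A)) =
    a * \<beta> (vr f (h(i := p)) A) (vr f (h(i := p)) (S - A)) + b * \<beta> (vr f (h(i := q)) A) (vr f (h(i := q)) (S - A))"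
  proof (cases "i \<in> A")
    case True
    then show ?thesis
      using lin[OF True A(1,3)] by (simp add: indep \<beta>.add_left \<beta>.scaleR_left)
  next
    case False
    then have "i \<in> S - A" using i by simp
    from lin[OF this A(2)] False show ?thesis
      by (simp add: indep \<beta>.add_right \<beta>.scaleR_right)
  qed
qed

lemma prod_Diff:
  assumes "finite S" "A \<subseteq> S"
  shows "(\<Prod>i\<in>A. g i) * (\<Prod>i\<in>S - A. g i) = (\<Prod>i\<in>S. (g i :: real))"
  using prod.subset_diff[OF assms(2,1), of g] by (simp add: mult.commute)

lemma form_bound:
  assumes f: "f \<in> L2 T" and h: "\<And>i. i \<in> S \<Longrightarrow> h i \<in> L2 T" and S: "finite S"
  shows "\<bar>form f h S\<bar> \<le> (\<Sum>A\<in>Pow S. bnd x0 (L2norm T f) (card A) * bnd x0 (L2norm T f) (card (S - A)) * K\<beta>)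
    * (\<Prod>i\<in>S. L2norm T (h i))"
  unfolding form_def sum_distrib_right
proof (rule order_trans[OF sum_abs], rule sum_mono)
  fix A assume "A \<in> Pow S"
  then have A: "finite A" "finite (S - A)" "A \<subseteq> S" using S finite_subset by auto
  let ?b = "bnd x0 (L2norm T f)"
  have "\<bar>\<beta> (vr f h A) (vr f h (S - A))\<bar> \<le> (?b (card A) * (\<Prod>i\<in>A. L2norm T (h i)))
      * (?b (card (S - A)) * (\<Prod>i\<in>S - A. L2norm T (h i))) * K\<beta>"
    by (intro K\<beta>_le var_bound f) (use A h T_pos in auto)
  also have "\<dots> = ?b (card A) * ?b (card (S - A)) * K\<beta> * (\<Prod>i\<in>S. L2norm T (h i))"
    by (simp add: prod_Diff[OF S A(3), symmetric])
  finally show "\<bar>\<beta> (vr f h A) (vr f h (S - A))\<bar> \<le> \<dots>" .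
qed

text \<open>\<open>C\<close> is chosen before \<open>f\<close>, \<open>d\<close> and
  \<open>h\<close> and may depend on \<open>r\<close>: uniformity in \<open>h\<close> is what turns
  the estimate into one in the operator norm on multilinear forms.\<close>

lemma form_derivative:
  assumes S: "finite S" and k: "k \<notin> S"
  shows "\<exists>C\<ge>0. \<forall>f d h. f \<in> L2 T \<and> d \<in> L2 T \<and> L2norm T f \<le> r \<and> L2norm T (\<lambda>t. f t + d t) \<le> r \<and> (\<forall>i\<in>S. h i \<in> L2 T)
    \<longrightarrow> \<bar>form (\<lambda>t. f t + d t) h S - form f h S - form f (h(k := d)) (insert k S)\<bar>
      \<le> C * (L2norm T d)\<^sup>2 * (\<Prod>i\<in>S. L2norm T (h i))"
proof -
  let ?b = "bnd x0 r" and ?l = "lip x0 r" and ?q = "quad x0 r"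
  define c where "c A = K\<beta> * (?q (card A) * ?b (card (S - A)) + ?b (Suc (card A)) * ?l (card (S - A))
      + ?b (card A) * ?q (card (S - A)))" for A
  have "0 \<le> (\<Sum>A\<in>Pow S. c A)"
    unfolding c_def using K\<beta>(1)
    by (intro sum_nonneg mult_nonneg_nonneg add_nonneg_nonneg bnd_nonneg lip_nonneg quad_nonneg) auto
  moreover have "\<bar>form (\<lambda>t. f t + d t) h S - form f h S - form f (h(k := d)) (insert k S)\<bar>
      \<le> (\<Sum>A\<in>Pow S. c A) * (L2norm T d)\<^sup>2 * (\<Prod>i\<in>S. L2norm T (h i))"
    if f: "f \<in> L2 T" and d: "d \<in> L2 T" and r: "L2norm T f \<le> r" "L2norm T (\<lambda>t. f t + d t) \<le> r"
      and h: "\<forall>i\<in>S. h i \<in> L2 T" for f d h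
  proof -
    let ?f' = "\<lambda>t. f t + d t" and ?h' = "h(k := d)" and ?P = "\<lambda>A. \<Prod>i\<in>A. L2norm T (h i)"
    have f': "?f' \<in> L2 T" using f d by (rule L2_add)
    have disj: "Pow S \<inter> insert k ` Pow S = {}" using k by auto
    have inj: "inj_on (insert k) (Pow S)" using k by (auto simp: inj_on_def)
    have h': "vr f ?h' A = vr f h A" if "A \<subseteq> S" for A
      by (rule fun_cong[of _ _ T], rule var_cong) (use that k in auto)
    \<comment> \<open>Subsets of \<open>insert k S\<close> without and with \<open>k\<close> are
      paired, which is the product rule for the new direction.\<close>
    have "form f ?h' (insert k S) = (\<Sum>A\<in>Pow S. \<beta> (vr f ?h' A) (vr f ?h' (insert k S - A)))
        + (\<Sum>A\<in>Pow S. \<beta> (vr f ?h' (insert k A)) (vr f ?h' (insert k S - insert k A)))"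
      unfolding form_def Pow_insert using S disj inj
      by (subst sum.union_disjoint) (auto simp: sum.reindex)
    also have "\<dots> = (\<Sum>A\<in>Pow S. \<beta> (vr f h A) (vr f ?h' (insert k (S - A))) + \<beta> (vr f ?h' (insert k A)) (vr f h (S - A)))"
      unfolding sum.distrib[symmetric]
    proof (rule sum.cong[OF refl])
      fix A assume "A \<in> Pow S"
      moreover from this have "insert k S - A = insert k (S - A)" "insert k S - insert k A = S - A"
        using k by auto
      ultimately show "\<beta> (vr f ?h' A) (vr f ?h' (insert k S - A)) + \<beta> (vr f ?h' (insert k A)) (vr f ?h' (insert k S - insert k A))
          = \<beta> (vr f h A) (vr f ?h' (insert k (S - A))) + \<beta> (vr f ?h' (insert k A)) (vr f h (S - A))"
        by (simp add: h')
    qed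
    finally have form': "form f ?h' (insert k S) = \<dots>" .
    have add_abs_le3: "\<bar>x\<bar> \<le> x' \<Longrightarrow> \<bar>y\<bar> \<le> y' \<Longrightarrow> \<bar>z\<bar> \<le> z' \<Longrightarrow> \<bar>x + y + z\<bar> \<le> x' + y' + z'"
      for x y z x' y' z' :: real
      by linarith
    have collect: "(q1 * \<delta>\<^sup>2 * a) * (b2 * b) * \<kappa> + (b1' * (\<delta> * a)) * (l * \<delta> * b) * \<kappa> + (b1 * a) * (q2 * \<delta>\<^sup>2 * b) * \<kappa>
        = \<kappa> * (q1 * b2 + b1' * l + b1 * q2) * \<delta>\<^sup>2 * (a * b)"
      for q1 q2 b1 b1' b2 l a b \<delta> \<kappa> :: real
      by (simp add: power2_eq_square algebra_simps)
    have "\<bar>\<beta> (vr ?f' h A) (vr ?f' h (S - A)) - \<beta> (vr f h A) (vr f h (S - A))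
        - (\<beta> (vr f h A) (vr f ?h' (insert k (S - A))) + \<beta> (vr f ?h' (insert k A)) (vr f h (S - A)))\<bar>
        \<le> c A * (L2norm T d)\<^sup>2 * ?P S" if "A \<in> Pow S" for A
    proof -
      have A: "finite A" "finite (S - A)" "A \<subseteq> S" "k \<notin> A" "k \<notin> S - A"
        using S finite_subset that k by auto
      let ?a' = "vr ?f' h A" and ?a = "vr f h A" and ?da = "vr f ?h' (insert k A)"
      let ?e' = "vr ?f' h (S - A)" and ?e = "vr f h (S - A)" and ?de = "vr f ?h' (insert k (S - A))"
      have hA: "\<And>i. i \<in> A \<Longrightarrow> h i \<in> L2 T" "\<And>i. i \<in> S - A \<Longrightarrow> h i \<in> L2 T" using h A by auto
      have TT: "T \<in> {0..T}" using T_pos by simp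
      have 1: "norm (?a' - ?a - ?da) \<le> ?q (card A) * (L2norm T d)\<^sup>2 * ?P A"
        using var_quadratic[OF f d r hA(1) A(1) refl A(4) TT] A by simp
      have 2: "norm ?e' \<le> ?b (card (S - A)) * ?P (S - A)"
        by (rule var_bound[OF f' r(2) hA(2) A(2) refl TT])
      have 3: "norm ?da \<le> ?b (Suc (card A)) * (L2norm T d * ?P A)"
      proof -
        have mem: "?h' i \<in> L2 T" if "i \<in> insert k A" for i using that hA d by auto
        have "norm ?da \<le> ?b (card (insert k A)) * (\<Prod>i\<in>insert k A. L2norm T (?h' i))"
          by (rule var_bound[OF f r(1) mem _ refl TT]) (use A in auto)
        also have "(\<Prod>i\<in>A. L2norm T (?h' i)) = ?P A"
          using A by (intro prod.cong) auto
        then have "(\<Prod>i\<in>insert k A. L2norm T (?h' i)) = L2norm T d * ?P A"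
          using A by simp
        finally show ?thesis using A by (simp del: fun_upd_apply)
      qed
      have 4: "norm (?e' - ?e) \<le> ?l (card (S - A)) * L2norm T d * ?P (S - A)"
        by (rule var_lipschitz[OF f d r hA(2) A(2) refl TT])
      have 5: "norm ?a \<le> ?b (card A) * ?P A"
        by (rule var_bound[OF f r(1) hA(1) A(1) refl TT])
      have 6: "norm (?e' - ?e - ?de) \<le> ?q (card (S - A)) * (L2norm T d)\<^sup>2 * ?P (S - A)"
        using var_quadratic[OF f d r hA(2) A(2) refl A(5) TT] A by simp
      \<comment> \<open>Product rule with remainder. Each of the three summands is quadratic in
        \<open>d\<close>: twice a second-order remainder meets a bounded factor, and once a
        derivative meets a first difference.\<close>
      have eq: "\<beta> ?a' ?e' - \<beta> ?a ?e - (\<beta> ?a ?de + \<beta> ?da ?e) =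
          \<beta> (?a' - ?a - ?da) ?e' + \<beta> ?da (?e' - ?e) + \<beta> ?a (?e' - ?e - ?de)"
        unfolding \<beta>.diff_left \<beta>.diff_right by linarith
      have "\<bar>\<beta> (?a' - ?a - ?da) ?e' + \<beta> ?da (?e' - ?e) + \<beta> ?a (?e' - ?e - ?de)\<bar>
          \<le> (?q (card A) * (L2norm T d)\<^sup>2 * ?P A) * (?b (card (S - A)) * ?P (S - A)) * K\<beta>
          + (?b (Suc (card A)) * (L2norm T d * ?P A)) * (?l (card (S - A)) * L2norm T d * ?P (S - A)) * K\<beta>
          + (?b (card A) * ?P A) * (?q (card (S - A)) * (L2norm T d)\<^sup>2 * ?P (S - A)) * K\<beta>"
        by (rule add_abs_le3[OF K\<beta>_le[OF 1 2] K\<beta>_le[OF 3 4] K\<beta>_le[OF 5 6]])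
      then show ?thesis
        unfolding eq collect c_def prod_Diff[OF S A(3)] .
    qed
    then have "\<bar>\<Sum>A\<in>Pow S. \<beta> (vr ?f' h A) (vr ?f' h (S - A)) - \<beta> (vr f h A) (vr f h (S - A))
        - (\<beta> (vr f h A) (vr f ?h' (insert k (S - A))) + \<beta> (vr f ?h' (insert k A)) (vr f h (S - A)))\<bar>
        \<le> (\<Sum>A\<in>Pow S. c A * (L2norm T d)\<^sup>2 * ?P S)"
      by (intro order_trans[OF sum_abs] sum_mono)
    then show ?thesis
      unfolding form' unfolding form_def sum_subtractf sum_distrib_right .
  qed
  ultimately show ?thesis by blast
qed

text \<open>Reversal lets \<open>d # hs\<close> extend the family of directions at the fresh index
  \<open>length hs\<close> and leaves the old indices alone, as \<open>form_derivative\<close>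
  expects. The order of the differential is the length of the list, so one function serves all
  orders; the constant \<open>c0\<close> survives only in order 0.\<close>

definition diffl :: "(real \<Rightarrow> real) \<Rightarrow> (real \<Rightarrow> real) list \<Rightarrow> real" where
  "diffl f hs = (if hs = [] then c0 else 0) + form f (\<lambda>i. rev hs ! i) {..<length hs}"

lemma diffl_Nil: "f \<in> L2 T \<Longrightarrow> diffl f [] = J f"
  by (simp add: diffl_def form_def J_eq var.simps)

lemma diffl_Cons: "diffl f (d # hs) = form f ((\<lambda>i. rev hs ! i)(length hs := d)) (insert (length hs) {..<length hs})"
proof -
  have "form f (\<lambda>i. (rev hs @ [d]) ! i) (insert (length hs) {..<length hs}) =
    form f ((\<lambda>i. rev hs ! i)(length hs := d)) (insert (length hs) {..<length hs})"
    by (rule form_cong) (auto simp: nth_append)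
  then show ?thesis by (simp add: diffl_def lessThan_Suc)
qed

lemma prod_list_rev_nth: "(\<Prod>h\<leftarrow>hs. g h) = (\<Prod>i<length hs. (g (rev hs ! i) :: real))"
proof -
  have "(\<Prod>h\<leftarrow>hs. g h) = prod_list (map g (rev hs))"
    by (simp add: rev_map[symmetric] prod_list.rev)
  also have "\<dots> = (\<Prod>i<length hs. g (rev hs ! i))"
    by (subst prod.list_conv_set_nth) (auto simp: atLeast0LessThan intro!: prod.cong)
  finally show ?thesis .
qed

lemma rev_nth_mem: "set hs \<subseteq> X \<Longrightarrow> i < length hs \<Longrightarrow> rev hs ! i \<in> X"
  by (metis length_rev nth_mem set_rev subsetD)

lemma diffl_update:
  assumes "i < length hs"
  shows "diffl f (hs[i := g]) = form f ((\<lambda>i. rev hs ! i)(length hs - 1 - i := g)) {..<length hs}"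
proof -
  have "form f (\<lambda>j. rev (hs[i := g]) ! j) {..<length hs} =
      form f ((\<lambda>i. rev hs ! i)(length hs - 1 - i := g)) {..<length hs}"
    using assms by (intro form_cong) (auto simp: rev_update nth_list_update)
  then show ?thesis using assms by (auto simp: diffl_def)
qed

lemma diffl_multilinear:
  assumes f: "f \<in> L2 T"
  shows "bounded_multilinear_form T k (diffl f)"
  unfolding bounded_multilinear_form_def
proof (intro conjI allI impI)
  fix hs i g assume *: "length hs = k \<and> set hs \<subseteq> L2 T \<and> i < k \<and> g \<in> L2 T"
  define h where "h i = rev hs ! i" for i
  define m where "m = length hs - 1 - i"
  have m: "m < length hs" using * by (auto simp: m_def)
  have mem: "h j \<in> L2 T" if "j < length hs" for j
    using * that by (auto simp: h_def intro!: rev_nth_mem)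
  have hm: "hs ! i = h m" using * by (simp add: h_def m_def rev_nth)
  have "diffl f (hs[i := (\<lambda>t. (hs ! i) t + g t)]) = form f (h(m := \<lambda>t. 1 * h m t + 1 * g t)) {..<length hs}"
    using * hm diffl_update[of i hs] by (simp add: h_def[abs_def] m_def)
  also have "\<dots> = 1 * form f (h(m := h m)) {..<length hs} + 1 * form f (h(m := g)) {..<length hs}"
    using * mem m by (intro form_linear f) auto
  also have "\<dots> = diffl f hs + diffl f (hs[i := g])"
    using * diffl_update[of i hs f g] by (auto simp: h_def[abs_def] m_def diffl_def)
  finally show "diffl f (hs[i := (\<lambda>t. (hs ! i) t + g t)]) = diffl f hs + diffl f (hs[i := g])" .
next
  fix hs i c assume *: "length hs = k \<and> set hs \<subseteq> L2 T \<and> i < k"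
  define h where "h i = rev hs ! i" for i
  define m where "m = length hs - 1 - i"
  have m: "m < length hs" using * by (auto simp: m_def)
  have mem: "h j \<in> L2 T" if "j < length hs" for j
    using * that by (auto simp: h_def intro!: rev_nth_mem)
  have hm: "hs ! i = h m" using * by (simp add: h_def m_def rev_nth)
  have "diffl f (hs[i := (\<lambda>t. c * (hs ! i) t)]) = form f (h(m := \<lambda>t. c * h m t + 0 * h m t)) {..<length hs}"
    using * hm diffl_update[of i hs] by (simp add: h_def[abs_def] m_def)
  also have "\<dots> = c * form f (h(m := h m)) {..<length hs} + 0 * form f (h(m := h m)) {..<length hs}"
    using * mem m by (intro form_linear f) auto
  also have "\<dots> = c * diffl f hs"
    using * by (auto simp: h_def[abs_def] diffl_def)
  finally show "diffl f (hs[i := (\<lambda>t. c * (hs ! i) t)]) = c * diffl f hs" .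
next
  let ?C = "\<bar>c0\<bar> + (\<Sum>A\<in>Pow {..<k}. bnd x0 (L2norm T f) (card A) * bnd x0 (L2norm T f) (card ({..<k} - A)) * K\<beta>)"
  show "\<exists>C. \<forall>hs. length hs = k \<and> set hs \<subseteq> L2 T \<longrightarrow> \<bar>diffl f hs\<bar> \<le> C * (\<Prod>h\<leftarrow>hs. L2norm T h)"
  proof (intro exI allI impI)
    fix hs assume *: "length hs = k \<and> set hs \<subseteq> L2 T"
    have "\<bar>form f (\<lambda>i. rev hs ! i) {..<k}\<bar> \<le> (\<Sum>A\<in>Pow {..<k}. bnd x0 (L2norm T f) (card A) * bnd x0 (L2norm T f) (card ({..<k} - A)) * K\<beta>)
      * (\<Prod>i<k. L2norm T (rev hs ! i))"
      using * by (intro form_bound f) (auto intro!: rev_nth_mem)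
    moreover have "\<bar>if hs = [] then c0 else 0\<bar> \<le> \<bar>c0\<bar> * (\<Prod>i<k. L2norm T (rev hs ! i))"
      using * by (auto intro!: mult_nonneg_nonneg prod_nonneg)
    ultimately show "\<bar>diffl f hs\<bar> \<le> ?C * (\<Prod>h\<leftarrow>hs. L2norm T h)"
      using * unfolding diffl_def prod_list_rev_nth distrib_right by simp
  qed
qed

theorem has_frechet_differential_diffl:
  "f \<in> L2 T \<Longrightarrow> has_frechet_differential T J k f (diffl f)"
proof (induction k arbitrary: f)
  case 0
  then show ?case by (simp add: diffl_Nil)
next
  case (Suc k)
  \<comment> \<open>Given the factor 2 in \<open>L2norm_add_le\<close>, this radius covers
    \<open>f\<close> and every \<open>f + d\<close> with the norm of \<open>d\<close> at most
    1.\<close>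
  define r where "r = 2 * (L2norm T f + 1)"
  have r: "L2norm T f \<le> r" using L2norm_nonneg[of T f] by (simp add: r_def)
  obtain C where C: "C \<ge> 0" "\<forall>f d h. f \<in> L2 T \<and> d \<in> L2 T \<and> L2norm T f \<le> r \<and> L2norm T (\<lambda>t. f t + d t) \<le> r \<and> (\<forall>i\<in>{..<k}. h i \<in> L2 T)
    \<longrightarrow> \<bar>form (\<lambda>t. f t + d t) h {..<k} - form f h {..<k} - form f (h(k := d)) (insert k {..<k})\<bar>
      \<le> C * (L2norm T d)\<^sup>2 * (\<Prod>i\<in>{..<k}. L2norm T (h i))"
    using form_derivative[of "{..<k}" k r] by auto
  have main: "\<exists>\<delta>>0. \<forall>d\<in>L2 T. L2norm T d < \<delta> \<longrightarrow> (\<forall>hs. length hs = k \<and> set hs \<subseteq> L2 T \<longrightarrow>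
      \<bar>diffl (\<lambda>t. f t + d t) hs - diffl f hs - diffl f (d # hs)\<bar> \<le> \<epsilon> * L2norm T d * (\<Prod>h\<leftarrow>hs. L2norm T h))"
    if \<epsilon>: "\<epsilon> > 0" for \<epsilon>
  proof (intro exI conjI ballI allI impI)
    show "0 < min 1 (\<epsilon> / (C + 1))" using \<epsilon> C by simp
    fix d hs assume d: "d \<in> L2 T" "L2norm T d < min 1 (\<epsilon> / (C + 1))" and hs: "length hs = k \<and> set hs \<subseteq> L2 T"
    have "L2norm T (\<lambda>t. f t + d t) \<le> r"
      using L2norm_add_le[OF Suc.prems d(1)] d(2) by (simp add: r_def)
    then have "\<bar>form (\<lambda>t. f t + d t) (\<lambda>i. rev hs ! i) {..<k} - form f (\<lambda>i. rev hs ! i) {..<k}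
        - form f ((\<lambda>i. rev hs ! i)(k := d)) (insert k {..<k})\<bar>
        \<le> C * (L2norm T d)\<^sup>2 * (\<Prod>i<k. L2norm T (rev hs ! i))"
      using C(2) Suc.prems d(1) r hs by (auto intro!: rev_nth_mem)
    also have "\<dots> \<le> \<epsilon> * L2norm T d * (\<Prod>i<k. L2norm T (rev hs ! i))"
    proof -
      have "C * L2norm T d \<le> (C + 1) * (\<epsilon> / (C + 1))"
        using C d by (intro mult_mono) auto
      then have "C * L2norm T d \<le> \<epsilon>" using C by simp
      then have "C * L2norm T d * L2norm T d \<le> \<epsilon> * L2norm T d"
        by (rule mult_right_mono) simp
      then show ?thesis
        by (intro mult_right_mono prod_nonneg) (auto simp: power2_eq_square)
    qed
    finally show "\<bar>diffl (\<lambda>t. f t + d t) hs - diffl f hs - diffl f (d # hs)\<bar> \<le> \<epsilon> * L2norm T d * (\<Prod>h\<leftarrow>hs. L2norm T h)"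
      using hs unfolding diffl_Cons prod_list_rev_nth by (simp add: diffl_def)
  qed
  show ?case
    unfolding has_frechet_differential.simps
  \<comment> \<open>The family of lower differentials is \<open>diffl\<close> itself, which exists
    at every control; hence the radius 1 of the neighbourhood is an arbitrary choice.\<close>
  proof (rule conjI[OF diffl_multilinear[OF Suc.prems]], rule exI[of _ diffl], rule exI[of _ "1::real"], intro conjI)
    show "\<forall>g\<in>L2 T. L2norm T (\<lambda>t. g t - f t) < 1 \<longrightarrow> has_frechet_differential T J k g (diffl g)"
      using Suc.IH by blast
    show "\<forall>\<epsilon>>0. \<exists>\<delta>>0. \<forall>d\<in>L2 T. L2norm T d < \<delta> \<longrightarrow> (\<forall>hs. length hs = k \<and> set hs \<subseteq> L2 T \<longrightarrow>
        \<bar>diffl (\<lambda>t. f t + d t) hs - diffl f hs - diffl f (d # hs)\<bar> \<le> \<epsilon> * L2norm T d * (\<Prod>h\<leftarrow>hs. L2norm T h))"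
      using main by blast
  qed simp
qed

section \<open>Dyson expansion and Taylor coefficients at the zero control\<close>

abbreviation dyson :: "(real \<Rightarrow> real) \<Rightarrow> nat \<Rightarrow> real \<Rightarrow> 'a" where
  "dyson d n \<equiv> (volt d ^^ n) (\<lambda>t. x0)"

lemma L2_zero: "(\<lambda>t. 0) \<in> L2 T"
  by (intro L2_continuous continuous_intros)

lemma dyson_continuous: "d \<in> L2 T \<Longrightarrow> continuous_on {0..T} (dyson d n)"
  by (induction n) (auto intro!: volt_continuous)

lemma norm_dyson_le:
  assumes "d \<in> L2 T" "t \<in> {0..T}"
  shows "norm (dyson d n t) \<le> (step * L2norm T d) ^ n * norm x0"
  using assms(2)
proof (induction n arbitrary: t)
  case (Suc n)
  have "norm (volt d (dyson d n) t) \<le> step * L2norm T d * ((step * L2norm T d) ^ n * norm x0)"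
    by (intro norm_volt_step assms dyson_continuous Suc)
  then show ?case by (simp add: mult.assoc)
qed simp

text \<open>At the zero control the implicit part of the Volterra equation disappears. With equal
  directions all summands agree, and unfolding the recursion collects \<open>fact n\<close>.\<close>

lemma var_zero:
  assumes d: "d \<in> L2 T" and S: "finite S" "card S = n" and t: "t \<in> {0..T}"
  shows "var n x0 (\<lambda>t. 0) (\<lambda>_. d) S t = fact n *\<^sub>R dyson d n t"
  using S t
proof (induction n arbitrary: S t)
  case 0
  then show ?case
    using var_solves[OF L2_zero, of S "\<lambda>_. d" 0 x0] d by (auto simp: solves_def)
next
  case (Suc n)
  have "var (Suc n) x0 (\<lambda>t. 0) (\<lambda>_. d) S t = (\<Sum>i\<in>S. volt d (var n x0 (\<lambda>t. 0) (\<lambda>_. d) (S - {i})) t)"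
    using var_solves[OF L2_zero, of S "\<lambda>_. d" "Suc n" x0] d Suc.prems unfolding solves_def by auto
  also have "\<dots> = (\<Sum>i\<in>S. fact n *\<^sub>R volt d (dyson d n) t)"
  proof (rule sum.cong[OF refl])
    fix i assume i: "i \<in> S"
    have "volt d (var n x0 (\<lambda>t. 0) (\<lambda>_. d) (S - {i})) t = volt d (\<lambda>s. fact n *\<^sub>R dyson d n s) t"
      using Suc i by (intro volt_cong) auto
    then show "volt d (var n x0 (\<lambda>t. 0) (\<lambda>_. d) (S - {i})) t = fact n *\<^sub>R volt d (dyson d n) t"
      by (simp add: volt_cmult)
  qed
  also have "\<dots> = fact (Suc n) *\<^sub>R dyson d (Suc n) t"
    using Suc.prems by (simp add: sum_constant_scaleR)
  finally show ?case .
qed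

definition taylor :: "(real \<Rightarrow> real) \<Rightarrow> nat \<Rightarrow> real" where
  "taylor d k = (\<Sum>i\<le>k. \<beta> (dyson d i T) (dyson d (k - i) T))"

text \<open>Subsets are grouped by size: there are \<open>k choose i\<close> of them, each with
  weight \<open>fact i * fact (k - i)\<close>, which multiplies to \<open>fact k\<close>. Order 0 is
  excluded because \<open>diffl\<close> adds \<open>c0\<close> there.\<close>

lemma diffl_zero:
  assumes d: "d \<in> L2 T" and k: "k > 0"
  shows "diffl (\<lambda>t. 0) (replicate k d) = fact k * taylor d k"
proof -
  have TT: "T \<in> {0..T}" using T_pos by simp
  have "diffl (\<lambda>t. 0) (replicate k d) = form (\<lambda>t. 0) (\<lambda>_. d) {..<k}"
    using k by (auto simp: diffl_def intro!: form_cong)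
  also have "\<dots> = (\<Sum>A\<in>Pow {..<k}. fact (card A) * fact (k - card A) * \<beta> (dyson d (card A) T) (dyson d (k - card A) T))"
    unfolding form_def
  proof (rule sum.cong[OF refl])
    fix A assume "A \<in> Pow {..<k}"
    then have "finite A" "A \<subseteq> {..<k}" by (auto intro: finite_subset)
    then have A: "finite A" "card ({..<k} - A) = k - card A"
      by (simp_all add: card_Diff_subset)
    show "\<beta> (vr (\<lambda>t. 0) (\<lambda>_. d) A) (vr (\<lambda>t. 0) (\<lambda>_. d) ({..<k} - A)) =
        fact (card A) * fact (k - card A) * \<beta> (dyson d (card A) T) (dyson d (k - card A) T)"
      using A var_zero[OF d A(1) refl TT] var_zero[OF d _ A(2) TT]
      by (simp add: \<beta>.scaleR_left \<beta>.scaleR_right)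
  qed
  also have "\<dots> = (\<Sum>i\<le>k. \<Sum>A\<in>{A \<in> Pow {..<k}. card A = i}.
      fact (card A) * fact (k - card A) * \<beta> (dyson d (card A) T) (dyson d (k - card A) T))"
  proof (rule sum.group[symmetric])
    show "card ` Pow {..<k} \<subseteq> {..k}"
      using card_mono[of "{..<k}"] by auto
  qed auto
  also have "\<dots> = (\<Sum>i\<le>k. real (k choose i) * (fact i * fact (k - i) * \<beta> (dyson d i T) (dyson d (k - i) T)))"
  proof (rule sum.cong[OF refl])
    fix i assume "i \<in> {..k}"
    have "card {A \<in> Pow {..<k}. card A = i} = k choose i"
      using n_subsets[of "{..<k}" i] by (simp add: Pow_def)
    then show "(\<Sum>A\<in>{A \<in> Pow {..<k}. card A = i}.
        fact (card A) * fact (k - card A) * \<beta> (dyson d (card A) T) (dyson d (k - card A) T)) =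
        real (k choose i) * (fact i * fact (k - i) * \<beta> (dyson d i T) (dyson d (k - i) T))"
      by simp
  qed
  also have "\<dots> = (\<Sum>i\<le>k. fact k * \<beta> (dyson d i T) (dyson d (k - i) T))"
    by (intro sum.cong refl) (auto simp: binomial_fact)
  finally show ?thesis by (simp add: taylor_def sum_distrib_left)
qed

text \<open>The solution provides its own remainder: \<open>n\<close> substitutions of
  \<open>X = x0 + volt d X\<close> leave \<open>n\<close> Dyson terms and
  \<open>(volt d ^^ n) X\<close>, which is of order \<open>n\<close> in the norm of
  \<open>d\<close>.\<close>

lemma taylor_remainder:
  assumes d: "d \<in> L2 T" and d1: "L2norm T d \<le> 1"
  shows "\<bar>J d - (c0 + (\<Sum>k<N. taylor d k))\<bar> \<le>
    (real N + 1) * (step ^ N * growth 1 * (norm x0)\<^sup>2 * K\<beta> * max 1 (growth 1)) * L2norm T d ^ N"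
proof -
  have TT: "T \<in> {0..T}" using T_pos by simp
  define X where "X = sol d (\<lambda>t. x0)"
  define q where "q = step * L2norm T d"
  have q: "q \<ge> 0" using step_nonneg by (simp add: q_def)
  have X: "continuous_on {0..T} X" "\<And>t. t \<in> {0..T} \<Longrightarrow> X t = x0 + volt d X t"
    using sol_solves[OF d, of "\<lambda>t. x0"] by (auto simp: X_def solves_def)
  have Xb: "norm (X t) \<le> growth 1 * norm x0" if "t \<in> {0..T}" for t
    using solves_bound[OF d sol_solves[OF d, of "\<lambda>t. x0"] _ d1 that] by (simp add: X_def)
  define R where "R n = (volt d ^^ n) X" for n
  have Rc: "continuous_on {0..T} (R n)" for n
    unfolding R_def by (induction n) (auto intro!: volt_continuous d X)
  have Rb: "norm (R n t) \<le> q ^ n * (growth 1 * norm x0)" if "t \<in> {0..T}" for n t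
    using that
  proof (induction n arbitrary: t)
    case 0
    then show ?case using Xb by (simp add: R_def)
  next
    case (Suc n)
    have "norm (volt d (R n) t) \<le> step * L2norm T d * (q ^ n * (growth 1 * norm x0))"
      by (intro norm_volt_step d Rc Suc)
    then show ?case by (simp add: R_def q_def mult.assoc)
  qed
  have XR: "X t = (\<Sum>i<n. dyson d i t) + R n t" if "t \<in> {0..T}" for n t
  proof (induction n)
    case 0
    then show ?case by (simp add: R_def)
  next
    case (Suc n)
    have "R n t = dyson d n t + R (Suc n) t"
      using that
    proof (induction n arbitrary: t)
      case 0
      then show ?case using X(2) by (simp add: R_def)
    next
      case (Suc n)
      have "R (Suc n) t = volt d (R n) t" by (simp add: R_def)
      also have "\<dots> = volt d (\<lambda>s. dyson d n s + R (Suc n) s) t"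
        using Suc by (intro volt_cong) auto
      also have "\<dots> = volt d (dyson d n) t + volt d (R (Suc n)) t"
        using Suc.prems by (intro volt_add d dyson_continuous Rc) auto
      finally show ?case by (simp add: R_def)
    qed
    then show ?case using Suc by simp
  qed
  have "\<beta> (X T) (X T) = (\<Sum>i<N. \<beta> (dyson d i T) (X T)) + \<beta> (R N T) (X T)"
    by (subst XR[OF TT, of N]) (simp add: \<beta>.add_left \<beta>.sum_left)
  \<comment> \<open>The second argument is expanded only to order \<open>N - i\<close>, so that the
    double sum runs over \<open>i + j < N\<close> and each remaining product has total order
    \<open>N\<close>.\<close>
  also have "(\<Sum>i<N. \<beta> (dyson d i T) (X T)) =
      (\<Sum>i<N. (\<Sum>j<N - i. \<beta> (dyson d i T) (dyson d j T)) + \<beta> (dyson d i T) (R (N - i) T))"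
  proof (rule sum.cong[OF refl])
    fix i
    show "\<beta> (dyson d i T) (X T) = (\<Sum>j<N - i. \<beta> (dyson d i T) (dyson d j T)) + \<beta> (dyson d i T) (R (N - i) T)"
      by (subst XR[OF TT, of "N - i"]) (simp add: \<beta>.add_right \<beta>.sum_right)
  qed
  also have "\<dots> = (\<Sum>k<N. taylor d k) + (\<Sum>i<N. \<beta> (dyson d i T) (R (N - i) T))"
  proof -
    have "(\<Sum>i<N. \<Sum>j<N - i. \<beta> (dyson d i T) (dyson d j T)) =
        (\<Sum>(i,j)\<in>{(i,j). i + j < N}. \<beta> (dyson d i T) (dyson d j T))"
      by (subst sum.Sigma) (auto intro!: sum.cong)
    also have "\<dots> = (\<Sum>k<N. taylor d k)"
      unfolding taylor_def by (rule sum.triangle_reindex)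
    finally show ?thesis by (simp add: sum.distrib)
  qed
  finally have "J d - (c0 + (\<Sum>k<N. taylor d k)) = (\<Sum>i<N. \<beta> (dyson d i T) (R (N - i) T)) + \<beta> (R N T) (X T)"
    by (simp add: J_eq[OF d] X_def)
  also have "\<bar>\<dots>\<bar> \<le> (\<Sum>i<N. q ^ N * growth 1 * (norm x0)\<^sup>2 * K\<beta>) + q ^ N * growth 1 * (norm x0)\<^sup>2 * K\<beta> * growth 1"
  proof (intro order_trans[OF abs_triangle_ineq] add_mono order_trans[OF sum_abs] sum_mono)
    fix i assume i: "i \<in> {..<N}"
    have "\<bar>\<beta> (dyson d i T) (R (N - i) T)\<bar> \<le> (q ^ i * norm x0) * (q ^ (N - i) * (growth 1 * norm x0)) * K\<beta>"
      using norm_dyson_le[OF d TT] by (intro K\<beta>_le Rb TT) (auto simp: q_def)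
    also have "\<dots> = (q ^ i * q ^ (N - i)) * growth 1 * (norm x0)\<^sup>2 * K\<beta>"
      by (simp add: power2_eq_square)
    also have "q ^ i * q ^ (N - i) = q ^ N" using i by (simp flip: power_add)
    finally show "\<bar>\<beta> (dyson d i T) (R (N - i) T)\<bar> \<le> q ^ N * growth 1 * (norm x0)\<^sup>2 * K\<beta>" .
  next
    have "\<bar>\<beta> (R N T) (X T)\<bar> \<le> (q ^ N * (growth 1 * norm x0)) * (growth 1 * norm x0) * K\<beta>"
      by (intro K\<beta>_le Rb TT Xb)
    then show "\<bar>\<beta> (R N T) (X T)\<bar> \<le> q ^ N * growth 1 * (norm x0)\<^sup>2 * K\<beta> * growth 1"
      by (simp add: power2_eq_square mult_ac)
  qed
  also have "\<dots> = q ^ N * growth 1 * (norm x0)\<^sup>2 * K\<beta> * (real N + growth 1)"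
    by (simp add: algebra_simps)
  also have "\<dots> \<le> q ^ N * growth 1 * (norm x0)\<^sup>2 * K\<beta> * ((real N + 1) * max 1 (growth 1))"
  proof (rule mult_left_mono)
    have "real N * 1 \<le> real N * max 1 (growth 1)" by (intro mult_left_mono) auto
    then show "real N + growth 1 \<le> (real N + 1) * max 1 (growth 1)"
      by (simp add: algebra_simps)
    show "0 \<le> q ^ N * growth 1 * (norm x0)\<^sup>2 * K\<beta>"
      using q K\<beta>(1) growth_pos[of 1] by simp
  qed
  finally show ?thesis by (simp add: q_def power_mult_distrib mult_ac)
qed

theorem taylor_expansion:
  assumes "\<epsilon> > 0"
  shows "\<exists>\<delta>>0. \<forall>d\<in>L2 T. L2norm T d < \<delta> \<longrightarrow>
    \<bar>J d - (c0 + (\<Sum>k\<le>n. taylor d k))\<bar> \<le> \<epsilon> * L2norm T d ^ n"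
proof -
  \<comment> \<open>The remainder bound one order beyond \<open>n\<close>; its surplus factor
    \<open>L2norm T d\<close> is made smaller than \<open>\<epsilon> / (C + 1)\<close>.\<close>
  define C where "C = (real (Suc n) + 1) * (step ^ Suc n * growth 1 * (norm x0)\<^sup>2 * K\<beta> * max 1 (growth 1))"
  have C: "C \<ge> 0"
    using step_nonneg growth_pos[of 1] K\<beta>(1) by (simp add: C_def)
  show ?thesis
  proof (intro exI[of _ "min 1 (\<epsilon> / (C + 1))"] conjI ballI impI)
    show "0 < min 1 (\<epsilon> / (C + 1))" using C assms by simp
    fix d assume d: "d \<in> L2 T" "L2norm T d < min 1 (\<epsilon> / (C + 1))"
    have "\<bar>J d - (c0 + (\<Sum>k<Suc n. taylor d k))\<bar> \<le> C * L2norm T d ^ Suc n"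
      unfolding C_def using d by (intro taylor_remainder) auto
    also have "\<dots> = (C * L2norm T d) * L2norm T d ^ n" by simp
    also have "\<dots> \<le> \<epsilon> * L2norm T d ^ n"
    proof (rule mult_right_mono)
      have "C * L2norm T d \<le> (C + 1) * (\<epsilon> / (C + 1))"
        using C d by (intro mult_mono) auto
      then show "C * L2norm T d \<le> \<epsilon>" using C by simp
    qed simp
    finally show "\<bar>J d - (c0 + (\<Sum>k\<le>n. taylor d k))\<bar> \<le> \<epsilon> * L2norm T d ^ n"
      by (simp add: lessThan_Suc_atMost)
  qed
qed

end

section \<open>Criteria for absolute continuity and the three-level generator\<close>

lemma division_of_interval_real:
  fixes d :: "real set set"
  assumes "d division_of t" "K \<in> d"
  obtains a b where "K = {a..b}" "a \<le> b" "{a..b} \<subseteq> t" "Sup K = b" "Inf K = a"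
proof -
  obtain a b where K: "K = cbox a b" "K \<noteq> {}" "K \<subseteq> t"
    using division_ofD(2,3,4)[OF assms(1)] assms(2) by metis
  then show thesis using that[of a b] by auto
qed

lemma absolutely_continuous_fun_on_dominated:
  assumes ac: "absolutely_continuous_fun_on S x"
    and le: "\<And>u v. u \<in> S \<Longrightarrow> v \<in> S \<Longrightarrow> norm (w v - w u) \<le> c * norm (x v - x u)"
  shows "absolutely_continuous_fun_on S w"
  unfolding absolutely_continuous_fun_on_def
proof (intro allI impI)
  fix \<epsilon> :: real assume "\<epsilon> > 0"
  then have "\<epsilon> / (\<bar>c\<bar> + 1) > 0" by (simp add: add_nonneg_pos)
  then obtain \<delta> where \<delta>: "\<delta> > 0" "\<And>d t. d division_of t \<and> t \<subseteq> S \<and> (\<Sum>k\<in>d. Sup k - Inf k) < \<delta> \<Longrightarrow>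
      (\<Sum>k\<in>d. norm (x (Sup k) - x (Inf k))) < \<epsilon> / (\<bar>c\<bar> + 1)"
    using ac unfolding absolutely_continuous_fun_on_def by blast
  show "\<exists>\<delta>>0. \<forall>d t. d division_of t \<and> t \<subseteq> S \<and> (\<Sum>k\<in>d. Sup k - Inf k) < \<delta> \<longrightarrow>
      (\<Sum>k\<in>d. norm (w (Sup k) - w (Inf k))) < \<epsilon>"
  proof (intro exI[of _ \<delta>] conjI allI impI \<delta>(1))
    fix d t assume *: "d division_of t \<and> t \<subseteq> S \<and> (\<Sum>k\<in>d. Sup k - Inf k) < \<delta>"
    have "(\<Sum>k\<in>d. norm (w (Sup k) - w (Inf k))) \<le> (\<Sum>k\<in>d. (\<bar>c\<bar> + 1) * norm (x (Sup k) - x (Inf k)))"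
    proof (rule sum_mono)
      fix k assume "k \<in> d"
      then obtain a b where k: "k = {a..b}" "a \<le> b" "{a..b} \<subseteq> t" "Sup k = b" "Inf k = a"
        using division_of_interval_real * by metis
      then have "Sup k \<in> S" "Inf k \<in> S" using * by auto
      then have "norm (w (Sup k) - w (Inf k)) \<le> c * norm (x (Sup k) - x (Inf k))" by (intro le)
      also have "\<dots> \<le> (\<bar>c\<bar> + 1) * norm (x (Sup k) - x (Inf k))" by (intro mult_right_mono) auto
      finally show "norm (w (Sup k) - w (Inf k)) \<le> (\<bar>c\<bar> + 1) * norm (x (Sup k) - x (Inf k))" .
    qed
    also have "\<dots> = (\<bar>c\<bar> + 1) * (\<Sum>k\<in>d. norm (x (Sup k) - x (Inf k)))"
      by (simp add: sum_distrib_left)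
    also have "\<dots> < (\<bar>c\<bar> + 1) * (\<epsilon> / (\<bar>c\<bar> + 1))"
      using \<delta>(2)[OF *] by (intro mult_strict_left_mono) auto
    also have "\<dots> = \<epsilon>" by (simp add: add_nonneg_eq_0_iff)
    finally show "(\<Sum>k\<in>d. norm (w (Sup k) - w (Inf k))) < \<epsilon>" .
  qed
qed

lemma absolutely_continuous_fun_on_diff:
  assumes x: "absolutely_continuous_fun_on S x" and y: "absolutely_continuous_fun_on S y"
  shows "absolutely_continuous_fun_on S (\<lambda>t. x t - y t)"
  unfolding absolutely_continuous_fun_on_def
proof (intro allI impI)
  fix \<epsilon> :: real assume "\<epsilon> > 0"
  then have "\<epsilon> / 2 > 0" by simp
  obtain \<delta>1 where \<delta>1: "\<delta>1 > 0" "\<And>d t. d division_of t \<and> t \<subseteq> S \<and> (\<Sum>k\<in>d. Sup k - Inf k) < \<delta>1 \<Longrightarrow>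
      (\<Sum>k\<in>d. norm (x (Sup k) - x (Inf k))) < \<epsilon> / 2"
    using x \<open>\<epsilon> / 2 > 0\<close> unfolding absolutely_continuous_fun_on_def by blast
  obtain \<delta>2 where \<delta>2: "\<delta>2 > 0" "\<And>d t. d division_of t \<and> t \<subseteq> S \<and> (\<Sum>k\<in>d. Sup k - Inf k) < \<delta>2 \<Longrightarrow>
      (\<Sum>k\<in>d. norm (y (Sup k) - y (Inf k))) < \<epsilon> / 2"
    using y \<open>\<epsilon> / 2 > 0\<close> unfolding absolutely_continuous_fun_on_def by blast
  show "\<exists>\<delta>>0. \<forall>d t. d division_of t \<and> t \<subseteq> S \<and> (\<Sum>k\<in>d. Sup k - Inf k) < \<delta> \<longrightarrow>
      (\<Sum>k\<in>d. norm (x (Sup k) - y (Sup k) - (x (Inf k) - y (Inf k)))) < \<epsilon>"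
  proof (intro exI[of _ "min \<delta>1 \<delta>2"] conjI allI impI)
    fix d t assume *: "d division_of t \<and> t \<subseteq> S \<and> (\<Sum>k\<in>d. Sup k - Inf k) < min \<delta>1 \<delta>2"
    have "(\<Sum>k\<in>d. norm (x (Sup k) - y (Sup k) - (x (Inf k) - y (Inf k)))) \<le>
        (\<Sum>k\<in>d. norm (x (Sup k) - x (Inf k)) + norm (y (Sup k) - y (Inf k)))"
    proof (rule sum_mono)
      fix k
      have "x (Sup k) - y (Sup k) - (x (Inf k) - y (Inf k)) = (x (Sup k) - x (Inf k)) - (y (Sup k) - y (Inf k))"
        by simp
      then show "norm (x (Sup k) - y (Sup k) - (x (Inf k) - y (Inf k))) \<le> norm (x (Sup k) - x (Inf k)) + norm (y (Sup k) - y (Inf k))"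
        by (metis norm_triangle_ineq4)
    qed
    also have "\<dots> < \<epsilon>"
      using \<delta>1(2)[of d t] \<delta>2(2)[of d t] * by (simp add: sum.distrib)
    finally show "(\<Sum>k\<in>d. norm (x (Sup k) - y (Sup k) - (x (Inf k) - y (Inf k)))) < \<epsilon>" .
  qed (use \<delta>1 \<delta>2 in auto)
qed

lemma absolutely_continuous_fun_on_imp_continuous_on:
  assumes "absolutely_continuous_fun_on {a..b} x"
  shows "continuous_on {a..b} x"
  unfolding continuous_on_iff
proof (intro ballI allI impI)
  fix u and \<epsilon> :: real assume u: "u \<in> {a..b}" and "\<epsilon> > 0"
  then obtain \<delta> where \<delta>: "\<delta> > 0" "\<And>d t. d division_of t \<and> t \<subseteq> {a..b} \<and> (\<Sum>k\<in>d. Sup k - Inf k) < \<delta> \<Longrightarrow>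
      (\<Sum>k\<in>d. norm (x (Sup k) - x (Inf k))) < \<epsilon>"
    using assms unfolding absolutely_continuous_fun_on_def by blast
  have "dist (x v) (x u) < \<epsilon>" if v: "v \<in> {a..b}" "dist v u < \<delta>" for v
  proof -
    define l m where "l = min u v" and "m = max u v"
    have "{{l..m}} division_of {l..m}"
      using division_of_self[of l m] by (simp add: l_def m_def)
    moreover have "{l..m} \<subseteq> {a..b}" using u v by (auto simp: l_def m_def)
    moreover have lm: "l \<le> m" by (simp add: l_def m_def)
    moreover have "m - l < \<delta>" using v by (auto simp: l_def m_def dist_real_def)
    ultimately have "norm (x m - x l) < \<epsilon>"
      using \<delta>(2)[of "{{l..m}}" "{l..m}"] by simp
    then show ?thesis
      by (auto simp: l_def m_def dist_norm norm_minus_commute min_def max_def split: if_splits)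
  qed
  then show "\<exists>\<delta>>0. \<forall>v\<in>{a..b}. dist v u < \<delta> \<longrightarrow> dist (x v) (x u) < \<epsilon>"
    using \<delta>(1) by blast
qed

text \<open>The integral of \<open>\<bar>f\<bar>\<close> over a set of small length is controlled by
  \<open>\<bar>f s\<bar> \<le> \<eta> * (f s)^2 + 1 / \<eta>\<close>. Choosing \<open>\<eta>\<close>
  first makes the square part small, as all intervals together contribute at most \<open>F\<close>;
  then \<open>\<delta>\<close> is chosen against \<open>1 / \<eta>\<close> for the part proportional
  to length.\<close>

lemma absolutely_continuous_fun_onI_L2:
  assumes f: "f \<in> L2 T"
    and le: "\<And>u v. 0 \<le> u \<Longrightarrow> u \<le> v \<Longrightarrow> v \<le> T \<Longrightarrow>
      norm (x v - x u) \<le> c * integral {u..v} (\<lambda>s. \<bar>f s\<bar>) + c * (v - u)"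
  shows "absolutely_continuous_fun_on {0..T} x"
  unfolding absolutely_continuous_fun_on_def
proof (intro allI impI)
  fix \<epsilon> :: real assume \<epsilon>: "\<epsilon> > 0"
  define F where "F = integral {0..T} (\<lambda>s. (f s)\<^sup>2)"
  define c' where "c' = \<bar>c\<bar> + 1"
  have F: "F \<ge> 0" unfolding F_def using L2_square_integrable[OF f] by (intro integral_nonneg) auto
  define \<eta> where "\<eta> = \<epsilon> / (2 * c' * (F + 1))"
  have c': "c' > 0" by (simp add: c'_def)
  have \<eta>: "\<eta> > 0" using \<epsilon> c' F by (simp add: \<eta>_def)
  define \<delta> where "\<delta> = \<epsilon> / (2 * c' * (1 / \<eta> + 1))"
  have cancel: "a * (e / (2 * a * b)) * b = e / 2" "a * b * (e / (2 * a * b)) = e / 2"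
    if "a > 0" "b > 0" for a b e :: real
    using that by simp_all
  have \<eta>1: "1 / \<eta> + 1 > 0" using \<eta> by (simp add: add_pos_pos)
  show "\<exists>\<delta>>0. \<forall>d t. d division_of t \<and> t \<subseteq> {0..T} \<and> (\<Sum>k\<in>d. Sup k - Inf k) < \<delta> \<longrightarrow>
      (\<Sum>k\<in>d. norm (x (Sup k) - x (Inf k))) < \<epsilon>"
  proof (intro exI[of _ \<delta>] conjI allI impI)
    show "\<delta> > 0" using \<epsilon> c' \<eta>1 by (simp add: \<delta>_def)
    fix d t assume *: "d division_of t \<and> t \<subseteq> {0..T} \<and> (\<Sum>k\<in>d. Sup k - Inf k) < \<delta>"
    have "(\<Sum>k\<in>d. norm (x (Sup k) - x (Inf k))) \<le>
        (\<Sum>k\<in>d. c' * \<eta> * integral k (\<lambda>s. (f s)\<^sup>2) + c' * (1 / \<eta> + 1) * (Sup k - Inf k))"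
    proof (rule sum_mono)
      fix k assume "k \<in> d"
      then obtain a b where k: "k = {a..b}" "a \<le> b" "{a..b} \<subseteq> t" "Sup k = b" "Inf k = a"
        using division_of_interval_real * by metis
      have "{a..b} \<subseteq> {0..T}" using k(3) * by blast
      then have ab: "0 \<le> a" "b \<le> T" using k(2) by auto
      have i2: "(\<lambda>s. (f s)\<^sup>2) integrable_on {a..b}" using L2_square_integrable[OF f ab] .
      have i1: "(\<lambda>s. \<bar>f s\<bar>) integrable_on {a..b}"
        using L2_scaleR_continuous_integrable[OF L2_abs[OF f], of "\<lambda>_. 1::real" a b] ab by simp
      have "integral {a..b} (\<lambda>s. \<bar>f s\<bar>) \<le> integral {a..b} (\<lambda>s. \<eta> * (f s)\<^sup>2 + 1 / \<eta>)"
      proof (rule integral_le[OF i1])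
        show "(\<lambda>s. \<eta> * (f s)\<^sup>2 + 1 / \<eta>) integrable_on {a..b}"
          by (intro integrable_add integrable_on_mult_right i2) auto
        fix s
        have "0 \<le> (\<eta> * \<bar>f s\<bar> - 1)\<^sup>2" by simp
        then have "2 * \<eta> * \<bar>f s\<bar> \<le> \<eta>\<^sup>2 * (f s)\<^sup>2 + 1"
          by (simp add: power2_eq_square algebra_simps)
        moreover have "0 \<le> \<eta> * \<bar>f s\<bar>" using \<eta> by simp
        moreover have "\<eta> * (\<eta> * (f s)\<^sup>2 + 1 / \<eta>) = \<eta>\<^sup>2 * (f s)\<^sup>2 + 1"
          using \<eta> by (simp add: power2_eq_square distrib_left)
        ultimately have "\<eta> * \<bar>f s\<bar> \<le> \<eta> * (\<eta> * (f s)\<^sup>2 + 1 / \<eta>)"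
          by linarith
        then show "\<bar>f s\<bar> \<le> \<eta> * (f s)\<^sup>2 + 1 / \<eta>"
          using \<eta> by (simp only: mult_le_cancel_left_pos)
      qed
      also have "\<dots> = \<eta> * integral {a..b} (\<lambda>s. (f s)\<^sup>2) + (b - a) / \<eta>"
        using k(2) by (subst integral_add) (auto intro!: integrable_on_mult_right i2)
      finally have I: "integral {a..b} (\<lambda>s. \<bar>f s\<bar>) \<le> \<dots>" .
      have I0: "0 \<le> integral {a..b} (\<lambda>s. \<bar>f s\<bar>)" by (intro integral_nonneg i1) auto
      have "norm (x b - x a) \<le> c * (integral {a..b} (\<lambda>s. \<bar>f s\<bar>) + (b - a))"
        using le[OF ab(1) k(2) ab(2)] by (simp add: algebra_simps)
      also have "\<dots> \<le> c' * (integral {a..b} (\<lambda>s. \<bar>f s\<bar>) + (b - a))"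
        using I0 k(2) by (intro mult_right_mono) (auto simp: c'_def)
      also have "\<dots> \<le> c' * ((\<eta> * integral {a..b} (\<lambda>s. (f s)\<^sup>2) + (b - a) / \<eta>) + (b - a))"
        using I c' by (intro mult_left_mono) auto
      finally show "norm (x (Sup k) - x (Inf k)) \<le>
          c' * \<eta> * integral k (\<lambda>s. (f s)\<^sup>2) + c' * (1 / \<eta> + 1) * (Sup k - Inf k)"
        unfolding k(4,5) unfolding k(1) by (simp add: algebra_simps)
    qed
    also have "\<dots> = c' * \<eta> * (\<Sum>k\<in>d. integral k (\<lambda>s. (f s)\<^sup>2)) + c' * (1 / \<eta> + 1) * (\<Sum>k\<in>d. Sup k - Inf k)"
      by (simp add: sum.distrib sum_distrib_left)
    also have "(\<Sum>k\<in>d. integral k (\<lambda>s. (f s)\<^sup>2)) \<le> F"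
    proof -
      have it: "(\<lambda>s. (f s)\<^sup>2) integrable_on t"
        by (rule integrable_on_subdivision[of d _ _ "{0..T}"]) (use * L2_square_integrable[OF f, of 0 T] in auto)
      then have "(\<Sum>k\<in>d. integral k (\<lambda>s. (f s)\<^sup>2)) = integral t (\<lambda>s. (f s)\<^sup>2)"
        using * by (intro integral_combine_division_topdown[symmetric]) auto
      also have "\<dots> \<le> F"
        unfolding F_def using * L2_square_integrable[OF f, of 0 T] it by (intro integral_subset_le) auto
      finally show ?thesis .
    qed
    then have "c' * \<eta> * (\<Sum>k\<in>d. integral k (\<lambda>s. (f s)\<^sup>2)) \<le> c' * \<eta> * F"
      using c' \<eta> by (intro mult_left_mono) auto
    also have "c' * \<eta> * F \<le> \<epsilon> / 2"
    proof -
      have "c' * \<eta> * F \<le> c' * \<eta> * (F + 1)" using c' \<eta> by (intro mult_left_mono) auto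
      also have "\<dots> = \<epsilon> / 2" unfolding \<eta>_def by (rule cancel(1)) (use c' F in auto)
      finally show ?thesis .
    qed
    also have "c' * (1 / \<eta> + 1) * (\<Sum>k\<in>d. Sup k - Inf k) < c' * (1 / \<eta> + 1) * \<delta>"
      using * c' \<eta>1 by (intro mult_strict_left_mono) auto
    also have "c' * (1 / \<eta> + 1) * \<delta> = \<epsilon> / 2"
      unfolding \<delta>_def using c' \<eta>1 by (rule cancel(2))
    finally show "(\<Sum>k\<in>d. norm (x (Sup k) - x (Inf k))) < \<epsilon>" by simp
  qed
qed

lemma integral_L2_diff_le:
  fixes z :: "real \<Rightarrow> 'a::euclidean_space"
  assumes f: "f \<in> L2 T" and z: "continuous_on {0..T} z" and K: "\<And>s. s \<in> {0..T} \<Longrightarrow> norm (z s) \<le> K"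
    and uv: "0 \<le> u" "u \<le> v" "v \<le> T"
  shows "norm (integral {0..v} (\<lambda>s. f s *\<^sub>R z s) - integral {0..u} (\<lambda>s. f s *\<^sub>R z s)) \<le> K * integral {u..v} (\<lambda>s. \<bar>f s\<bar>)"
proof -
  note int = L2_scaleR_continuous_integrable[OF f z]
  have "integral {0..u} (\<lambda>s. f s *\<^sub>R z s) + integral {u..v} (\<lambda>s. f s *\<^sub>R z s) = integral {0..v} (\<lambda>s. f s *\<^sub>R z s)"
    using uv by (intro Henstock_Kurzweil_Integration.integral_combine int) auto
  then have "integral {0..v} (\<lambda>s. f s *\<^sub>R z s) - integral {0..u} (\<lambda>s. f s *\<^sub>R z s) = integral {u..v} (\<lambda>s. f s *\<^sub>R z s)"
    by (simp add: algebra_simps)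
  also have "norm \<dots> \<le> integral {u..v} (\<lambda>s. K * \<bar>f s\<bar>)"
  proof (rule Henstock_Kurzweil_Integration.integral_norm_bound_integral)
    show "(\<lambda>s. K * \<bar>f s\<bar>) integrable_on {u..v}"
      using L2_scaleR_continuous_integrable[OF L2_abs[OF f], of "\<lambda>_. 1::real" u v] uv
      by (intro integrable_on_mult_right) auto
    show "norm (f s *\<^sub>R z s) \<le> K * \<bar>f s\<bar>" if "s \<in> {u..v}" for s
      using mult_left_mono[OF K[of s], of "\<bar>f s\<bar>"] that uv by (simp add: mult.commute)
  qed (use uv int in auto)
  finally show ?thesis by simp
qed

section \<open>Entrywise derivatives and matrix norms\<close>

lemma has_vector_derivative_vecI:
  fixes F :: "real \<Rightarrow> 'b::euclidean_space^'n"
  assumes "\<And>i. ((\<lambda>t. F t $ i) has_vector_derivative F' $ i) (at t within S)"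
  shows "(F has_vector_derivative F') (at t within S)"
  unfolding has_vector_derivative_def
proof (subst has_derivative_componentwise_within, intro ballI)
  fix b :: "'b^'n" assume "b \<in> Basis"
  then obtain i u where b: "b = axis i u" "u \<in> Basis" by (auto simp: Basis_vec_def)
  have "((\<lambda>t. F t $ i \<bullet> u) has_derivative (\<lambda>s. (s *\<^sub>R F' $ i) \<bullet> u)) (at t within S)"
    using assms[of i] unfolding has_vector_derivative_def by (intro has_derivative_inner_left) auto
  then show "((\<lambda>t. F t \<bullet> b) has_derivative (\<lambda>s. s *\<^sub>R F' \<bullet> b)) (at t within S)"
    by (simp add: b inner_axis)
qed

lemma norm_matrix_le:
  fixes X :: "'b::real_normed_vector^'n^'m"
  shows "norm X \<le> (\<Sum>i\<in>UNIV. \<Sum>j\<in>UNIV. norm (X $ i $ j))"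
proof -
  have "norm X \<le> (\<Sum>i\<in>UNIV. norm (X $ i))"
    unfolding norm_vec_def[of X] by (rule L2_set_le_sum) auto
  also have "\<dots> \<le> (\<Sum>i\<in>UNIV. \<Sum>j\<in>UNIV. norm (X $ i $ j))"
  proof (rule sum_mono)
    fix i
    show "norm (X $ i) \<le> (\<Sum>j\<in>UNIV. norm (X $ i $ j))"
      unfolding norm_vec_def[of "X $ i"] by (rule L2_set_le_sum) auto
  qed
  finally show ?thesis .
qed

lemma norm_entry_le: "norm (X $ i $ j) \<le> norm (X :: 'b::real_normed_vector^'n^'m)"
  using order_trans[OF Finite_Cartesian_Product.norm_nth_le Finite_Cartesian_Product.norm_nth_le] .

lemma norm_matrix_mult_le:
  fixes A :: "complex^'n^'m" and X :: "complex^'k^'n"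
  shows "norm (A ** X) \<le> (real CARD('k) * (\<Sum>i\<in>UNIV. \<Sum>l\<in>UNIV. norm (A $ i $ l))) * norm X"
proof -
  have "norm (A ** X) \<le> (\<Sum>i\<in>UNIV. \<Sum>j\<in>(UNIV::'k set). norm ((A ** X) $ i $ j))"
    by (rule norm_matrix_le)
  also have "\<dots> \<le> (\<Sum>i\<in>UNIV. \<Sum>j\<in>(UNIV::'k set). \<Sum>l\<in>UNIV. norm (A $ i $ l) * norm X)"
  proof (intro sum_mono)
    fix i j
    have "norm ((A ** X) $ i $ j) \<le> (\<Sum>l\<in>UNIV. norm (A $ i $ l * X $ l $ j))"
      by (simp add: matrix_matrix_mult_def norm_sum)
    also have "\<dots> \<le> (\<Sum>l\<in>UNIV. norm (A $ i $ l) * norm X)"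
      by (intro sum_mono) (simp add: norm_mult mult_left_mono norm_entry_le)
    finally show "norm ((A ** X) $ i $ j) \<le> (\<Sum>l\<in>UNIV. norm (A $ i $ l) * norm X)" .
  qed
  also have "\<dots> = (real CARD('k) * (\<Sum>i\<in>UNIV. \<Sum>l\<in>UNIV. norm (A $ i $ l))) * norm X"
    by (simp add: sum_distrib_left sum_distrib_right mult.assoc)
  finally show ?thesis .
qed

lemma norm_cis_diff_le: "norm (cis a - cis b) \<le> \<bar>a - b\<bar>"
proof -
  have "cis a - cis b = cis b * (exp (\<i> * of_real (a - b)) - 1)"
    by (simp add: cis_conv_exp algebra_simps flip: exp_add)
  then have "norm (cis a - cis b) = 2 * \<bar>sin ((a - b) / 2)\<bar>"
    by (simp only: norm_mult norm_cis dist_exp_i_1)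
  also have "\<dots> \<le> \<bar>a - b\<bar>"
    using abs_sin_x_le_abs_x[of "(a - b) / 2"] by simp
  finally show ?thesis .
qed

lemma coupling_nth [simp]:
  "coupling a b $ 1 $ 1 = 0" "coupling a b $ 1 $ 2 = a" "coupling a b $ 1 $ 3 = 0"
  "coupling a b $ 2 $ 1 = cnj a" "coupling a b $ 2 $ 2 = 0" "coupling a b $ 2 $ 3 = b"
  "coupling a b $ 3 $ 1 = 0" "coupling a b $ 3 $ 2 = cnj b" "coupling a b $ 3 $ 3 = 0"
  by (simp_all add: coupling_def)

lemma diag3_nth [simp]:
  "diag3 a b c $ 1 $ 1 = of_real a" "diag3 a b c $ 1 $ 2 = 0" "diag3 a b c $ 1 $ 3 = 0"
  "diag3 a b c $ 2 $ 1 = 0" "diag3 a b c $ 2 $ 2 = of_real b" "diag3 a b c $ 2 $ 3 = 0"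
  "diag3 a b c $ 3 $ 1 = 0" "diag3 a b c $ 3 $ 2 = 0" "diag3 a b c $ 3 $ 3 = of_real c"
  by (simp_all add: diag3_def)

section \<open>The interaction picture generator of the three-level system\<close>

locale three_level =
  fixes h1 h2 h3 :: real and v12 v23 :: complex
begin

abbreviation "H0 \<equiv> diag3 h1 h2 h3"
abbreviation "V \<equiv> coupling v12 v23"

definition level :: "3 \<Rightarrow> real" where
  "level i = (if i = 1 then h1 else if i = 2 then h2 else h3)"

lemma level_simps [simp]: "level 1 = h1" "level 2 = h2" "level 3 = h3"
  by (simp_all add: level_def)

text \<open>The generator in the interaction picture, \<open>-i e\<^bsup>itH\<^sub>0\<^esup> V e\<^bsup>-itH\<^sub>0\<^esup>\<close>.\<close>

definition W :: "real \<Rightarrow> complex^3^3" where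
  "W t = (\<chi> i k. - \<i> * V $ i $ k * cis ((level i - level k) * t))"

definition B :: "real \<Rightarrow> complex^3^3 \<Rightarrow> complex^3^3" where
  "B t X = W t ** X"

text \<open>The constant of \<open>norm_matrix_mult_le\<close> for \<open>W t\<close>; the phases
  have modulus 1, so it does not depend on \<open>t\<close>.\<close>

definition M :: real where
  "M = real CARD(3) * (\<Sum>i\<in>(UNIV::3 set). \<Sum>k\<in>(UNIV::3 set). norm (V $ i $ k))"

lemma volterra_B:
  assumes "0 < T"
  shows "volterra T M B"
proof (rule volterra.intro[OF assms])
  show "0 \<le> M" unfolding M_def by (intro mult_nonneg_nonneg sum_nonneg) auto
  fix s x
  show "linear (B s)"
    by (rule linearI) (simp_all add: B_def matrix_matrix_mult_def vec_eq_iff sum.distrib algebra_simps scaleR_sum_right)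
  have "norm (W s $ i $ k) = norm (V $ i $ k)" for i k
    by (simp add: W_def norm_mult)
  then show "norm (B s x) \<le> M * norm x"
    using norm_matrix_mult_le[of "W s" x] unfolding B_def M_def by simp
next
  fix y :: "real \<Rightarrow> complex^3^3" assume y: "continuous_on {0..T} y"
  show "continuous_on {0..T} (\<lambda>s. B s (y s))"
    unfolding B_def W_def matrix_matrix_mult_def by (intro continuous_intros y)
qed

text \<open>The matrix \<open>H0 + f t V\<close> is Hermitian, so the real inner product of
  \<open>y\<close> with its derivative vanishes. The initial vector is arbitrary: a unit vector
  gives normalisation of the populations, the zero vector gives uniqueness.\<close>

lemma hermitian_flow_norm_const:
  fixes y :: "real \<Rightarrow> complex^3"
  assumes ac: "absolutely_continuous_fun_on {0..T} y" and N: "negligible N"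
    and der: "\<And>t. t \<in> {0..T} - N \<Longrightarrow> \<exists>y'. (y has_vector_derivative y') (at t within {0..T}) \<and>
      (\<forall>i. \<i> * y' $ i = (\<Sum>k\<in>UNIV. (H0 + f t *\<^sub>R V) $ i $ k * y t $ k))"
    and t: "t \<in> {0..T}"
  shows "norm (y t) = norm (y 0)"
proof -
  have "continuous_on {0..T} y" using ac by (rule absolutely_continuous_fun_on_imp_continuous_on)
  then obtain K where K: "K > 0" "\<And>s. s \<in> {0..T} \<Longrightarrow> norm (y s) \<le> K"
    using continuous_on_interval_norm_bound by blast
  have "absolutely_continuous_fun_on {0..T} (\<lambda>t. y t \<bullet> y t)"
  proof (rule absolutely_continuous_fun_on_dominated[OF ac])
    fix u v assume uv: "u \<in> {0..T}" "v \<in> {0..T}"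
    have "y v \<bullet> y v - y u \<bullet> y u = (y v + y u) \<bullet> (y v - y u)"
      by (simp add: inner_add_left inner_diff_right inner_commute[of "y u" "y v"])
    also have "norm \<dots> \<le> norm (y v + y u) * norm (y v - y u)"
      using Cauchy_Schwarz_ineq2 by auto
    also have "\<dots> \<le> (2 * K) * norm (y v - y u)"
      using norm_triangle_ineq[of "y v" "y u"] K(2)[OF uv(1)] K(2)[OF uv(2)] by (intro mult_right_mono) auto
    finally show "norm (y v \<bullet> y v - y u \<bullet> y u) \<le> (2 * K) * norm (y v - y u)" .
  qed
  then have "y t \<bullet> y t = y 0 \<bullet> y 0"
  proof (rule absolutely_continuous_zero_derivative_imp_const[OF _ N _ t])
    fix s assume "s \<in> {0..T} - N"
    then obtain y' where y': "(y has_vector_derivative y') (at s within {0..T})"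
      "\<And>i. \<i> * y' $ i = (\<Sum>k\<in>UNIV. (H0 + f s *\<^sub>R V) $ i $ k * y s $ k)"
      using der by blast
    have "y' $ i = - \<i> * (\<Sum>k\<in>UNIV. (H0 + f s *\<^sub>R V) $ i $ k * y s $ k)" for i
      unfolding y'(2)[symmetric] by simp
    then have "y s \<bullet> y' = 0"
      by (simp add: inner_vec_def sum_3 inner_complex_def) (simp add: algebra_simps)
    moreover have "((\<lambda>t. y t \<bullet> y t) has_vector_derivative (y s \<bullet> y' + y' \<bullet> y s)) (at s within {0..T})"
      by (rule bounded_bilinear.has_vector_derivative[OF bounded_bilinear_inner y'(1) y'(1)])
    ultimately show "((\<lambda>t. y t \<bullet> y t) has_vector_derivative 0) (at s within {0..T})"
      by (simp add: inner_commute)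
  qed
  then show ?thesis by (simp add: norm_eq_sqrt_inner)
qed

end

section \<open>The Schroedinger equation and the interaction picture\<close>

lemma AE_lebesgue_on_iff_negligible:
  assumes "S \<in> sets lebesgue"
  shows "(AE t in lebesgue_on S. P t) \<longleftrightarrow> (\<exists>N. negligible N \<and> (\<forall>t\<in>S - N. P t))"
proof -
  have "(AE t in lebesgue_on S. P t) \<longleftrightarrow> (AE t in lebesgue. t \<in> S \<longrightarrow> P t)"
    using assms by (intro AE_restrict_space_iff) auto
  also have "\<dots> \<longleftrightarrow> (\<exists>N\<in>null_sets lebesgue. {t. \<not> (t \<in> S \<longrightarrow> P t)} \<subseteq> N)"
    by (simp add: eventually_ae_filter)
  also have "\<dots> \<longleftrightarrow> (\<exists>N. negligible N \<and> (\<forall>t\<in>S - N. P t))"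
    unfolding negligible_iff_null_sets by blast
  finally show ?thesis .
qed

lemma mat_matrix_mult_nth: "(mat c ** X) $ i $ j = c * X $ i $ j" for X :: "complex^'k^'n"
  by (simp add: matrix_matrix_mult_def mat_def if_distrib[of "\<lambda>x. x * _"] cong: if_cong)

lemma norm_column_le: "norm (column j X) \<le> norm X" for X :: "complex^'k^'n"
  unfolding norm_vec_def[of X] norm_vec_def[of "column j X"]
  by (rule L2_set_mono) (auto simp: column_def Finite_Cartesian_Product.norm_nth_le)

lemma bounded_linear_column: "bounded_linear (column j :: complex^'k^'n \<Rightarrow> complex^'n)"
  by (rule bounded_linear_intro[of _ 1]) (auto simp: column_def vec_eq_iff norm_column_le[unfolded column_def])

lemma bounded_linear_entry: "bounded_linear (\<lambda>X :: 'b::real_normed_vector^'k^'n. X $ i $ j)"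
  using bounded_linear_compose[OF bounded_linear_vec_nth bounded_linear_vec_nth] .

lemma has_vector_derivative_cis:
  "((\<lambda>t. cis (c * t)) has_vector_derivative \<i> * of_real c * cis (c * t)) (at t within S)"
proof -
  have eq: "cis (c * s) = exp (s *\<^sub>R (\<i> * of_real c))" for s
    by (simp add: cis_conv_exp scaleR_conv_of_real mult_ac)
  show ?thesis
    unfolding eq using exp_scaleR_has_vector_derivative_right[of "\<i> * of_real c" t S]
    by (simp add: mult_ac)
qed

lemma matrix_diff_ldistrib: "A ** (X - Y) = A ** X - A ** Y" for A :: "'a::ring_1^'n^'m"
  by (simp add: matrix_matrix_mult_def vec_eq_iff right_diff_distrib sum_subtractf)

context three_level
begin

lemma diag_level: "H0 $ i $ k = (if i = k then of_real (level i) else 0)"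
  using exhaust_3[of i] exhaust_3[of k] by auto

text \<open>This is \<open>U = exp (- i t H0) C\<close>, entrywise because \<open>H0\<close> is
  diagonal: row \<open>i\<close> receives a phase. Increments of \<open>U\<close> come from
  \<open>C\<close>, through the integral of \<open>\<bar>f\<bar>\<close>, and from the phases,
  through the length of the interval; both kinds fit
  \<open>absolutely_continuous_fun_onI_L2\<close>.\<close>

lemma schroedinger_of_volterra:
  assumes T: "0 < T" and f: "f \<in> L2 T" and C: "volterra.solves T B f (\<lambda>_. mat 1) C"
  shows "schroedinger_solution H0 V T f (\<lambda>t. \<chi> i j. cis (- level i * t) * C t $ i $ j)"
proof -
  interpret volterra T M B using T by (rule volterra_B)
  let ?U = "\<lambda>t. \<chi> i j. cis (- level i * t) * C t $ i $ j"
  have Cc: "continuous_on {0..T} C" and Ceq: "\<And>t. t \<in> {0..T} \<Longrightarrow> C t = mat 1 + volt f C t"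
    using C by (auto simp: solves_def)
  obtain K where K: "K > 0" "\<And>s. s \<in> {0..T} \<Longrightarrow> norm (C s) \<le> K"
    using continuous_on_interval_norm_bound[OF Cc] by blast
  define L where "L = \<bar>h1\<bar> + \<bar>h2\<bar> + \<bar>h3\<bar>"
  have L: "\<bar>level i\<bar> \<le> L" "L \<ge> 0" for i by (auto simp: L_def level_def)
  define g where "g s = f s *\<^sub>R B s (C s)" for s
  have g: "g absolutely_integrable_on {0..T}"
    unfolding g_def[abs_def] by (intro L2_scaleR_continuous f continuous_B Cc)
  have Cdiff: "norm (C v - C u) \<le> M * K * integral {u..v} (\<lambda>s. \<bar>f s\<bar>)" if "0 \<le> u" "u \<le> v" "v \<le> T" for u v
  proof -
    have "norm (B s (C s)) \<le> M * K" if "s \<in> {0..T}" for s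
      using norm_B[of s "C s"] K(2)[OF that] M_nonneg by (auto intro: order_trans mult_left_mono)
    from integral_L2_diff_le[OF f continuous_B[OF Cc] this \<open>0 \<le> u\<close> \<open>u \<le> v\<close> \<open>v \<le> T\<close>] show ?thesis
      using that Ceq[of u] Ceq[of v] by (simp add: volt_def)
  qed
  \<comment> \<open>Majorises the coefficients of both kinds of increment at once; the later factor
    9 counts matrix entries.\<close>
  define c where "c = M * K + L * K"
  have ac: "absolutely_continuous_fun_on {0..T} ?U"
  proof (rule absolutely_continuous_fun_onI_L2[OF f, of _ "9 * c"])
    fix u v :: real assume uv: "0 \<le> u" "u \<le> v" "v \<le> T"
    define D where "D = M * K * integral {u..v} (\<lambda>s. \<bar>f s\<bar>) + L * K * (v - u)"
    have entry: "norm (cis (- level i * v) * C v $ i $ j - cis (- level i * u) * C u $ i $ j) \<le> D" for i j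
    proof -
      have "cis (- level i * v) * C v $ i $ j - cis (- level i * u) * C u $ i $ j =
          cis (- level i * v) * (C v - C u) $ i $ j + (cis (- level i * v) - cis (- level i * u)) * C u $ i $ j"
        by (simp add: algebra_simps)
      also have "norm \<dots> \<le> norm ((C v - C u) $ i $ j) + norm (cis (- level i * v) - cis (- level i * u)) * norm (C u $ i $ j)"
        by (rule order_trans[OF norm_triangle_ineq]) (simp add: norm_mult)
      also have "norm ((C v - C u) $ i $ j) \<le> M * K * integral {u..v} (\<lambda>s. \<bar>f s\<bar>)"
        using norm_entry_le Cdiff[OF uv] by (rule order_trans)
      also have "norm (cis (- level i * v) - cis (- level i * u)) * norm (C u $ i $ j) \<le> (L * (v - u)) * K"
      proof (rule mult_mono)
        have "norm (cis (- level i * v) - cis (- level i * u)) \<le> \<bar>level i * (u - v)\<bar>"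
          using norm_cis_diff_le[of "- level i * v" "- level i * u"] by (simp add: algebra_simps)
        also have "\<dots> \<le> L * (v - u)"
          using uv L(1)[of i] by (simp add: abs_mult mult_right_mono)
        finally show "norm (cis (- level i * v) - cis (- level i * u)) \<le> L * (v - u)" .
        show "norm (C u $ i $ j) \<le> K"
          using norm_entry_le[of "C u" i j] K(2)[of u] uv by auto
      qed (use uv L in auto)
      finally show ?thesis by (simp add: D_def mult_ac)
    qed
    have "norm (?U v - ?U u) \<le> (\<Sum>i\<in>UNIV. \<Sum>j\<in>UNIV. norm ((?U v - ?U u) $ i $ j))"
      by (rule norm_matrix_le)
    also have "\<dots> \<le> (\<Sum>i\<in>(UNIV::3 set). \<Sum>j\<in>(UNIV::3 set). D)"
      by (intro sum_mono) (use entry in auto)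
    also have "\<dots> = 9 * D" by simp
    also have "9 * D \<le> 9 * (c * integral {u..v} (\<lambda>s. \<bar>f s\<bar>) + c * (v - u))"
    proof -
      have "0 \<le> integral {u..v} (\<lambda>s. \<bar>f s\<bar>)"
        using L2_scaleR_continuous_integrable[OF L2_abs[OF f], of "\<lambda>_. 1::real" u v] uv
        by (intro Henstock_Kurzweil_Integration.integral_nonneg) auto
      then have "0 \<le> L * K * integral {u..v} (\<lambda>s. \<bar>f s\<bar>)" "0 \<le> M * K * (v - u)"
        using L(2) K(1) M_nonneg uv by auto
      then show ?thesis by (simp add: D_def c_def algebra_simps)
    qed
    finally show "norm (?U v - ?U u) \<le> 9 * c * integral {u..v} (\<lambda>s. \<bar>f s\<bar>) + 9 * c * (v - u)"
      by (simp only: mult.assoc distrib_left)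
  qed
  have U0: "?U 0 = mat 1"
    using Ceq[of 0] T by (simp add: vec_eq_iff mat_def)
  obtain N where N: "negligible N"
    "\<And>t. t \<in> {0..T} - N \<Longrightarrow> ((\<lambda>t. integral {0..t} g) has_vector_derivative g t) (at t within {0..T})"
    using integral_has_vector_derivative_ae[OF g] by blast
  have "\<exists>U'. (?U has_vector_derivative U') (at t within {0..T}) \<and> mat \<i> ** U' = (H0 + f t *\<^sub>R V) ** ?U t"
    if t: "t \<in> {0..T} - N" for t
  proof (intro exI conjI)
    let ?U' = "\<chi> i j. cis (- level i * t) * g t $ i $ j + (\<i> * of_real (- level i) * cis (- level i * t)) * C t $ i $ j"
    have "((\<lambda>t. mat 1 + integral {0..t} g) has_vector_derivative 0 + g t) (at t within {0..T})"
      by (intro has_vector_derivative_add has_vector_derivative_const N(2)[OF t])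
    then have "(C has_vector_derivative 0 + g t) (at t within {0..T})"
      by (rule has_vector_derivative_transform[rotated 2]) (use t Ceq in \<open>auto simp: volt_def g_def[abs_def]\<close>)
    then have C': "(C has_vector_derivative g t) (at t within {0..T})" by simp
    show "(?U has_vector_derivative ?U') (at t within {0..T})"
    proof (intro has_vector_derivative_vecI)
      fix i j
      have "((\<lambda>t. cis (- level i * t) * C t $ i $ j) has_vector_derivative
          (cis (- level i * t) * g t $ i $ j + (\<i> * of_real (- level i) * cis (- level i * t)) * C t $ i $ j)) (at t within {0..T})"
        by (intro has_vector_derivative_mult has_vector_derivative_cis
            bounded_linear.has_vector_derivative[OF bounded_linear_entry C'])
      then show "((\<lambda>t. ?U t $ i $ j) has_vector_derivative ?U' $ i $ j) (at t within {0..T})" by simp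
    qed
    show "mat \<i> ** ?U' = (H0 + f t *\<^sub>R V) ** ?U t"
      unfolding vec_eq_iff
    proof (intro allI)
      fix i j
      \<comment> \<open>The phase of row \<open>i\<close> cancels against the row phase in
        \<open>W\<close>, leaving the phase of row \<open>k\<close> of \<open>U\<close>: the
        conjugation that defines the interaction picture is undone.\<close>
      have ph: "cis (- level i * t) * cis ((level i - level k) * t) = cis (- level k * t)" for k
        by (simp add: cis_mult algebra_simps)
      have "\<i> * (cis (- level i * t) * g t $ i $ j) =
          (\<Sum>k\<in>UNIV. of_real (f t) * V $ i $ k * (cis (- level i * t) * cis ((level i - level k) * t)) * C t $ k $ j)"
        by (simp add: g_def B_def W_def matrix_matrix_mult_def)
          (simp add: scaleR_conv_of_real sum_distrib_left mult_ac)
      then have 1: "\<i> * (cis (- level i * t) * g t $ i $ j) = (\<Sum>k\<in>UNIV. of_real (f t) * V $ i $ k * cis (- level k * t) * C t $ k $ j)"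
        unfolding ph .
      have 2: "(\<Sum>k\<in>UNIV. H0 $ i $ k * (cis (- level k * t) * C t $ k $ j)) = of_real (level i) * (cis (- level i * t) * C t $ i $ j)"
        by (simp add: diag_level if_distrib[of "\<lambda>x. x * _"] cong: if_cong)
      have "((H0 + f t *\<^sub>R V) ** ?U t) $ i $ j = (\<Sum>k\<in>UNIV. H0 $ i $ k * (cis (- level k * t) * C t $ k $ j))
          + (\<Sum>k\<in>UNIV. of_real (f t) * V $ i $ k * cis (- level k * t) * C t $ k $ j)"
        unfolding sum.distrib[symmetric]
        by (simp add: matrix_matrix_mult_def) (simp add: scaleR_conv_of_real algebra_simps)
      also have "\<dots> = \<i> * (cis (- level i * t) * g t $ i $ j) + of_real (level i) * (cis (- level i * t) * C t $ i $ j)"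
        unfolding 1 2 by simp
      also have "\<dots> = (mat \<i> ** ?U') $ i $ j"
        by (simp add: mat_matrix_mult_nth algebra_simps)
      finally show "(mat \<i> ** ?U') $ i $ j = ((H0 + f t *\<^sub>R V) ** ?U t) $ i $ j" ..
    qed
  qed
  then show ?thesis
    using ac U0 N(1) unfolding schroedinger_solution_def
    by (subst AE_lebesgue_on_iff_negligible) auto
qed

lemma schroedinger_column_norm:
  fixes Z :: "real \<Rightarrow> complex^3^3"
  assumes ac: "absolutely_continuous_fun_on {0..T} Z"
    and ae: "AE t in lebesgue_on {0..T}. \<exists>Z'. (Z has_vector_derivative Z') (at t within {0..T}) \<and>
      mat \<i> ** Z' = (H0 + f t *\<^sub>R V) ** Z t"
    and t: "t \<in> {0..T}"
  shows "norm (column j (Z t)) = norm (column j (Z 0))"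
proof -
  obtain N where N: "negligible N" "\<And>t. t \<in> {0..T} - N \<Longrightarrow> \<exists>Z'. (Z has_vector_derivative Z') (at t within {0..T}) \<and>
      mat \<i> ** Z' = (H0 + f t *\<^sub>R V) ** Z t"
    using ae by (subst (asm) AE_lebesgue_on_iff_negligible) auto
  show ?thesis
  proof (rule hermitian_flow_norm_const[OF _ N(1) _ t])
    show "absolutely_continuous_fun_on {0..T} (\<lambda>t. column j (Z t))"
    proof (rule absolutely_continuous_fun_on_dominated[OF ac, of _ 1])
      show "norm (column j (Z v) - column j (Z u)) \<le> 1 * norm (Z v - Z u)" for u v
        using norm_column_le[of j "Z v - Z u"] by (simp add: linear_diff[OF bounded_linear.linear[OF bounded_linear_column]])
    qed
    fix s assume "s \<in> {0..T} - N"
    then obtain Z' where Z': "(Z has_vector_derivative Z') (at s within {0..T})" "mat \<i> ** Z' = (H0 + f s *\<^sub>R V) ** Z s"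
      using N(2) by blast
    have "\<i> * column j Z' $ i = (\<Sum>k\<in>UNIV. (H0 + f s *\<^sub>R V) $ i $ k * column j (Z s) $ k)" for i
    proof -
      have "\<i> * column j Z' $ i = (mat \<i> ** Z') $ i $ j"
        by (simp add: mat_matrix_mult_nth column_def)
      then show ?thesis unfolding Z'(2) by (simp add: matrix_matrix_mult_def column_def)
    qed
    then show "\<exists>y'. ((\<lambda>t. column j (Z t)) has_vector_derivative y') (at s within {0..T}) \<and>
      (\<forall>i. \<i> * y' $ i = (\<Sum>k\<in>UNIV. (H0 + f s *\<^sub>R V) $ i $ k * column j (Z s) $ k))"
      using bounded_linear.has_vector_derivative[OF bounded_linear_column Z'(1)] by blast
  qed
qed

text \<open>The difference of two solutions solves the same linear equation with initial value 0,
  and \<open>schroedinger_column_norm\<close> keeps each of its columns at norm 0.\<close>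

lemma schroedinger_unique:
  assumes U: "schroedinger_solution H0 V T f U" and U2: "schroedinger_solution H0 V T f U2" and t: "t \<in> {0..T}"
  shows "U t = U2 t"
proof -
  let ?Z = "\<lambda>t. U t - U2 t"
  have "column j (U t - U2 t) = 0" for j
  proof -
    have "norm (column j (?Z t)) = norm (column j (?Z 0))"
    proof (rule schroedinger_column_norm[OF _ _ t])
      show "absolutely_continuous_fun_on {0..T} ?Z"
        using U U2 by (intro absolutely_continuous_fun_on_diff) (auto simp: schroedinger_solution_def)
      have "AE t in lebesgue_on {0..T}. \<exists>U'. (U has_vector_derivative U') (at t within {0..T}) \<and> mat \<i> ** U' = (H0 + f t *\<^sub>R V) ** U t"
        "AE t in lebesgue_on {0..T}. \<exists>U'. (U2 has_vector_derivative U') (at t within {0..T}) \<and> mat \<i> ** U' = (H0 + f t *\<^sub>R V) ** U2 t"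
        using U U2 by (auto simp: schroedinger_solution_def)
      then show "AE t in lebesgue_on {0..T}. \<exists>Z'. (?Z has_vector_derivative Z') (at t within {0..T}) \<and> mat \<i> ** Z' = (H0 + f t *\<^sub>R V) ** ?Z t"
      proof eventually_elim
        case (elim t)
        then obtain X Y where "(U has_vector_derivative X) (at t within {0..T})" "mat \<i> ** X = (H0 + f t *\<^sub>R V) ** U t"
          "(U2 has_vector_derivative Y) (at t within {0..T})" "mat \<i> ** Y = (H0 + f t *\<^sub>R V) ** U2 t" by blast
        then show ?case
          by (intro exI[of _ "X - Y"]) (simp add: has_vector_derivative_diff matrix_diff_ldistrib)
      qed
    qed
    also have "?Z 0 = 0" using U U2 by (simp add: schroedinger_solution_def)
    also have "column j (0 :: complex^3^3) = 0" by (simp add: column_def vec_eq_iff)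
    finally show ?thesis by simp
  qed
  then have "U t $ i $ j - U2 t $ i $ j = 0" for i j
    by (simp add: column_def vec_eq_iff)
  then show ?thesis by (simp add: vec_eq_iff)
qed

text \<open>Values outside \<open>{0..T}\<close> do not affect derivatives within
  \<open>{0..T}\<close>. This admits the restriction of a solution, the extensional representative
  that \<open>propagator\<close> describes.\<close>

lemma schroedinger_cong:
  assumes T: "0 < T" and U: "schroedinger_solution H0 V T f U" and eq: "\<And>t. t \<in> {0..T} \<Longrightarrow> U t = U2 t"
  shows "schroedinger_solution H0 V T f U2"
  unfolding schroedinger_solution_def
proof (intro conjI)
  show "absolutely_continuous_fun_on {0..T} U2"
    by (rule absolutely_continuous_fun_on_dominated[of _ U _ 1]) (use U eq in \<open>auto simp: schroedinger_solution_def\<close>)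
  show "U2 0 = mat 1" using U eq[of 0] T by (simp add: schroedinger_solution_def)
  obtain N where N: "negligible N" "\<And>t. t \<in> {0..T} - N \<Longrightarrow> \<exists>U'. (U has_vector_derivative U') (at t within {0..T}) \<and>
      mat \<i> ** U' = (H0 + f t *\<^sub>R V) ** U t"
    using U unfolding schroedinger_solution_def by (subst (asm) AE_lebesgue_on_iff_negligible) auto
  have "\<exists>U'. (U2 has_vector_derivative U') (at t within {0..T}) \<and> mat \<i> ** U' = (H0 + f t *\<^sub>R V) ** U2 t"
    if t: "t \<in> {0..T} - N" for t
  proof -
    obtain U' where U': "(U has_vector_derivative U') (at t within {0..T})" "mat \<i> ** U' = (H0 + f t *\<^sub>R V) ** U t"
      using N(2)[OF t] by blast
    have "(U2 has_vector_derivative U') (at t within {0..T})"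
      by (rule has_vector_derivative_transform[OF _ _ U'(1)]) (use t eq in auto)
    then show ?thesis using U'(2) eq t by auto
  qed
  then show "AE t in lebesgue_on {0..T}. \<exists>U'. (U2 has_vector_derivative U') (at t within {0..T}) \<and> mat \<i> ** U' = (H0 + f t *\<^sub>R V) ** U2 t"
    using N(1) by (subst AE_lebesgue_on_iff_negligible) auto
qed

lemma propagator_eq:
  assumes T: "0 < T" and U: "schroedinger_solution H0 V T f U" and t: "t \<in> {0..T}"
  shows "propagator H0 V T f t = U t"
proof -
  let ?R = "restrict U {0..T}"
  have R: "schroedinger_solution H0 V T f ?R"
    using T U by (rule schroedinger_cong) simp
  have "propagator H0 V T f = ?R"
    unfolding propagator_def
  proof (rule the_equality)
    show "?R \<in> extensional {0..T} \<and> schroedinger_solution H0 V T f ?R" using R by simp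
    fix U2 assume U2: "U2 \<in> extensional {0..T} \<and> schroedinger_solution H0 V T f U2"
    show "U2 = ?R"
    proof (rule extensionalityI[of _ "{0..T}"])
      show "U2 x = ?R x" if "x \<in> {0..T}" for x
        using schroedinger_unique[of T f U2 ?R x] U2 R that by simp
    qed (use U2 in auto)
  qed
  then show ?thesis using t by simp
qed

lemma objective_eq:
  assumes T: "0 < T" and f: "f \<in> L2 T" and C: "volterra.solves T B f (\<lambda>_. mat 1) C"
  shows "objective H0 V (diag3 0 0 1) (diag3 l1 l2 l3) T f =
    l3 + ((l1 - l3) * (norm (C T $ 1 $ 3))\<^sup>2 - (l3 - l2) * (norm (C T $ 2 $ 3))\<^sup>2)"
proof -
  define U where "U t = (\<chi> i j. cis (- level i * t) * C t $ i $ j)" for t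
  have U: "schroedinger_solution H0 V T f U"
    using schroedinger_of_volterra[OF T f C] by (simp add: U_def[abs_def])
  have TT: "T \<in> {0..T}" using T by simp
  \<comment> \<open>The initial state projects onto level 3, so only the third column of
    \<open>U T\<close> enters, and conservation of its norm replaces full unitarity. The diagonal
    phases leave the moduli unchanged, so that \<open>C\<close> may stand for
    \<open>U\<close>.\<close>
  have "norm (column 3 (U T)) = norm (column 3 (U 0))"
    using U by (intro schroedinger_column_norm[OF _ _ TT]) (auto simp: schroedinger_solution_def)
  also have "U 0 = mat 1" using U by (simp add: schroedinger_solution_def)
  also have "norm (column 3 (mat 1 :: complex^3^3)) = 1"
    by (simp add: norm_vec_def L2_set_def sum_3 column_def mat_def)
  finally have "(norm (column 3 (U T)))\<^sup>2 = 1" by simp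
  then have unit: "(norm (U T $ 1 $ 3))\<^sup>2 + (norm (U T $ 2 $ 3))\<^sup>2 + (norm (U T $ 3 $ 3))\<^sup>2 = 1"
    by (simp add: norm_vec_def L2_set_def sum_3 column_def)
  have nU: "norm (U T $ i $ 3) = norm (C T $ i $ 3)" for i
    by (simp add: U_def norm_mult)
  have "objective H0 V (diag3 0 0 1) (diag3 l1 l2 l3) T f =
      l1 * (norm (U T $ 1 $ 3))\<^sup>2 + l2 * (norm (U T $ 2 $ 3))\<^sup>2 + l3 * (norm (U T $ 3 $ 3))\<^sup>2"
    unfolding objective_def Let_def propagator_eq[OF T U TT]
    by (simp add: trace_def matrix_matrix_mult_def sum_3 dagger_def complex_norm_square[symmetric] algebra_simps
        flip: complex_norm_square)
  also have "(norm (U T $ 3 $ 3))\<^sup>2 = 1 - (norm (U T $ 1 $ 3))\<^sup>2 - (norm (U T $ 2 $ 3))\<^sup>2"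
    using unit by simp
  finally show ?thesis unfolding nU by (simp add: algebra_simps)
qed

end

section \<open>Dyson terms and the strong pulse\<close>

text \<open>The antiderivative \<open>y\<close> is only absolutely continuous, so \<open>y y' = (y\<^sup>2)' / 2\<close> holds almost everywhere.\<close>

lemma integral_times_antiderivative:
  fixes w :: "real \<Rightarrow> complex"
  assumes f: "f \<in> L2 T" and w: "continuous_on {0..T} w" and T: "0 \<le> T"
  defines "y \<equiv> \<lambda>t. integral {0..t} (\<lambda>s. f s *\<^sub>R w s)"
  shows "integral {0..T} (\<lambda>s. f s *\<^sub>R (w s * y s)) = (y T)\<^sup>2 / 2"
proof -
  have yc: "continuous_on {0..T} y"
    unfolding y_def using f w by (intro indefinite_integral_continuous_1 L2_scaleR_continuous_integrable) auto
  have wyc: "continuous_on {0..T} (\<lambda>s. w s * y s)" by (intro continuous_intros w yc)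
  obtain Kw where Kw: "Kw > 0" "\<And>s. s \<in> {0..T} \<Longrightarrow> norm (w s) \<le> Kw"
    using continuous_on_interval_norm_bound[OF w] by blast
  obtain Ky where Ky: "Ky > 0" "\<And>s. s \<in> {0..T} \<Longrightarrow> norm (y s) \<le> Ky"
    using continuous_on_interval_norm_bound[OF yc] by blast
  define z where "z t = integral {0..t} (\<lambda>s. f s *\<^sub>R (w s * y s))" for t
  \<comment> \<open>The claim is that \<open>\<phi>\<close> vanishes at \<open>T\<close>. It starts
    at 0, and the product rule cancels its derivative wherever both indefinite integrals are
    differentiable.\<close>
  define \<phi> where "\<phi> t = (y t)\<^sup>2 - 2 * z t" for t
  have "absolutely_continuous_fun_on {0..T} \<phi>"
  proof (rule absolutely_continuous_fun_onI_L2[OF f, of _ "4 * Kw * Ky"])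
    fix u v :: real assume uv: "0 \<le> u" "u \<le> v" "v \<le> T"
    let ?I = "integral {u..v} (\<lambda>s. \<bar>f s\<bar>)"
    have 1: "norm (y v - y u) \<le> Kw * ?I"
      unfolding y_def by (rule integral_L2_diff_le[OF f w Kw(2) uv])
    have 2: "norm (z v - z u) \<le> (Kw * Ky) * ?I"
      unfolding z_def using Kw Ky
      by (intro integral_L2_diff_le[OF f wyc _ uv]) (auto simp: norm_mult intro!: mult_mono)
    have "\<phi> v - \<phi> u = (y v - y u) * (y v + y u) - 2 * (z v - z u)"
      by (simp add: \<phi>_def power2_eq_square algebra_simps)
    then have "norm (\<phi> v - \<phi> u) \<le> norm (y v - y u) * norm (y v + y u) + 2 * norm (z v - z u)"
      by (metis norm_triangle_ineq4 norm_mult norm_numeral)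
    also have "\<dots> \<le> (Kw * ?I) * (2 * Ky) + 2 * ((Kw * Ky) * ?I)"
    proof (intro add_mono mult_mono 1 2 order_refl)
      show "norm (y v + y u) \<le> 2 * Ky"
        using norm_triangle_ineq[of "y v" "y u"] Ky(2)[of u] Ky(2)[of v] uv by auto
      show "0 \<le> Kw * ?I" using 1 norm_ge_zero order_trans by blast
    qed auto
    also have "\<dots> \<le> 4 * Kw * Ky * ?I + 4 * Kw * Ky * (v - u)"
      using Kw(1) Ky(1) uv by simp
    finally show "norm (\<phi> v - \<phi> u) \<le> \<dots>" .
  qed
  moreover obtain N1 where N1: "negligible N1"
    "\<And>t. t \<in> {0..T} - N1 \<Longrightarrow> (y has_vector_derivative f t *\<^sub>R w t) (at t within {0..T})"
    unfolding y_def using integral_has_vector_derivative_ae[OF L2_scaleR_continuous[OF f w]] by blast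
  moreover obtain N2 where N2: "negligible N2"
    "\<And>t. t \<in> {0..T} - N2 \<Longrightarrow> (z has_vector_derivative f t *\<^sub>R (w t * y t)) (at t within {0..T})"
    unfolding z_def[abs_def] using integral_has_vector_derivative_ae[OF L2_scaleR_continuous[OF f wyc]] by blast
  moreover have "negligible (N1 \<union> N2)" using N1(1) N2(1) by simp
  moreover have "(\<phi> has_vector_derivative 0) (at t within {0..T})" if t: "t \<in> {0..T} - (N1 \<union> N2)" for t
  proof -
    have "((\<lambda>t. y t * y t - 2 * z t) has_vector_derivative
        (y t * (f t *\<^sub>R w t) + (f t *\<^sub>R w t) * y t - 2 * (f t *\<^sub>R (w t * y t)))) (at t within {0..T})"
      using t by (intro has_vector_derivative_diff has_vector_derivative_mult has_vector_derivative_mult_right N1(2) N2(2)) auto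
    moreover have "y t * (f t *\<^sub>R w t) + (f t *\<^sub>R w t) * y t - 2 * (f t *\<^sub>R (w t * y t)) = 0"
      by (simp add: scaleR_conv_of_real)
    ultimately show ?thesis by (simp add: \<phi>_def[abs_def] power2_eq_square)
  qed
  ultimately have "\<phi> T = \<phi> 0"
    using T by (intro absolutely_continuous_zero_derivative_imp_const[of T \<phi> "N1 \<union> N2"]) auto
  then show ?thesis by (simp add: \<phi>_def z_def y_def)
qed

text \<open>Polarisation of the objective minus \<open>l3\<close>, with \<open>l1 - l3\<close> and
  \<open>l3 - l2\<close> as parameters; the inner product on complex numbers is the real part of
  \<open>x * cnj y\<close>.\<close>

definition pop :: "real \<Rightarrow> real \<Rightarrow> complex^3^3 \<Rightarrow> complex^3^3 \<Rightarrow> real" where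
  "pop a b X Y = a * (X $ 1 $ 3 \<bullet> Y $ 1 $ 3) - b * (X $ 2 $ 3 \<bullet> Y $ 2 $ 3)"

lemma bounded_bilinear_pop: "bounded_bilinear (pop a b)"
proof
  show "\<exists>K. \<forall>X Y. norm (pop a b X Y) \<le> norm X * norm Y * K"
  proof (intro exI allI)
    fix X Y :: "complex^3^3"
    have *: "\<bar>X $ i $ j \<bullet> Y $ i $ j\<bar> \<le> norm X * norm Y" for i j
      by (rule order_trans[OF Cauchy_Schwarz_ineq2]) (intro mult_mono norm_entry_le, auto)
    have "\<bar>pop a b X Y\<bar> \<le> \<bar>a\<bar> * \<bar>X $ 1 $ 3 \<bullet> Y $ 1 $ 3\<bar> + \<bar>b\<bar> * \<bar>X $ 2 $ 3 \<bullet> Y $ 2 $ 3\<bar>"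
      unfolding pop_def abs_mult[symmetric] by (rule abs_triangle_ineq4)
    also have "\<dots> \<le> \<bar>a\<bar> * (norm X * norm Y) + \<bar>b\<bar> * (norm X * norm Y)"
      by (intro add_mono mult_left_mono *) auto
    finally show "norm (pop a b X Y) \<le> norm X * norm Y * (\<bar>a\<bar> + \<bar>b\<bar>)"
      by (simp add: algebra_simps)
  qed
qed (simp_all add: pop_def inner_add_left inner_add_right algebra_simps)

section \<open>Dyson terms of the three-level system: parity and resonance\<close>

locale driven_three_level = three_level h1 h2 h3 v12 v23
  for h1 h2 h3 :: real and v12 v23 :: complex +
  fixes T l1 l2 l3 :: real
  assumes T: "0 < T" and v12: "v12 \<noteq> 0" and v23: "v23 \<noteq> 0" and l13: "l3 < l1" and l32: "l2 < l3"
begin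

abbreviation J :: "(real \<Rightarrow> real) \<Rightarrow> real" where
  "J \<equiv> objective H0 V (diag3 0 0 1) (diag3 l1 l2 l3) T"

sublocale volterra T M B
  using T by (rule volterra_B)

sublocale quadratic_objective T M B "mat 1" "pop (l1 - l3) (l3 - l2)" l3 J
proof (intro quadratic_objective.intro quadratic_objective_axioms.intro volterra_axioms bounded_bilinear_pop)
  fix f assume f: "f \<in> L2 T"
  have "solves f (\<lambda>_. mat 1) (sol f (\<lambda>_. mat 1))"
    by (intro sol_solves f continuous_intros)
  from objective_eq[OF T f this] show "J f = l3 + pop (l1 - l3) (l3 - l2) (sol f (\<lambda>t. mat 1) T) (sol f (\<lambda>t. mat 1) T)"
    by (simp add: pop_def power2_norm_eq_inner)
qed

lemma W_nth: "W t $ i $ k = - \<i> * V $ i $ k * cis ((level i - level k) * t)"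
  by (simp add: W_def)

lemma volt_nth:
  assumes "d \<in> L2 T" "continuous_on {0..T} y" "t \<in> {0..T}"
  shows "volt d y t $ i $ j = integral {0..t} (\<lambda>s. d s *\<^sub>R (\<Sum>k\<in>UNIV. W s $ i $ k * y s $ k $ j))"
proof -
  have "integral {0..t} ((\<lambda>X. X $ i $ j) \<circ> (\<lambda>s. d s *\<^sub>R B s (y s))) = volt d y t $ i $ j"
    unfolding volt_def using assms by (intro integral_linear volt_integrable bounded_linear_entry) auto
  then show ?thesis by (simp add: o_def B_def matrix_matrix_mult_def)
qed

text \<open>The coupling changes the parity of the level, so odd orders only populate level 2.\<close>

lemma dyson_parity:
  assumes d: "d \<in> L2 T" and t: "t \<in> {0..T}"
  shows "(even n \<longrightarrow> dyson d n t $ 2 $ 3 = 0) \<and> (odd n \<longrightarrow> dyson d n t $ 1 $ 3 = 0 \<and> dyson d n t $ 3 $ 3 = 0)"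
  using t
proof (induction n arbitrary: t)
  case 0
  then show ?case by (simp add: mat_def)
next
  case (Suc n)
  have eq: "dyson d (Suc n) t $ i $ 3 = integral {0..t} (\<lambda>s. d s *\<^sub>R (\<Sum>k\<in>UNIV. W s $ i $ k * dyson d n s $ k $ 3))" for i
    using volt_nth[OF d dyson_continuous[OF d] Suc.prems] by simp
  have zero: "dyson d (Suc n) t $ i $ 3 = 0" if "\<And>s. s \<in> {0..t} \<Longrightarrow> (\<Sum>k\<in>UNIV. W s $ i $ k * dyson d n s $ k $ 3) = 0" for i
  proof -
    have "dyson d (Suc n) t $ i $ 3 = integral {0..t} (\<lambda>s. 0)"
      unfolding eq by (rule integral_cong) (simp add: that)
    then show ?thesis by simp
  qed
  have IH: "(even n \<longrightarrow> dyson d n s $ 2 $ 3 = 0) \<and> (odd n \<longrightarrow> dyson d n s $ 1 $ 3 = 0 \<and> dyson d n s $ 3 $ 3 = 0)"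
    if "s \<in> {0..t}" for s
    using that Suc by auto
  show ?case
  proof (cases "even n")
    case True
    then have "dyson d (Suc n) t $ 1 $ 3 = 0" "dyson d (Suc n) t $ 3 $ 3 = 0"
      using IH by (intro zero; simp add: sum_3 W_nth)+
    then show ?thesis using True by simp
  next
    case False
    then have "dyson d (Suc n) t $ 2 $ 3 = 0"
      using IH by (intro zero) (simp add: sum_3 W_nth)
    then show ?thesis using False by simp
  qed
qed

lemma dyson_1_entry:
  assumes d: "d \<in> L2 T" and t: "t \<in> {0..T}"
  shows "dyson d 1 t $ 2 $ 3 = integral {0..t} (\<lambda>s. d s *\<^sub>R (- \<i> * v23 * cis ((h2 - h3) * s)))"
  using volt_nth[OF d _ t, of "\<lambda>_. mat 1" 2 3]
  by (simp add: sum_3 W_nth mat_def continuous_intros)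

text \<open>Equal frequencies give the transitions from 3 to 2 and from 2 to 1 the same phase, so
  \<open>W s $ 1 $ 2\<close> is \<open>v12 / v23\<close> times the entry \<open>w s\<close> that
  drives the first Dyson term. The iterated integral then pairs an antiderivative with its own
  derivative, which produces half a square.\<close>

lemma dyson_2_harmonic:
  assumes d: "d \<in> L2 T" and h: "h2 - h1 = h3 - h2"
  shows "dyson d 2 T $ 1 $ 3 = v12 / v23 * (dyson d 1 T $ 2 $ 3)\<^sup>2 / 2"
proof -
  define w where "w s = - \<i> * v23 * cis ((h2 - h3) * s)" for s
  define y where "y t = integral {0..t} (\<lambda>s. d s *\<^sub>R w s)" for t
  have TT: "T \<in> {0..T}" using T by simp
  have wc: "continuous_on {0..T} w" unfolding w_def[abs_def] by (intro continuous_intros)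
  have y: "dyson d 1 s $ 2 $ 3 = y s" if "s \<in> {0..T}" for s
    using dyson_1_entry[OF d that] by (simp add: y_def w_def)
  have yc: "continuous_on {0..T} y"
    unfolding y_def[abs_def] using d wc by (intro indefinite_integral_continuous_1 L2_scaleR_continuous_integrable) auto
  have "dyson d 2 T $ 1 $ 3 = integral {0..T} (\<lambda>s. d s *\<^sub>R (\<Sum>k\<in>UNIV. W s $ 1 $ k * dyson d 1 s $ k $ 3))"
    using volt_nth[OF d dyson_continuous[OF d] TT, of 1 1 3] by (simp add: numeral_2_eq_2)
  also have "\<dots> = integral {0..T} (\<lambda>s. v12 / v23 * (d s *\<^sub>R (w s * y s)))"
  proof (rule integral_cong)
    fix s assume s: "s \<in> {0..T}"
    have "h1 - h2 = h2 - h3" using h by simp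
    then have c: "W s $ 1 $ 2 = v12 / v23 * w s"
      unfolding W_nth level_simps w_def using v23 by (simp only:) simp
    have "W s $ 1 $ 1 = 0" "W s $ 1 $ 3 = 0" by (simp_all add: W_nth)
    then show "d s *\<^sub>R (\<Sum>k\<in>UNIV. W s $ 1 $ k * dyson d 1 s $ k $ 3) = v12 / v23 * (d s *\<^sub>R (w s * y s))"
      unfolding sum_3 y[OF s] c by simp
  qed
  also have "\<dots> = v12 / v23 * integral {0..T} (\<lambda>s. d s *\<^sub>R (w s * y s))"
    by (rule integral_mult_right)
  also have "integral {0..T} (\<lambda>s. d s *\<^sub>R (w s * y s)) = (y T)\<^sup>2 / 2"
    unfolding y_def using T by (intro integral_times_antiderivative d wc) auto
  finally show ?thesis using y[OF TT] by simp
qed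

section \<open>Scaling and signs of the Taylor coefficients\<close>

lemma dyson_cmult:
  assumes "t \<in> {0..T}"
  shows "dyson (\<lambda>t. c * d t) n t = c ^ n *\<^sub>R dyson d n t"
  using assms
proof (induction n arbitrary: t)
  case (Suc n)
  have "dyson (\<lambda>t. c * d t) (Suc n) t = volt (\<lambda>t. c * d t) (\<lambda>s. c ^ n *\<^sub>R dyson d n s) t"
    using Suc by (simp, intro volt_cong) auto
  also have "\<dots> = c *\<^sub>R volt d (\<lambda>s. c ^ n *\<^sub>R dyson d n s) t" by (rule volt_control_cmult)
  finally show ?case by (simp add: volt_cmult)
qed simp

lemma taylor_cmult: "taylor (\<lambda>t. c * d t) k = c ^ k * taylor d k"
proof -
  have "T \<in> {0..T}" using T by simp
  then have "taylor (\<lambda>t. c * d t) k = (\<Sum>i\<le>k. c ^ k * pop (l1 - l3) (l3 - l2) (dyson d i T) (dyson d (k - i) T))"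
    unfolding taylor_def
  proof (intro sum.cong refl)
    fix i assume "T \<in> {0..T}" "i \<in> {..k}"
    then have "c ^ k = c ^ i * c ^ (k - i)" by (simp flip: power_add)
    then show "pop (l1 - l3) (l3 - l2) (dyson (\<lambda>t. c * d t) i T) (dyson (\<lambda>t. c * d t) (k - i) T) =
        c ^ k * pop (l1 - l3) (l3 - l2) (dyson d i T) (dyson d (k - i) T)"
      by (simp add: dyson_cmult[OF \<open>T \<in> {0..T}\<close>] \<beta>.scaleR_left \<beta>.scaleR_right)
  qed
  then show ?thesis by (simp add: taylor_def sum_distrib_left)
qed

lemma pop_dyson:
  assumes "d \<in> L2 T"
  shows "odd i \<Longrightarrow> odd j \<Longrightarrow> pop a b (dyson d i T) (dyson d j T) = - b * (dyson d i T $ 2 $ 3 \<bullet> dyson d j T $ 2 $ 3)"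
    and "even i \<Longrightarrow> even j \<Longrightarrow> pop a b (dyson d i T) (dyson d j T) = a * (dyson d i T $ 1 $ 3 \<bullet> dyson d j T $ 1 $ 3)"
    and "odd (i + j) \<Longrightarrow> pop a b (dyson d i T) (dyson d j T) = 0"
proof -
  have "T \<in> {0..T}" using T by simp
  note p = dyson_parity[OF assms this]
  show "odd i \<Longrightarrow> odd j \<Longrightarrow> pop a b (dyson d i T) (dyson d j T) = - b * (dyson d i T $ 2 $ 3 \<bullet> dyson d j T $ 2 $ 3)"
    "even i \<Longrightarrow> even j \<Longrightarrow> pop a b (dyson d i T) (dyson d j T) = a * (dyson d i T $ 1 $ 3 \<bullet> dyson d j T $ 1 $ 3)"
    "odd (i + j) \<Longrightarrow> pop a b (dyson d i T) (dyson d j T) = 0"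
    unfolding pop_def using p[of i] p[of j] by auto
qed

lemma dyson_0_entry: "dyson d 0 t $ 1 $ 3 = 0"
  by (simp add: mat_def)

lemma taylor_odd:
  assumes "d \<in> L2 T" "odd k"
  shows "taylor d k = 0"
  unfolding taylor_def
proof (rule sum.neutral, rule ballI)
  fix i assume "i \<in> {..k}"
  then have "odd (i + (k - i))" using assms by simp
  then show "pop (l1 - l3) (l3 - l2) (dyson d i T) (dyson d (k - i) T) = 0"
    by (rule pop_dyson(3)[OF assms(1)])
qed

lemma taylor_0: "taylor d 0 = 0"
  unfolding taylor_def pop_def by (simp add: mat_def)

lemma taylor_2:
  assumes "d \<in> L2 T"
  shows "taylor d 2 = - (l3 - l2) * (norm (dyson d 1 T $ 2 $ 3))\<^sup>2"
proof -
  have "{..2::nat} = {0, 1, 2}" by auto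
  then show ?thesis
    using pop_dyson(1)[OF assms, of 1 1] pop_dyson(2)[OF assms, of 0 2] pop_dyson(2)[OF assms, of 2 0]
    unfolding taylor_def by (simp add: mat_def power2_norm_eq_inner algebra_simps)
qed

text \<open>In order 4 every product contains \<open>dyson d 1 T $ 2 $ 3\<close>,
  \<open>dyson d 2 T $ 1 $ 3\<close> or an entry of order 0; in order 6 only the pairing of order 3
  with itself escapes. A weak sign is enough, since the sign condition on \<open>R\<close> lets it
  vanish along a line.\<close>

lemma taylor_4_6:
  assumes d: "d \<in> L2 T" and h: "h2 - h1 = h3 - h2" and z: "dyson d 1 T $ 2 $ 3 = 0"
  shows "taylor d 4 = 0" "taylor d 6 \<le> 0"
proof -
  have z2: "dyson d 2 T $ 1 $ 3 = 0"
    using dyson_2_harmonic[OF d h] z by simp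
  note e = pop_dyson(2)[OF d]
  note o = pop_dyson(1)[OF d]
  have "{..4::nat} = {0, 1, 2, 3, 4}" by auto
  then have "taylor d 4 = (\<Sum>i\<in>{0, 1, 2, 3, 4}. pop (l1 - l3) (l3 - l2) (dyson d i T) (dyson d (4 - i) T))"
    unfolding taylor_def by simp
  also have "\<dots> = pop (l1 - l3) (l3 - l2) (dyson d 0 T) (dyson d 4 T) + pop (l1 - l3) (l3 - l2) (dyson d 1 T) (dyson d 3 T)
      + pop (l1 - l3) (l3 - l2) (dyson d 2 T) (dyson d 2 T) + pop (l1 - l3) (l3 - l2) (dyson d 3 T) (dyson d 1 T)
      + pop (l1 - l3) (l3 - l2) (dyson d 4 T) (dyson d 0 T)"
    by (simp del: funpow.simps)
  also have "\<dots> = 0"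
    using e[of 0 4] o[of 1 3] e[of 2 2] o[of 3 1] e[of 4 0] by (simp only: dyson_0_entry z z2) simp
  finally show "taylor d 4 = 0" .
  have "{..6::nat} = {0, 1, 2, 3, 4, 5, 6}" by auto
  then have "taylor d 6 = (\<Sum>i\<in>{0, 1, 2, 3, 4, 5, 6}. pop (l1 - l3) (l3 - l2) (dyson d i T) (dyson d (6 - i) T))"
    unfolding taylor_def by simp
  also have "\<dots> = pop (l1 - l3) (l3 - l2) (dyson d 0 T) (dyson d 6 T) + pop (l1 - l3) (l3 - l2) (dyson d 1 T) (dyson d 5 T)
      + pop (l1 - l3) (l3 - l2) (dyson d 2 T) (dyson d 4 T) + pop (l1 - l3) (l3 - l2) (dyson d 3 T) (dyson d 3 T)
      + pop (l1 - l3) (l3 - l2) (dyson d 4 T) (dyson d 2 T) + pop (l1 - l3) (l3 - l2) (dyson d 5 T) (dyson d 1 T)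
      + pop (l1 - l3) (l3 - l2) (dyson d 6 T) (dyson d 0 T)"
    by (simp del: funpow.simps)
  also have "\<dots> = - (l3 - l2) * (dyson d 3 T $ 2 $ 3 \<bullet> dyson d 3 T $ 2 $ 3)"
    using e[of 0 6] o[of 1 5] e[of 2 4] o[of 3 3] e[of 4 2] o[of 5 1] e[of 6 0]
    by (simp only: dyson_0_entry z z2) (simp add: algebra_simps)
  also have "\<dots> \<le> 0" using l32 by (intro mult_nonpos_nonneg) auto
  finally show "taylor d 6 \<le> 0" .
qed

lemma J_zero: "J (\<lambda>t. 0) = l3"
proof -
  have "sol (\<lambda>t. 0) (\<lambda>t. mat 1) T = mat 1"
    using sol_solves[OF L2_zero, of "\<lambda>t. mat 1"] T by (simp add: solves_def)
  then show ?thesis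
    using J_eq[OF L2_zero] by (simp add: pop_def mat_def)
qed

text \<open>Resonant control: taking the real part of the phase as control turns the real part of
  the integral into that of a squared cosine, which is positive for every transition frequency, zero
  included.\<close>

lemma ex_dyson_1_nonzero: "\<exists>d\<in>L2 T. dyson d 1 T $ 2 $ 3 \<noteq> 0"
proof
  define d where "d s = cos ((h2 - h3) * s)" for s
  have dc: "continuous_on {0..T} d" unfolding d_def[abs_def] by (intro continuous_intros)
  show d: "d \<in> L2 T" by (rule L2_continuous[OF dc])
  have TT: "T \<in> {0..T}" using T by simp
  have ic: "(\<lambda>s. d s *\<^sub>R cis ((h2 - h3) * s)) integrable_on {0..T}"
    by (intro integrable_continuous_real continuous_intros dc)
  have "dyson d 1 T $ 2 $ 3 = integral {0..T} (\<lambda>s. (- \<i> * v23) * (d s *\<^sub>R cis ((h2 - h3) * s)))"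
    unfolding dyson_1_entry[OF d TT] by (simp add: mult_ac)
  also have "\<dots> = (- \<i> * v23) * integral {0..T} (\<lambda>s. d s *\<^sub>R cis ((h2 - h3) * s))"
    by (rule integral_mult_right)
  finally have eq: "dyson d 1 T $ 2 $ 3 = \<dots>" .
  have "Re (integral {0..T} (\<lambda>s. d s *\<^sub>R cis ((h2 - h3) * s))) = integral {0..T} (\<lambda>s. (d s)\<^sup>2)"
    using integral_linear[OF ic bounded_linear_Re] by (simp add: o_def d_def power2_eq_square)
  also have "\<dots> \<noteq> 0"
  proof
    assume "integral {0..T} (\<lambda>s. (d s)\<^sup>2) = 0"
    moreover have "continuous_on {0..T} (\<lambda>s. (d s)\<^sup>2)" by (intro continuous_intros dc)
    ultimately have "\<forall>s\<in>{0..T}. (d s)\<^sup>2 = 0"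
      using T integral_eq_0_iff[of 0 T "\<lambda>s. (d s)\<^sup>2"] by auto
    then show False using T by (auto simp: d_def dest!: bspec[of _ _ 0])
  qed
  finally have "integral {0..T} (\<lambda>s. d s *\<^sub>R cis ((h2 - h3) * s)) \<noteq> 0" by auto
  then show "dyson d 1 T $ 2 $ 3 \<noteq> 0" using v23 unfolding eq by simp
qed

lemma trap_of_orderI:
  assumes n: "1 \<le> n"
    and better: "\<exists>g\<in>L2 T. J (\<lambda>t. 0) < J g"
    and nonzero: "\<exists>d\<in>L2 T. (\<Sum>j=2..n. taylor d j) \<noteq> 0"
    and sign: "\<And>d. d \<in> L2 T \<Longrightarrow> \<exists>\<epsilon>>0. \<forall>s\<in>{-\<epsilon><..<\<epsilon>}. (\<Sum>j=2..n. s ^ j * taylor d j) \<le> 0"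
  shows "trap_of_order n T J (\<lambda>t. 0)"
proof -
  \<comment> \<open>\<open>trap_of_order\<close> prescribes \<open>R\<close> on all functions, while
    the link to \<open>taylor\<close> holds on \<open>L2 T\<close>; hence \<open>R\<close> is
    defined through \<open>diffl\<close>.\<close>
  define R where "R d = (\<Sum>j=2..n. diffl (\<lambda>t. 0) (replicate j d) / fact j)" for d
  have R: "R d = (\<Sum>j=2..n. taylor d j)" if "d \<in> L2 T" for d
    unfolding R_def by (intro sum.cong) (auto simp: diffl_zero[OF that])
  \<comment> \<open>Starting the sum at 2 loses nothing: order 0 vanishes because the identity has
    zero entries at (1,3) and (2,3), order 1 by parity.\<close>
  have "(\<Sum>k\<le>n. taylor d k) = (\<Sum>j=2..n. taylor d j)" if "d \<in> L2 T" for d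
  proof -
    have "{..n} = {0, 1} \<union> {2..n}" using n by auto
    then have "(\<Sum>k\<le>n. taylor d k) = (\<Sum>k\<in>{0, 1}. taylor d k) + (\<Sum>j=2..n. taylor d j)"
      by (simp add: sum.union_disjoint)
    then show ?thesis using taylor_0 taylor_odd[OF that, of 1] by simp
  qed
  then have expansion: "\<exists>\<delta>>0. \<forall>d\<in>L2 T. L2norm T d < \<delta> \<longrightarrow> \<bar>J (\<lambda>t. 0 + d t) - (J (\<lambda>t. 0) + R d)\<bar> \<le> \<epsilon> * L2norm T d ^ n"
    if "\<epsilon> > 0" for \<epsilon>
    using taylor_expansion[OF that, of n] by (simp add: J_zero R)
  show ?thesis
    unfolding trap_of_order_def
  proof (intro conjI exI[of _ "\<lambda>j. diffl (\<lambda>t. 0)"] exI[of _ R])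
    show "(\<lambda>t. 0) \<in> L2 T" by (rule L2_zero)
    show "\<not> (\<forall>g\<in>L2 T. J g \<le> J (\<lambda>t. 0))" using better by (auto simp: not_le)
    show "\<forall>j\<in>{1..n}. has_frechet_differential T J j (\<lambda>t. 0) (diffl (\<lambda>t. 0))"
      using has_frechet_differential_diffl[OF L2_zero] by blast
    show "\<forall>d. R d = (\<Sum>j = 2..n. diffl (\<lambda>t. 0) (replicate j d) / fact j)" by (simp add: R_def)
    show "\<forall>\<epsilon>>0. \<exists>\<delta>>0. \<forall>d\<in>L2 T. L2norm T d < \<delta> \<longrightarrow> \<bar>J (\<lambda>t. 0 + d t) - (J (\<lambda>t. 0) + R d)\<bar> \<le> \<epsilon> * L2norm T d ^ n"
      using expansion by blast
    show "\<exists>d\<in>L2 T. R d \<noteq> 0" using nonzero by (auto simp: R)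
    show "\<forall>d\<in>L2 T. \<exists>\<epsilon>>0. \<forall>s\<in>{- \<epsilon><..<\<epsilon>}. R (\<lambda>t. s * d t) \<le> 0"
      using sign by (simp add: R L2_cmult taylor_cmult)
  qed
qed

section \<open>The strong short pulse and better values of the objective\<close>

definition rabi :: real where "rabi = sqrt ((norm v12)\<^sup>2 + (norm v23)\<^sup>2)"

lemma rabi_pos: "0 < rabi"
  using v12 by (simp add: rabi_def add_pos_nonneg)

lemma rabi_power2: "rabi\<^sup>2 = (norm v12)\<^sup>2 + (norm v23)\<^sup>2"
  by (simp add: rabi_def)

text \<open>\<open>pulse s = e\<^bsup>-isV\<^esup>\<close>, in closed form because \<open>V\<^sup>3 = rabi\<^sup>2 V\<close>.\<close>

definition pulse :: "real \<Rightarrow> complex^3^3" where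
  "pulse s = mat 1 + (sin (rabi * s) / rabi) *\<^sub>R W 0 + ((1 - cos (rabi * s)) / rabi\<^sup>2) *\<^sub>R (W 0 ** W 0)"

text \<open>Cayley-Hamilton for \<open>- i V\<close>, whose trace and determinant vanish; the
  nonzero eigenvalues of \<open>V\<close> are \<open>rabi\<close> and \<open>- rabi\<close>. This
  reduces the exponential series to a combination of the identity, \<open>W 0\<close> and its
  square.\<close>

lemma W0_cubed: "W 0 ** (W 0 ** W 0) = - (rabi\<^sup>2) *\<^sub>R W 0"
proof -
  have r: "complex_of_real (rabi\<^sup>2) = v12 * cnj v12 + v23 * cnj v23"
    by (simp add: rabi_power2 flip: complex_norm_square)
  have "(W 0 ** (W 0 ** W 0)) $ i $ j = - (complex_of_real (rabi\<^sup>2)) * W 0 $ i $ j" for i j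
    unfolding r using exhaust_3[of i] exhaust_3[of j]
    by (auto simp: matrix_matrix_mult_def sum_3 W_nth algebra_simps)
  then show ?thesis
    by (simp add: vec_eq_iff scaleR_conv_of_real[where 'a=complex])
qed

lemma pulse_has_vector_derivative:
  "(pulse has_vector_derivative B 0 (pulse s)) (at s within S)"
proof -
  have "(pulse has_vector_derivative (cos (rabi * s)) *\<^sub>R W 0 + (sin (rabi * s) / rabi) *\<^sub>R (W 0 ** W 0)) (at s within S)"
  proof -
    have 1: "((\<lambda>s. sin (rabi * s) / rabi) has_real_derivative cos (rabi * s)) (at s within S)"
      using rabi_pos by (auto intro!: derivative_eq_intros)
    have 2: "((\<lambda>s. (1 - cos (rabi * s)) / rabi\<^sup>2) has_real_derivative sin (rabi * s) / rabi) (at s within S)"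
      using rabi_pos by (auto intro!: derivative_eq_intros simp: power2_eq_square)
    have "((\<lambda>s. mat 1 + (sin (rabi * s) / rabi) *\<^sub>R W 0 + ((1 - cos (rabi * s)) / rabi\<^sup>2) *\<^sub>R (W 0 ** W 0))
        has_vector_derivative 0 + ((sin (rabi * s) / rabi) *\<^sub>R 0 + cos (rabi * s) *\<^sub>R W 0)
          + (((1 - cos (rabi * s)) / rabi\<^sup>2) *\<^sub>R 0 + (sin (rabi * s) / rabi) *\<^sub>R (W 0 ** W 0))) (at s within S)"
      by (intro has_vector_derivative_add has_vector_derivative_const has_vector_derivative_scaleR 1 2)
    then show ?thesis by (simp add: pulse_def[abs_def])
  qed
  moreover have "B 0 (pulse s) = (cos (rabi * s)) *\<^sub>R W 0 + (sin (rabi * s) / rabi) *\<^sub>R (W 0 ** W 0)"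
  proof -
    have "B 0 (pulse s) = W 0 + (sin (rabi * s) / rabi) *\<^sub>R (W 0 ** W 0) + ((1 - cos (rabi * s)) / rabi\<^sup>2) *\<^sub>R (- (rabi\<^sup>2) *\<^sub>R W 0)"
      unfolding pulse_def linear_add[OF linear_B] linear_cmul[OF linear_B] by (simp add: B_def W0_cubed)
    also have "((1 - cos (rabi * s)) / rabi\<^sup>2) *\<^sub>R (- (rabi\<^sup>2) *\<^sub>R W 0) = (cos (rabi * s) - 1) *\<^sub>R W 0"
      using rabi_pos by (simp flip: scaleR_minus_left)
    finally show ?thesis by (simp add: algebra_simps)
  qed
  ultimately show ?thesis by simp
qed

text \<open>Half a Rabi period: the sine vanishes and only the square of \<open>W 0\<close> remains
  beside the identity. Two applications of the coupling lead from level 3 to level 1 but never to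
  level 2.\<close>

lemma pulse_pi:
  "norm (pulse (pi / rabi) $ 1 $ 3) = 2 * norm v12 * norm v23 / rabi\<^sup>2" "pulse (pi / rabi) $ 2 $ 3 = 0"
proof -
  have "pulse (pi / rabi) = mat 1 + (2 / rabi\<^sup>2) *\<^sub>R (W 0 ** W 0)"
    using rabi_pos by (simp add: pulse_def)
  then show "norm (pulse (pi / rabi) $ 1 $ 3) = 2 * norm v12 * norm v23 / rabi\<^sup>2" "pulse (pi / rabi) $ 2 $ 3 = 0"
    by (simp_all add: mat_def matrix_matrix_mult_def sum_3 W_nth norm_mult)
qed

text \<open>Bounds the rate at which \<open>W s\<close> turns away from \<open>W 0\<close>, in the
  norm estimate of \<open>norm_matrix_mult_le\<close>: each phase moves at the speed of its level
  difference.\<close>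

definition drift :: real where
  "drift = 3 * (\<Sum>i\<in>(UNIV::3 set). \<Sum>k\<in>(UNIV::3 set). norm (V $ i $ k) * \<bar>level i - level k\<bar>)"

lemma drift_nonneg: "0 \<le> drift"
  unfolding drift_def by (intro mult_nonneg_nonneg sum_nonneg) auto

lemma norm_B_diff_le:
  assumes "0 \<le> s"
  shows "norm (B 0 X - B s X) \<le> drift * s * norm X"
proof -
  have "B 0 X - B s X = (W 0 - W s) ** X"
    by (simp add: B_def matrix_matrix_mult_def vec_eq_iff left_diff_distrib sum_subtractf)
  also have "norm \<dots> \<le> (3 * (\<Sum>i\<in>(UNIV::3 set). \<Sum>k\<in>(UNIV::3 set). norm ((W 0 - W s) $ i $ k))) * norm X"
    using norm_matrix_mult_le[of "W 0 - W s" X] by simp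
  also have "\<dots> \<le> (3 * (\<Sum>i\<in>(UNIV::3 set). \<Sum>k\<in>(UNIV::3 set). norm (V $ i $ k) * \<bar>level i - level k\<bar> * s)) * norm X"
  proof (intro mult_right_mono mult_left_mono sum_mono)
    fix i k
    have "(W 0 - W s) $ i $ k = - \<i> * V $ i $ k * (cis ((level i - level k) * 0) - cis ((level i - level k) * s))"
      by (simp add: W_nth algebra_simps)
    then have "norm ((W 0 - W s) $ i $ k) = norm (V $ i $ k) * norm (cis ((level i - level k) * 0) - cis ((level i - level k) * s))"
      by (simp only: norm_mult norm_minus_cancel norm_ii mult_1)
    also have "\<dots> \<le> norm (V $ i $ k) * \<bar>(level i - level k) * 0 - (level i - level k) * s\<bar>"
      by (intro mult_left_mono norm_cis_diff_le) auto
    finally show "norm ((W 0 - W s) $ i $ k) \<le> norm (V $ i $ k) * \<bar>level i - level k\<bar> * s"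
      using assms by (simp add: abs_mult mult.assoc)
  qed auto
  also have "\<dots> = drift * s * norm X"
    by (simp add: drift_def sum_distrib_right mult.assoc)
  finally show ?thesis .
qed

text \<open>The pulse has the fixed area \<open>A * \<delta> = pi / rabi\<close>. Shortening it
  reduces the rotation of \<open>B s\<close> away from \<open>B 0\<close> while it lasts, so the
  error is of order \<open>\<delta>\<close>, provided that the Gronwall factor stays
  bounded.\<close>

lemma pulse_approximation:
  obtains c where "0 \<le> c" "\<And>\<delta>. 0 < \<delta> \<Longrightarrow> \<delta> \<le> T \<Longrightarrow>
    \<exists>g\<in>L2 T. norm (sol g (\<lambda>t. mat 1) T - pulse (pi / rabi)) \<le> c * \<delta>"
proof -
  have "continuous_on {0..pi / rabi} pulse"
    by (rule continuous_on_vector_derivative[where f' = "\<lambda>s. B 0 (pulse s)"]) (rule pulse_has_vector_derivative)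
  then obtain K where K: "K > 0" "\<And>s. s \<in> {0..pi / rabi} \<Longrightarrow> norm (pulse s) \<le> K"
    using continuous_on_interval_norm_bound by blast
  define G where "G = sqrt 2 * exp (M\<^sup>2 * (pi / rabi)\<^sup>2)"
  define c where "c = G * (pi / rabi * (drift * K))"
  have c: "0 \<le> c"
    unfolding c_def G_def using K drift_nonneg rabi_pos by (intro mult_nonneg_nonneg) auto
  show thesis
  proof (rule that[OF c])
    fix \<delta> assume \<delta>: "0 < \<delta>" "\<delta> \<le> T"
    \<comment> \<open>Gronwall is applied on \<open>{0..\<delta>}\<close> only. There the exponent
      is \<open>M^2 * (A^2 * \<delta>) * \<delta>\<close>, which depends on the area alone; with
      horizon \<open>T\<close> it would grow like \<open>1 / \<delta>\<close>.\<close>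
    interpret D: volterra \<delta> M B using \<delta>(1) by (rule volterra_B)
    define A where "A = pi / (rabi * \<delta>)"
    have A: "A > 0" "A * \<delta> = pi / rabi" using \<delta> rabi_pos by (auto simp: A_def)
    define g where "g s = (if s \<le> \<delta> then A else 0)" for s
    have gm: "g \<in> borel_measurable (lebesgue_on {0..T})"
    proof -
      have "g \<in> borel_measurable borel" unfolding g_def[abs_def] by measurable
      then show ?thesis
        by (simp add: measurable_completion measurable_restrict_space1)
    qed
    have g: "g \<in> L2 T"
      by (rule L2_bounded[OF gm, of A]) (use A in \<open>auto simp: g_def\<close>)
    define C where "C = sol g (\<lambda>t. mat 1)"
    have C: "continuous_on {0..T} C" "\<And>t. t \<in> {0..T} \<Longrightarrow> C t = mat 1 + volt g C t"
      using sol_solves[OF g, of "\<lambda>t. mat 1"] by (auto simp: C_def solves_def)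
    have A2: "(\<lambda>_. A) \<in> L2 \<delta>" by (intro L2_continuous continuous_intros)
    have solC: "D.solves (\<lambda>_. A) (\<lambda>_. mat 1) C"
      unfolding D.solves_def
    proof (intro conjI ballI)
      show "continuous_on {0..\<delta>} C" using C(1) \<delta> by (auto intro: continuous_on_subset)
      fix t assume t: "t \<in> {0..\<delta>}"
      have "volt g C t = volt (\<lambda>_. A) C t"
        unfolding volt_def using t by (intro integral_cong) (auto simp: g_def)
      then show "C t = mat 1 + volt (\<lambda>_. A) C t" using C(2)[of t] t \<delta> by simp
    qed
    define P where "P t = pulse (A * t)" for t
    have P': "(P has_vector_derivative A *\<^sub>R B 0 (P t)) (at t within S)" for t S
    proof -
      have "((\<lambda>t. A * t) has_vector_derivative A) (at t within S)"
        unfolding has_real_derivative_iff_has_vector_derivative[symmetric] by (auto intro!: derivative_eq_intros)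
      from vector_diff_chain_within[OF this pulse_has_vector_derivative] show ?thesis
        by (simp add: o_def P_def[abs_def])
    qed
    have Pc: "continuous_on {0..\<delta>} P"
      by (rule continuous_on_vector_derivative[where f' = "\<lambda>t. A *\<^sub>R B 0 (P t)"]) (rule P')
    have Pb: "norm (P s) \<le> K" if "s \<in> {0..\<delta>}" for s
    proof -
      have "A * s \<le> A * \<delta>" using that A by (intro mult_left_mono) auto
      then show ?thesis unfolding P_def using that A by (intro K(2)) auto
    qed
    define \<eta> where "\<eta> t = integral {0..t} (\<lambda>s. A *\<^sub>R (B 0 (P s) - B s (P s)))" for t
    have BP: "continuous_on {0..\<delta>} (\<lambda>s. B s (P s))" by (rule D.continuous_B[OF Pc])
    have B0P: "continuous_on {0..\<delta>} (\<lambda>s. B 0 (P s))"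
      unfolding B_def matrix_matrix_mult_def by (intro continuous_intros Pc)
    have solP: "D.solves (\<lambda>_. A) (\<lambda>t. mat 1 + \<eta> t) P"
      unfolding D.solves_def
    proof (intro conjI ballI Pc)
      fix t assume t: "t \<in> {0..\<delta>}"
      have sub: "{0..t} \<subseteq> {0..\<delta>}" using t by auto
      have "((\<lambda>s. A *\<^sub>R B 0 (P s)) has_integral P t - P 0) {0..t}"
        using t by (intro fundamental_theorem_of_calculus P') auto
      moreover have "P 0 = mat 1" by (simp add: P_def pulse_def)
      moreover have "integral {0..t} (\<lambda>s. A *\<^sub>R B 0 (P s)) = \<eta> t + volt (\<lambda>_. A) P t"
        unfolding \<eta>_def volt_def
      proof (subst integral_add[symmetric])
        show "(\<lambda>s. A *\<^sub>R (B 0 (P s) - B s (P s))) integrable_on {0..t}" "(\<lambda>s. A *\<^sub>R B s (P s)) integrable_on {0..t}"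
          using continuous_on_subset[OF BP sub] continuous_on_subset[OF B0P sub]
          by (auto intro!: integrable_continuous_real continuous_intros)
      qed (simp add: algebra_simps)
      ultimately show "P t = mat 1 + \<eta> t + volt (\<lambda>_. A) P t"
        by (simp add: has_integral_iff algebra_simps)
    qed
    have \<eta>b: "norm (mat 1 - (mat 1 + \<eta> t)) \<le> pi / rabi * (drift * K) * \<delta>" if t: "t \<in> {0..\<delta>}" for t
    proof -
      have sub: "{0..t} \<subseteq> {0..\<delta>}" using t by auto
      have "norm (\<eta> t) \<le> integral {0..t} (\<lambda>s. A * (drift * \<delta> * K))"
        unfolding \<eta>_def
      proof (rule Henstock_Kurzweil_Integration.integral_norm_bound_integral)
        show "(\<lambda>s. A *\<^sub>R (B 0 (P s) - B s (P s))) integrable_on {0..t}"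
          using continuous_on_subset[OF BP sub] continuous_on_subset[OF B0P sub]
          by (auto intro!: integrable_continuous_real continuous_intros)
        fix s assume s: "s \<in> {0..t}"
        have "norm (B 0 (P s) - B s (P s)) \<le> drift * s * norm (P s)"
          using s by (intro norm_B_diff_le) auto
        also have "\<dots> \<le> drift * \<delta> * K"
          using s t drift_nonneg Pb[of s] by (intro mult_mono) auto
        finally show "norm (A *\<^sub>R (B 0 (P s) - B s (P s))) \<le> A * (drift * \<delta> * K)"
          using A(1) by (simp add: mult_left_mono)
      qed (rule integrable_const_ivl)
      also have "\<dots> = t * (A * (drift * \<delta> * K))" using t by simp
      also have "\<dots> \<le> \<delta> * (A * (drift * \<delta> * K))"
        using t A(1) drift_nonneg \<delta> K by (intro mult_right_mono) auto
      also have "\<dots> = (A * \<delta>) * (drift * K) * \<delta>" by (simp add: mult_ac)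
      finally show ?thesis by (simp add: A(2))
    qed
    have r: "L2norm \<delta> (\<lambda>_. A) = A * sqrt \<delta>"
    proof (rule power2_eq_imp_eq)
      show "(L2norm \<delta> (\<lambda>_. A))\<^sup>2 = (A * sqrt \<delta>)\<^sup>2"
        using \<delta> by (simp add: L2norm_power2[OF A2] power_mult_distrib)
    qed (use A \<delta> in auto)
    have "norm (C \<delta> - P \<delta>) \<le> D.growth (L2norm \<delta> (\<lambda>_. A)) * (pi / rabi * (drift * K) * \<delta>)"
      using D.solves_bound[OF A2 D.solves_diff[OF A2 solC solP] \<eta>b order_refl, of \<delta>] \<delta> by auto
    also have "D.growth (L2norm \<delta> (\<lambda>_. A)) = G"
    proof -
      have "M\<^sup>2 * (A * sqrt \<delta>)\<^sup>2 * \<delta> = M\<^sup>2 * (A * \<delta>)\<^sup>2"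
        using \<delta> by (simp add: power_mult_distrib power2_eq_square[of \<delta>])
      then show ?thesis by (simp add: D.growth_def r G_def A(2))
    qed
    also have "P \<delta> = pulse (pi / rabi)" by (simp add: P_def A(2))
    \<comment> \<open>The control vanishes after \<open>\<delta>\<close>, and in the interaction
      picture the state then stands still.\<close>
    also have "C \<delta> = C T"
    proof -
      have "volt g C \<delta> + integral {\<delta>..T} (\<lambda>s. g s *\<^sub>R B s (C s)) = volt g C T"
        unfolding volt_def using \<delta> volt_integrable[OF g C(1), of T]
        by (intro Henstock_Kurzweil_Integration.integral_combine) auto
      moreover have "integral {\<delta>..T} (\<lambda>s. g s *\<^sub>R B s (C s)) = integral {\<delta>..T} (\<lambda>s. 0)"
        by (rule integral_spike[of "{\<delta>}"]) (auto simp: g_def)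
      ultimately show ?thesis using C(2)[of \<delta>] C(2)[of T] \<delta> by simp
    qed
    finally have "norm (C T - pulse (pi / rabi)) \<le> c * \<delta>" by (simp add: c_def mult.assoc)
    then show "\<exists>g\<in>L2 T. norm (sol g (\<lambda>t. mat 1) T - pulse (pi / rabi)) \<le> c * \<delta>"
      using g by (auto simp: C_def)
  qed
qed

lemma zero_not_maximal: "\<exists>g\<in>L2 T. J (\<lambda>t. 0) < J g"
proof -
  obtain c where c: "0 \<le> c" "\<And>\<delta>. 0 < \<delta> \<Longrightarrow> \<delta> \<le> T \<Longrightarrow>
    \<exists>g\<in>L2 T. norm (sol g (\<lambda>t. mat 1) T - pulse (pi / rabi)) \<le> c * \<delta>"
    using pulse_approximation by blast
  define a b p where "a = l1 - l3" and "b = l3 - l2" and "p = 2 * norm v12 * norm v23 / rabi\<^sup>2"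
  have pos: "0 < a" "0 < b" "0 < p"
    using l13 l32 v12 v23 rabi_pos by (auto simp: a_def b_def p_def)
  \<comment> \<open>Two demands on the error: \<open>q \<le> p / 2\<close> leaves the (1,3) entry at
    least \<open>p / 2\<close>, and the factor \<open>a / (a + b)\<close> gives
    \<open>b * q^2 < a * (p / 2)^2\<close>, because \<open>a * b < (a + b)^2\<close>.\<close>
  define q where "q = p / 2 * (a / (a + b))"
  have q: "0 < q" "q \<le> p / 2"
    using pos mult_left_mono[of "a / (a + b)" 1 "p / 2"] by (auto simp: q_def)
  define \<delta> where "\<delta> = min T (q / (c + 1))"
  have \<delta>: "0 < \<delta>" "\<delta> \<le> T" using T q c by (auto simp: \<delta>_def)
  have "c * \<delta> \<le> (c + 1) * (q / (c + 1))"
    using c(1) q \<delta> by (intro mult_mono) (auto simp: \<delta>_def)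
  then have "c * \<delta> \<le> q" using c(1) by simp
  moreover obtain g where g: "g \<in> L2 T" "norm (sol g (\<lambda>t. mat 1) T - pulse (pi / rabi)) \<le> c * \<delta>"
    using c(2)[OF \<delta>] by blast
  ultimately have close: "norm (sol g (\<lambda>t. mat 1) T - pulse (pi / rabi)) \<le> q" by linarith
  define X where "X = sol g (\<lambda>t. mat 1) T"
  have e: "norm (X $ i $ j - pulse (pi / rabi) $ i $ j) \<le> q" for i j
    using order_trans[OF norm_entry_le[of "X - pulse (pi / rabi)" i j]] close by (simp add: X_def)
  have "p \<le> norm (X $ 1 $ 3) + q"
    using e[of 1 3] norm_triangle_ineq4[of "X $ 1 $ 3" "X $ 1 $ 3 - pulse (pi / rabi) $ 1 $ 3"] pulse_pi(1)
    by (simp add: p_def)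
  then have "p / 2 \<le> norm (X $ 1 $ 3)" using q by linarith
  then have 1: "a * (p / 2)\<^sup>2 \<le> a * (norm (X $ 1 $ 3))\<^sup>2"
    using pos by (intro mult_left_mono power_mono) auto
  have "norm (X $ 2 $ 3) \<le> q" using e[of 2 3] by (simp add: pulse_pi(2))
  then have 2: "b * (norm (X $ 2 $ 3))\<^sup>2 \<le> b * q\<^sup>2"
    using pos by (intro mult_left_mono power_mono) auto
  have "b * q\<^sup>2 = (p / 2)\<^sup>2 * (b * (a / (a + b))\<^sup>2)" unfolding q_def power_mult_distrib by (simp only: mult_ac)
  also have "\<dots> < (p / 2)\<^sup>2 * a"
  proof (rule mult_strict_left_mono)
    have "a * b < (a + b)\<^sup>2" using pos by (simp add: power2_eq_square algebra_simps add_pos_pos)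
    then have "a * (a * b) < a * (a + b)\<^sup>2" using pos by (intro mult_strict_left_mono) auto
    then show "b * (a / (a + b))\<^sup>2 < a"
      using pos by (simp add: power_divide divide_less_eq power2_eq_square mult_ac)
  qed (use pos in auto)
  finally have "0 < a * (norm (X $ 1 $ 3))\<^sup>2 - b * (norm (X $ 2 $ 3))\<^sup>2"
    using 1 2 by (simp add: mult.commute)
  then have "l3 < J g"
    using J_eq[OF g(1)] by (simp add: pop_def X_def a_def b_def power2_norm_eq_inner)
  then show ?thesis using g(1) by (auto simp: J_zero)
qed

section \<open>The zero control as a trap of order three and of order seven\<close>

theorem trap_3: "trap_of_order 3 T J (\<lambda>t. 0)"
proof (rule trap_of_orderI[OF _ zero_not_maximal])
  have eq: "(\<Sum>j=2..3. s ^ j * taylor d j) = s\<^sup>2 * taylor d 2" if "d \<in> L2 T" for s d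
  proof -
    have "{2..3::nat} = {2, 3}" by auto
    then show ?thesis using taylor_odd[OF that, of 3] by simp
  qed
  obtain d where d: "d \<in> L2 T" "dyson d 1 T $ 2 $ 3 \<noteq> 0" using ex_dyson_1_nonzero by blast
  then have "taylor d 2 \<noteq> 0" using l32 by (simp add: taylor_2)
  then show "\<exists>d\<in>L2 T. (\<Sum>j=2..3. taylor d j) \<noteq> 0"
    using eq[OF d(1), of 1] d(1) by (intro bexI[of _ d]) auto
  show "\<exists>\<epsilon>>0. \<forall>s\<in>{-\<epsilon><..<\<epsilon>}. (\<Sum>j=2..3. s ^ j * taylor d j) \<le> 0" if "d \<in> L2 T" for d
    using that l32 by (intro exI[of _ 1]) (auto simp: eq taylor_2 mult_nonneg_nonpos mult_nonpos_nonneg)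
qed simp

lemma quadratic_term_dominates:
  fixes a b c :: real
  assumes "a < 0"
  obtains \<epsilon> where "0 < \<epsilon>" "\<And>s. \<bar>s\<bar> < \<epsilon> \<Longrightarrow> s \<noteq> 0 \<Longrightarrow> s\<^sup>2 * a + s ^ 4 * b + s ^ 6 * c < 0"
proof (rule that)
  \<comment> \<open>For \<open>\<bar>s\<bar> < 1\<close> the higher powers of \<open>s\<close> are
    at most \<open>\<bar>s\<bar>\<close>, so after division by \<open>s^2\<close> the perturbation
    of \<open>a\<close> is at most \<open>\<bar>s\<bar> * (\<bar>b\<bar> + \<bar>c\<bar>)\<close>.
    The \<open>+ 1\<close> guards against \<open>b = c = 0\<close>.\<close>
  define \<epsilon> where "\<epsilon> = min 1 (- a / (\<bar>b\<bar> + \<bar>c\<bar> + 1))"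
  have p: "\<bar>b\<bar> + \<bar>c\<bar> + 1 > 0" by simp
  show "0 < \<epsilon>" using assms p by (simp add: \<epsilon>_def divide_neg_pos)
  fix s assume s: "\<bar>s\<bar> < \<epsilon>" "s \<noteq> 0"
  have s1: "\<bar>s\<bar> < 1" "\<bar>s\<bar> * (\<bar>b\<bar> + \<bar>c\<bar> + 1) < - a"
  proof -
    show "\<bar>s\<bar> < 1" using s by (simp add: \<epsilon>_def)
    have "\<bar>s\<bar> < - a / (\<bar>b\<bar> + \<bar>c\<bar> + 1)" using s by (simp add: \<epsilon>_def)
    then show "\<bar>s\<bar> * (\<bar>b\<bar> + \<bar>c\<bar> + 1) < - a" unfolding pos_less_divide_eq[OF p] .
  qed
  have "s\<^sup>2 * b + s ^ 4 * c \<le> \<bar>s\<bar> * \<bar>b\<bar> + \<bar>s\<bar> * \<bar>c\<bar>"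
  proof (rule add_mono)
    have "s\<^sup>2 * b \<le> \<bar>s\<bar> ^ 2 * \<bar>b\<bar>" by (simp add: mult_left_mono)
    also have "\<dots> \<le> \<bar>s\<bar> ^ 1 * \<bar>b\<bar>" using s1 by (intro mult_right_mono power_decreasing) auto
    finally show "s\<^sup>2 * b \<le> \<bar>s\<bar> * \<bar>b\<bar>" by simp
    have "s ^ 4 * c \<le> \<bar>s\<bar> ^ 4 * \<bar>c\<bar>" by (simp add: mult_left_mono)
    also have "\<dots> \<le> \<bar>s\<bar> ^ 1 * \<bar>c\<bar>" using s1 by (intro mult_right_mono power_decreasing) auto
    finally show "s ^ 4 * c \<le> \<bar>s\<bar> * \<bar>c\<bar>" by simp
  qed
  also have "\<dots> \<le> \<bar>s\<bar> * (\<bar>b\<bar> + \<bar>c\<bar> + 1)" by (simp add: algebra_simps)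
  finally have "a + (s\<^sup>2 * b + s ^ 4 * c) < 0" using s1(2) by linarith
  then have "s\<^sup>2 * (a + (s\<^sup>2 * b + s ^ 4 * c)) < 0" using s(2) by (simp add: mult_pos_neg)
  moreover have "s\<^sup>2 * (a + (s\<^sup>2 * b + s ^ 4 * c)) = s\<^sup>2 * a + s ^ 4 * b + s ^ 6 * c"
    by (simp add: algebra_simps flip: power_add)
  ultimately show "s\<^sup>2 * a + s ^ 4 * b + s ^ 6 * c < 0" by simp
qed

theorem trap_7:
  assumes h: "h2 - h1 = h3 - h2"
  shows "trap_of_order 7 T J (\<lambda>t. 0)"
proof (rule trap_of_orderI[OF _ zero_not_maximal])
  have eq: "(\<Sum>j=2..7. s ^ j * taylor d j) = s\<^sup>2 * taylor d 2 + s ^ 4 * taylor d 4 + s ^ 6 * taylor d 6"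
    if "d \<in> L2 T" for s d
  proof -
    have "{2..7::nat} = {2, 3, 4, 5, 6, 7}" by auto
    then show ?thesis
      using taylor_odd[OF that, of 3] taylor_odd[OF that, of 5] taylor_odd[OF that, of 7] by simp
  qed
  have neg: "taylor d 2 < 0" if "d \<in> L2 T" "dyson d 1 T $ 2 $ 3 \<noteq> 0" for d
    using that l32 by (simp add: taylor_2 mult_neg_pos)
  obtain d where d: "d \<in> L2 T" "dyson d 1 T $ 2 $ 3 \<noteq> 0" using ex_dyson_1_nonzero by blast
  obtain \<epsilon> where \<epsilon>: "0 < \<epsilon>" "\<And>s. \<bar>s\<bar> < \<epsilon> \<Longrightarrow> s \<noteq> 0 \<Longrightarrow> s\<^sup>2 * taylor d 2 + s ^ 4 * taylor d 4 + s ^ 6 * taylor d 6 < 0"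
    using quadratic_term_dominates[OF neg[OF d]] by metis
  show "\<exists>d\<in>L2 T. (\<Sum>j=2..7. taylor d j) \<noteq> 0"
  proof
    \<comment> \<open>At \<open>d\<close> itself the terms of order 2, 4 and 6 might cancel;
      shrinking \<open>d\<close> into the range where the quadratic one dominates rules this
      out.\<close>
    show "(\<lambda>t. \<epsilon> / 2 * d t) \<in> L2 T" by (intro L2_cmult d)
    show "(\<Sum>j=2..7. taylor (\<lambda>t. \<epsilon> / 2 * d t) j) \<noteq> 0"
      unfolding taylor_cmult eq[OF d(1)] using \<epsilon>(2)[of "\<epsilon> / 2"] \<epsilon>(1) by simp
  qed
  fix d assume d: "d \<in> L2 T"
  show "\<exists>\<epsilon>>0. \<forall>s\<in>{-\<epsilon><..<\<epsilon>}. (\<Sum>j=2..7. s ^ j * taylor d j) \<le> 0"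
  proof (cases "dyson d 1 T $ 2 $ 3 = 0")
    case True
    \<comment> \<open>Only the sixth-order term is left, and an even power times a nonpositive
      coefficient has one sign for all \<open>s\<close>, so any threshold will do.\<close>
    then show ?thesis
      using taylor_4_6[OF d h True] by (intro exI[of _ 1]) (simp add: eq[OF d] taylor_2[OF d] mult_nonneg_nonpos)
  next
    case False
    obtain \<epsilon> where \<epsilon>: "0 < \<epsilon>" "\<And>s. \<bar>s\<bar> < \<epsilon> \<Longrightarrow> s \<noteq> 0 \<Longrightarrow> s\<^sup>2 * taylor d 2 + s ^ 4 * taylor d 4 + s ^ 6 * taylor d 6 < 0"
      using quadratic_term_dominates[OF neg[OF d False]] by metis
    show ?thesis
    proof (intro exI[of _ \<epsilon>] conjI ballI \<epsilon>(1))
      show "(\<Sum>j=2..7. s ^ j * taylor d j) \<le> 0" if "s \<in> {-\<epsilon><..<\<epsilon>}" for s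
        unfolding eq[OF d] using \<epsilon>(2)[of s] that by (cases "s = 0") (auto simp: abs_less_iff less_imp_le)
    qed
  qed
qed simp

end

theorem theorem1:
  fixes h1 h2 h3 \<omega>1 \<omega>2 lam1 lam2 lam3 :: real
    and v12 v23 :: complex
    and H0 V \<rho>0 Obs :: "complex^3^3"
  assumes "v12 \<noteq> 0" and "v23 \<noteq> 0"
    and "H0 = diag3 h1 h2 h3" and "V = coupling v12 v23"
    and "\<omega>1 = h2 - h1" and "\<omega>2 = h3 - h2"
    and "lam1 > lam3" and "lam3 > lam2"
    and "Obs = diag3 lam1 lam2 lam3" and "\<rho>0 = diag3 0 0 1"
  shows "\<exists>T0>0. \<forall>T>T0.
    (\<omega>1 \<noteq> \<omega>2 \<longrightarrow> trap_of_order 3 T (objective H0 V \<rho>0 Obs T) (\<lambda>t. 0)) \<and>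
    (\<omega>1 = \<omega>2 \<and> \<omega>1 \<noteq> 0 \<and> cmod v12 \<noteq> cmod v23 \<longrightarrow>
       trap_of_order 7 T (objective H0 V \<rho>0 Obs T) (\<lambda>t. 0))"
\<comment> \<open>Any positive number can serve as the witness, since
  \<open>driven_three_level\<close> asks for \<open>0 < T\<close>.\<close>
proof (intro exI[of _ "1::real"] conjI allI impI)
  fix T :: real assume "1 < T"
  then interpret driven_three_level h1 h2 h3 v12 v23 T lam1 lam2 lam3
    by unfold_locales (use assms in auto)
  show "trap_of_order 3 T (objective H0 V \<rho>0 Obs T) (\<lambda>t. 0)"
    using trap_3 assms by simp
  show "trap_of_order 7 T (objective H0 V \<rho>0 Obs T) (\<lambda>t. 0)"
    if "\<omega>1 = \<omega>2 \<and> \<omega>1 \<noteq> 0 \<and> cmod v12 \<noteq> cmod v23"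
    using trap_7 that assms by simp
qed simp

end
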